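(* With the notation of the context, let $I_W^q$ be the ideal of $\mathbb{R}[\lambda_1,\dots,\lambda_l,q_1,\dots,q_l]$ generated by the polynomials $F_k(\lambda_1,\dots,\lambda_l,-\langle\alpha_1^\vee,\alpha_1^\vee\rangle q_1,\dots,-\langle\alpha_l^\vee,\alpha_l^\vee\rangle q_l)$, $1\le k\le l$. Then the map $$(\mathcal{H}\otimes\mathbb{R}[q_1,\dots,q_l],\star)\to\mathbb{R}[\lambda_1,\dots,\lambda_l,q_1,\dots,q_l]/I_W^q,\qquad f \bmod I_W\mapsto \psi^{-1}(f)\bmod I_W^q,$$ is an isomorphism of $\mathbb{R}[q_1,\dots,q_l]$-algebras.
   Context: $G$ is a connected, simply connected, simple complex Lie group; $\mathfrak{t}$ is the Lie algebra of a maximal torus of a compact real form of $G$ with $W$-invariant inner product $\langle\cdot,\cdot\rangle$ identifying $\mathfrak{t}$ and $\mathfrak{t}^*$; $\Phi$ is the root system, $\alpha_1,\dots,\alpha_l$ simple roots, $\alpha^\vee=2\alpha/\langle\alpha,\alpha\rangle$ coroots, $\lambda_i$ fundamental weights ($\lambda_i(\alpha_j^\vee)=\delta_{ij}$), $W$ the Weyl group with simple reflections $s_i$ and length $l$. $I_W\subset\mathbb{R}[\lambda_1,\dots,\lambda_l]=S(\mathfrak{t}^* )$ is the ideal generated by $W$-invariant polynomials of positive degree, generated by homogeneous algebraically independent $u_1,\dots,u_l$; $\mathcal{H}=\mathbb{R}[\lambda_1,\dots,\lambda_l]/I_W$. Divided differences $\Delta_\alpha f=(f-s_\alpha f)/\alpha$,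 $\Delta_w$ via reduced words, extended $\mathbb{R}[q]$-linearly. For $\alpha\in\Phi^+$, $\alpha^\vee=\sum m_i\alpha_i^\vee$, ${\rm ht}(\alpha^\vee)=\sum m_i$, $q^{\alpha^\vee}=\prod q_i^{m_i}$; $\tilde{\Phi}^+=\{\alpha\in\Phi^+: l(s_\alpha)=2{\rm ht}(\alpha^\vee)-1\}$. $\Lambda_j=\lambda_j+\sum_{\alpha\in\tilde{\Phi}^+}\lambda_j(\alpha^\vee)q^{\alpha^\vee}\Delta_{s_\alpha}$ (commuting operators preserving $I_W\otimes\mathbb{R}[q]$); $\psi(f)=f(\Lambda_1,\dots,\Lambda_l,q_1,\dots,q_l)(1)$ is an $\mathbb{R}[q]$-module automorphism of $\mathbb{R}[\lambda,q]$. The product $\star$ on $\mathcal{H}\otimes\mathbb{R}[q_1,\dots,q_l]$ is $[f]\star[g]=[\psi(\psi^{-1}(f)\psi^{-1}(g))]$ (a commutative associative product). Toda lattice: the Hamiltonian system on $(\mathbb{R}^{2l},\sum_i dr_i\wedge ds_i)$ with Hamiltonian $E=\sum_{i,j}\langle\alpha_i^\vee,\alpha_j^\vee\rangle r_ir_j+\sum_i e^{2s_i}$; it admits $l$ independent integrals of motion $E=F_1,F_2,\dots,F_l$ which are polynomials in $r_1,\dots,r_l,e^{2s_1},\dots,e^{2s_l}$ and satisfy $F_k(\lambda_1,\dots,\lambda_l,0,\dots,0)=u_k(\lambda_1,\dots,\lambda_l)$; $F_k(\cdot,\cdot)$ denotes such a polynomial with $r_i$ replaced by the first group of arguments and $e^{2s_i}$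 by the second. *)

theory Defs
  imports
    "HOL-Analysis.Analysis"
    "HOL-Library.Poly_Mapping"
    "HOL-Algebra.QuotRing"
    "HOL-Algebra.Module"
    "HOL-Algebra.Algebraic_Closure_Type"
begin

type_synonym 'v mpoly = "('v \<Rightarrow>\<^sub>0 nat) \<Rightarrow>\<^sub>0 real"

definition pconst :: "real \<Rightarrow> 'v mpoly" where
  "pconst c = Poly_Mapping.single 0 c"

definition pvar :: "'v \<Rightarrow> 'v mpoly" where
  "pvar v = Poly_Mapping.single (Poly_Mapping.single v 1) 1"

definition psubst :: "('v \<Rightarrow> 'w mpoly) \<Rightarrow> 'v mpoly \<Rightarrow> 'w mpoly" where
  "psubst \<sigma> f =
     (\<Sum>m\<in>Poly_Mapping.keys f. pconst (Poly_Mapping.lookup f m)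
        * (\<Prod>v\<in>Poly_Mapping.keys m. \<sigma> v ^ Poly_Mapping.lookup m v))"

definition peval :: "('v \<Rightarrow> real) \<Rightarrow> 'v mpoly \<Rightarrow> real" where
  "peval x f =
     (\<Sum>m\<in>Poly_Mapping.keys f. Poly_Mapping.lookup f m
        * (\<Prod>v\<in>Poly_Mapping.keys m. x v ^ Poly_Mapping.lookup m v))"

definition homogeneous :: "nat \<Rightarrow> 'v mpoly \<Rightarrow> bool" where
  "homogeneous d f \<longleftrightarrow>
     (\<forall>m\<in>Poly_Mapping.keys f. (\<Sum>v\<in>Poly_Mapping.keys m. Poly_Mapping.lookup m v) = d)"

definition alg_independent :: "('k \<Rightarrow> 'v mpoly) \<Rightarrow> bool" where
  "alg_independent u \<longleftrightarrow> (\<forall>p. psubst u p = 0 \<longrightarrow> p = 0)"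

abbreviation mpoly_ring :: "'v mpoly ring" where
  "mpoly_ring \<equiv> ring_of_type_algebra"

text \<open>
  The index set \<open>{1, \<dots>, l}\<close> is a finite linearly ordered type \<open>'l\<close>. The ring
  \<open>\<real>[\<lambda>\<^sub>1, \<dots>, \<lambda>\<^sub>l, q\<^sub>1, \<dots>, q\<^sub>l]\<close> is \<open>('l + 'l) mpoly\<close>, where \<open>Inl i\<close> is \<open>\<lambda>\<^sub>i\<close> and
  \<open>Inr i\<close> is \<open>q\<^sub>i\<close>; the subrings \<open>\<real>[\<lambda>]\<close> and \<open>\<real>[q]\<close> are copies of \<open>'l mpoly\<close>.
\<close>

definition emb_lam :: "'l mpoly \<Rightarrow> ('l + 'l) mpoly" where
  "emb_lam = psubst (\<lambda>i. pvar (Inl i))"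

definition emb_q :: "'l mpoly \<Rightarrow> ('l + 'l) mpoly" where
  "emb_q = psubst (\<lambda>i. pvar (Inr i))"

definition coroot :: "'a::euclidean_space \<Rightarrow> 'a" where
  "coroot \<alpha> = (2 / (\<alpha> \<bullet> \<alpha>)) *\<^sub>R \<alpha>"

definition reflection :: "'a::euclidean_space \<Rightarrow> 'a \<Rightarrow> 'a" where
  "reflection \<alpha> v = v - (v \<bullet> coroot \<alpha>) *\<^sub>R \<alpha>"

definition root_system :: "'a::euclidean_space set \<Rightarrow> bool" where
  "root_system \<Phi> \<longleftrightarrow>
     finite \<Phi> \<and> 0 \<notin> \<Phi> \<and> span \<Phi> = UNIV \<and>
     (\<forall>\<alpha>\<in>\<Phi>. reflection \<alpha> ` \<Phi> = \<Phi>) \<and>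
     (\<forall>\<alpha>\<in>\<Phi>. \<forall>\<beta>\<in>\<Phi>. \<beta> \<bullet> coroot \<alpha> \<in> \<int>) \<and>
     (\<forall>\<alpha>\<in>\<Phi>. \<forall>c. c *\<^sub>R \<alpha> \<in> \<Phi> \<longrightarrow> c = 1 \<or> c = -1)"

definition irreducible_root_system :: "'a::euclidean_space set \<Rightarrow> bool" where
  "irreducible_root_system \<Phi> \<longleftrightarrow>
     root_system \<Phi> \<and> \<Phi> \<noteq> {} \<and>
     \<not> (\<exists>A B. A \<noteq> {} \<and> B \<noteq> {} \<and> A \<union> B = \<Phi> \<and> (\<forall>\<alpha>\<in>A. \<forall>\<beta>\<in>B. \<alpha> \<bullet> \<beta> = 0))"

definition simple_roots :: "'a::euclidean_space set \<Rightarrow> ('l::finite \<Rightarrow> 'a) \<Rightarrow> bool" where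
  "simple_roots \<Phi> al \<longleftrightarrow>
     inj al \<and> range al \<subseteq> \<Phi> \<and> independent (range al) \<and>
     (\<forall>\<beta>\<in>\<Phi>. \<exists>c::'l \<Rightarrow> nat. \<beta> = (\<Sum>i\<in>UNIV. real (c i) *\<^sub>R al i)
                          \<or> \<beta> = - (\<Sum>i\<in>UNIV. real (c i) *\<^sub>R al i))"

definition positive_roots :: "'a::euclidean_space set \<Rightarrow> ('l::finite \<Rightarrow> 'a) \<Rightarrow> 'a set" where
  "positive_roots \<Phi> al = {\<beta>\<in>\<Phi>. \<exists>c::'l \<Rightarrow> nat. \<beta> = (\<Sum>i\<in>UNIV. real (c i) *\<^sub>R al i)}"

text \<open>Weights are elements of \<open>'a\<close>, via the identification of \<open>'a\<close> with its dual by the inner product.\<close>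

definition fund_weight :: "('l::finite \<Rightarrow> 'a::euclidean_space) \<Rightarrow> 'l \<Rightarrow> 'a" where
  "fund_weight al i = (THE v. \<forall>j. v \<bullet> coroot (al j) = (if i = j then 1 else 0))"

inductive_set weyl_group :: "'a::euclidean_space set \<Rightarrow> ('a \<Rightarrow> 'a) set" for \<Phi> where
  weyl_id: "id \<in> weyl_group \<Phi>"
| weyl_reflection: "\<alpha> \<in> \<Phi> \<Longrightarrow> w \<in> weyl_group \<Phi> \<Longrightarrow> reflection \<alpha> \<circ> w \<in> weyl_group \<Phi>"

definition simple_word :: "('l::finite \<Rightarrow> 'a::euclidean_space) \<Rightarrow> 'l list \<Rightarrow> 'a \<Rightarrow> 'a" where
  "simple_word al ws = foldr (\<lambda>i w. reflection (al i) \<circ> w) ws id"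

definition weyl_length :: "('l::finite \<Rightarrow> 'a::euclidean_space) \<Rightarrow> ('a \<Rightarrow> 'a) \<Rightarrow> nat" where
  "weyl_length al w = (LEAST n. \<exists>ws. length ws = n \<and> simple_word al ws = w)"

definition reduced_word ::
    "('l::finite \<Rightarrow> 'a::euclidean_space) \<Rightarrow> ('a \<Rightarrow> 'a) \<Rightarrow> 'l list \<Rightarrow> bool" where
  "reduced_word al w ws \<longleftrightarrow> simple_word al ws = w \<and> length ws = weyl_length al w"

definition coroot_coeff :: "('l::finite \<Rightarrow> 'a::euclidean_space) \<Rightarrow> 'a \<Rightarrow> 'l \<Rightarrow> nat" where
  "coroot_coeff al \<beta> = (THE m. coroot \<beta> = (\<Sum>i\<in>UNIV. real (m i) *\<^sub>R coroot (al i)))"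

definition coroot_height :: "('l::finite \<Rightarrow> 'a::euclidean_space) \<Rightarrow> 'a \<Rightarrow> nat" where
  "coroot_height al \<beta> = (\<Sum>i\<in>UNIV. coroot_coeff al \<beta> i)"

definition quantum_roots :: "'a::euclidean_space set \<Rightarrow> ('l::finite \<Rightarrow> 'a) \<Rightarrow> 'a set" where
  "quantum_roots \<Phi> al =
     {\<beta>\<in>positive_roots \<Phi> al.
        int (weyl_length al (reflection \<beta>)) = 2 * int (coroot_height al \<beta>) - 1}"

text \<open>A vector \<open>v = \<Sum>\<^sub>j (v \<bullet> \<alpha>\<^sub>j\<^sup>\<or>) \<lambda>\<^sub>j\<close> as a linear form in the variables \<open>\<lambda>\<^sub>j\<close>.\<close>

definition lin_form :: "('l::finite \<Rightarrow> 'a::euclidean_space) \<Rightarrow> 'a \<Rightarrow> 'l mpoly" where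
  "lin_form al v = (\<Sum>j\<in>UNIV. pconst (v \<bullet> coroot (al j)) * pvar j)"

definition weyl_act ::
    "('l::finite \<Rightarrow> 'a::euclidean_space) \<Rightarrow> ('a \<Rightarrow> 'a) \<Rightarrow> 'l mpoly \<Rightarrow> 'l mpoly" where
  "weyl_act al w = psubst (\<lambda>i. lin_form al (w (fund_weight al i)))"

definition weyl_invariant ::
    "'a::euclidean_space set \<Rightarrow> ('l::finite \<Rightarrow> 'a) \<Rightarrow> 'l mpoly \<Rightarrow> bool" where
  "weyl_invariant \<Phi> al f \<longleftrightarrow> (\<forall>w\<in>weyl_group \<Phi>. weyl_act al w f = f)"

definition coinv_ideal :: "'a::euclidean_space set \<Rightarrow> ('l::finite \<Rightarrow> 'a) \<Rightarrow> 'l mpoly set" where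
  "coinv_ideal \<Phi> al =
     Idl\<^bsub>mpoly_ring\<^esub> {f. weyl_invariant \<Phi> al f \<and> (\<exists>d>0. homogeneous d f)}"

text \<open>
  The subspace \<open>I\<^sub>W \<otimes> \<real>[q]\<close> of \<open>\<real>[\<lambda>] \<otimes> \<real>[q] = \<real>[\<lambda>, q]\<close>; the module \<open>\<H> \<otimes> \<real>[q]\<close> is the
  quotient of \<open>\<real>[\<lambda>, q]\<close> by it.
\<close>

definition coinv_ideal_q ::
    "'a::euclidean_space set \<Rightarrow> ('l::finite \<Rightarrow> 'a) \<Rightarrow> ('l + 'l) mpoly set" where
  "coinv_ideal_q \<Phi> al =
     {(\<Sum>k<n. emb_lam (f k) * emb_q (g k)) | (n::nat) f g. \<forall>k<n. f k \<in> coinv_ideal \<Phi> al}"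

definition weyl_act_q ::
    "('l::finite \<Rightarrow> 'a::euclidean_space) \<Rightarrow> ('a \<Rightarrow> 'a) \<Rightarrow> ('l + 'l) mpoly \<Rightarrow> ('l + 'l) mpoly" where
  "weyl_act_q al w =
     psubst (case_sum (\<lambda>i. emb_lam (lin_form al (w (fund_weight al i)))) (\<lambda>i. pvar (Inr i)))"

text \<open>The quotient exists and is unique: \<open>\<real>[\<lambda>, q]\<close> is a domain and \<open>\<alpha>\<close> divides \<open>f - s\<^sub>\<alpha> f\<close>.\<close>

definition divided_diff ::
    "('l::finite \<Rightarrow> 'a::euclidean_space) \<Rightarrow> 'a \<Rightarrow> ('l + 'l) mpoly \<Rightarrow> ('l + 'l) mpoly" where
  "divided_diff al \<alpha> f =
     (THE g. g * emb_lam (lin_form al \<alpha>) = f - weyl_act_q al (reflection \<alpha>) f)"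

text \<open>The result does not depend on the chosen reduced word, by the braid relations.\<close>

definition divided_diff_word ::
    "('l::finite \<Rightarrow> 'a::euclidean_space) \<Rightarrow> ('a \<Rightarrow> 'a) \<Rightarrow> ('l + 'l) mpoly \<Rightarrow> ('l + 'l) mpoly" where
  "divided_diff_word al w =
     foldr (\<lambda>i. divided_diff al (al i)) (SOME ws. reduced_word al w ws)"

definition q_monom :: "('l::finite \<Rightarrow> 'a::euclidean_space) \<Rightarrow> 'a \<Rightarrow> ('l + 'l) mpoly" where
  "q_monom al \<beta> = (\<Prod>i\<in>UNIV. pvar (Inr i) ^ coroot_coeff al \<beta> i)"

definition Lambda_op ::
    "'a::euclidean_space set \<Rightarrow> ('l::finite \<Rightarrow> 'a) \<Rightarrow> 'l \<Rightarrow> ('l + 'l) mpoly \<Rightarrow> ('l + 'l) mpoly" where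
  "Lambda_op \<Phi> al j f =
     pvar (Inl j) * f
     + (\<Sum>\<beta>\<in>quantum_roots \<Phi> al.
          pconst (fund_weight al j \<bullet> coroot \<beta>) * q_monom al \<beta>
            * divided_diff_word al (reflection \<beta>) f)"

text \<open>
  \<open>\<psi>(f) = f(\<Lambda>\<^sub>1, \<dots>, \<Lambda>\<^sub>l, q\<^sub>1, \<dots>, q\<^sub>l)(1)\<close>. The operators \<open>\<Lambda>\<^sub>j\<close> commute, so the order in
  which they are applied (here \<open>\<Lambda>\<^sub>1\<^sup>a \<circ> \<dots> \<circ> \<Lambda>\<^sub>l\<^sup>z\<close>) is immaterial.
\<close>

definition psi ::
    "'a::euclidean_space set \<Rightarrow> ('l::{finite,linorder} \<Rightarrow> 'a) \<Rightarrow> ('l + 'l) mpoly \<Rightarrow> ('l + 'l) mpoly"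
  where
  "psi \<Phi> al f =
     (\<Sum>m\<in>Poly_Mapping.keys f. pconst (Poly_Mapping.lookup f m)
        * (\<Prod>i\<in>UNIV. pvar (Inr i) ^ Poly_Mapping.lookup m (Inr i))
        * foldr (\<lambda>j. Lambda_op \<Phi> al j ^^ Poly_Mapping.lookup m (Inl j))
            (sorted_list_of_set UNIV) 1)"

abbreviation psi_inv ::
    "'a::euclidean_space set \<Rightarrow> ('l::{finite,linorder} \<Rightarrow> 'a) \<Rightarrow> ('l + 'l) mpoly \<Rightarrow> ('l + 'l) mpoly"
  where "psi_inv \<Phi> al \<equiv> inv_into UNIV (psi \<Phi> al)"

definition coset_smult ::
    "('l + 'l) mpoly set \<Rightarrow> 'l mpoly \<Rightarrow> ('l + 'l) mpoly set \<Rightarrow> ('l + 'l) mpoly set" where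
  "coset_smult I p A = (\<Union>f\<in>A. I +>\<^bsub>mpoly_ring\<^esub> (emb_q p * f))"

definition star ::
    "'a::euclidean_space set \<Rightarrow> ('l::{finite,linorder} \<Rightarrow> 'a)
       \<Rightarrow> ('l + 'l) mpoly set \<Rightarrow> ('l + 'l) mpoly set \<Rightarrow> ('l + 'l) mpoly set" where
  "star \<Phi> al A B =
     (\<Union>f\<in>A. \<Union>g\<in>B.
        coinv_ideal_q \<Phi> al +>\<^bsub>mpoly_ring\<^esub> psi \<Phi> al (psi_inv \<Phi> al f * psi_inv \<Phi> al g))"

definition star_algebra ::
    "'a::euclidean_space set \<Rightarrow> ('l::{finite,linorder} \<Rightarrow> 'a)
       \<Rightarrow> ('l mpoly, ('l + 'l) mpoly set) module" where
  "star_algebra \<Phi> al =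
     \<lparr>carrier = a_rcosets\<^bsub>mpoly_ring\<^esub> (coinv_ideal_q \<Phi> al),
      mult = star \<Phi> al,
      one = coinv_ideal_q \<Phi> al +>\<^bsub>mpoly_ring\<^esub> 1,
      zero = coinv_ideal_q \<Phi> al,
      add = set_add mpoly_ring,
      smult = coset_smult (coinv_ideal_q \<Phi> al)\<rparr>"

definition quotient_algebra ::
    "('l + 'l) mpoly set \<Rightarrow> ('l mpoly, ('l + 'l) mpoly set) module" where
  "quotient_algebra I =
     ring.extend (mpoly_ring Quot I) (module.fields (coset_smult I))"

definition algebra_iso ::
    "('r, 'm) ring_scheme \<Rightarrow> ('r, 'a) module \<Rightarrow> ('r, 'b) module \<Rightarrow> ('a \<Rightarrow> 'b) \<Rightarrow> bool" where
  "algebra_iso R A B h \<longleftrightarrow>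
     algebra R A \<and> algebra R B \<and> h \<in> ring_iso A B \<and>
     (\<forall>p\<in>carrier R. \<forall>x\<in>carrier A. h (p \<odot>\<^bsub>A\<^esub> x) = p \<odot>\<^bsub>B\<^esub> h x)"

text \<open>The phase space \<open>\<real>\<^bsup>2l\<^esup>\<close> consists of the pairs \<open>(r, s)\<close>, with symplectic form \<open>\<Sum>\<^sub>i dr\<^sub>i \<and> ds\<^sub>i\<close>.\<close>

type_synonym 'l phase = "(real^'l) \<times> (real^'l)"

definition poisson :: "('l::finite phase \<Rightarrow> real) \<Rightarrow> ('l phase \<Rightarrow> real) \<Rightarrow> 'l phase \<Rightarrow> real" where
  "poisson f g p =
     (\<Sum>i\<in>UNIV.
        frechet_derivative f (at p) (axis i 1, 0) * frechet_derivative g (at p) (0, axis i 1)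
        - frechet_derivative f (at p) (0, axis i 1) * frechet_derivative g (at p) (axis i 1, 0))"

definition integral_of_motion :: "('l::finite phase \<Rightarrow> real) \<Rightarrow> ('l phase \<Rightarrow> real) \<Rightarrow> bool" where
  "integral_of_motion H f \<longleftrightarrow> (\<forall>p. f differentiable (at p)) \<and> (\<forall>p. poisson f H p = 0)"

definition independent_functions :: "('l::finite \<Rightarrow> 'l phase \<Rightarrow> real) \<Rightarrow> bool" where
  "independent_functions f \<longleftrightarrow>
     (\<exists>U. open U \<and> closure U = UNIV \<and>
        (\<forall>p\<in>U. \<forall>c. (\<forall>v. (\<Sum>k\<in>UNIV. c k * frechet_derivative (f k) (at p) v) = 0)
                    \<longrightarrow> (\<forall>k. c k = 0)))"

definition toda_hamiltonian ::
    "('l::finite \<Rightarrow> 'a::euclidean_space) \<Rightarrow> 'l phase \<Rightarrow> real" where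
  "toda_hamiltonian al = (\<lambda>(r, s).
     (\<Sum>i\<in>UNIV. \<Sum>j\<in>UNIV. (coroot (al i) \<bullet> coroot (al j)) * r $ i * r $ j)
     + (\<Sum>i\<in>UNIV. exp (2 * s $ i)))"

text \<open>For polynomials attached to the Toda lattice, \<open>Inl i\<close> is \<open>r\<^sub>i\<close> and \<open>Inr i\<close> is \<open>exp (2 s\<^sub>i)\<close>.\<close>

definition toda_fun :: "('l::finite + 'l) mpoly \<Rightarrow> 'l phase \<Rightarrow> real" where
  "toda_fun F = (\<lambda>(r, s). peval (case_sum (\<lambda>i. r $ i) (\<lambda>i. exp (2 * s $ i))) F)"

definition toda_ideal ::
    "('l::finite \<Rightarrow> 'a::euclidean_space) \<Rightarrow> ('l \<Rightarrow> ('l + 'l) mpoly) \<Rightarrow> ('l + 'l) mpoly set" where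
  "toda_ideal al F =
     Idl\<^bsub>mpoly_ring\<^esub> (range (\<lambda>k.
       psubst (case_sum (\<lambda>i. pvar (Inl i))
                        (\<lambda>i. pconst (- (coroot (al i) \<bullet> coroot (al i))) * pvar (Inr i))) (F k)))"

end

theory Submission
  imports Defs "HOL-Library.Countable"
begin

text \<open>
  It suffices to show \<open>\<psi>(F\<^sub>k(\<lambda>, -\<langle>\<alpha>\<^sub>i\<^sup>\<or>, \<alpha>\<^sub>i\<^sup>\<or>\<rangle> q\<^sub>i)) = u\<^sub>k\<close>: since the \<open>\<Lambda>\<^sub>j\<close> commute with each other and
  with multiplication by invariants, \<open>\<psi>\<close> then maps the ideal generated by these polynomials onto
  \<open>I\<^sub>W \<otimes> \<real>[q]\<close>, and the theorem is transport of structure along \<open>\<psi>\<close>, which is bijective because it is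
  unitriangular for the degree in \<open>\<lambda>\<close>.

  For an invariant \<open>u\<close> the polynomial \<open>f = \<psi>\<^sup>-\<^sup>1(u)\<close> satisfies \<open>f(\<Lambda>, q) = u\<close> as operators. The quadratic
  case is \<open>\<Sum> \<langle>\<alpha>\<^sub>i\<^sup>\<or>, \<alpha>\<^sub>j\<^sup>\<or>\<rangle> \<Lambda>\<^sub>i \<Lambda>\<^sub>j = Q + \<Sum> \<langle>\<alpha>\<^sub>i\<^sup>\<or>, \<alpha>\<^sub>i\<^sup>\<or>\<rangle> q\<^sub>i\<close>. Because \<open>[q\<^sub>i \<partial>/\<partial>q\<^sub>i, \<Lambda>\<^sub>j]\<close> is symmetric in \<open>i\<close>
  and \<open>j\<close>, the operator \<open>K = \<Sum> \<langle>\<alpha>\<^sub>i\<^sup>\<or>, \<alpha>\<^sub>j\<^sup>\<or>\<rangle> (\<Lambda>\<^sub>i q\<^sub>j \<partial>/\<partial>q\<^sub>j + q\<^sub>i \<partial>/\<partial>q\<^sub>i \<Lambda>\<^sub>j)\<close> satisfies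
  \<open>[K, f(\<Lambda>, q)] = {E, f}(\<Lambda>, q)\<close> for the Toda Hamiltonian \<open>E\<close>. As \<open>K\<close> commutes with \<open>u\<close>, the polynomial
  \<open>\<psi>\<^sup>-\<^sup>1(u)\<close> is an integral of motion. An integral of motion is determined by its value at \<open>q = 0\<close>, and
  \<open>\<psi>\<^sup>-\<^sup>1(u\<^sub>k)\<close> and \<open>F\<^sub>k\<close> both restrict to \<open>u\<^sub>k\<close>.

  The operators \<open>\<Lambda>\<^sub>j\<close> commute because the terms of the commutator cancel in pairs. By the Leibniz rule
  for \<open>\<Delta>\<^sub>w\<close> these terms are indexed by pairs of roots, and \<open>l(s\<^sub>\<alpha>) \<le> 2 ht(\<alpha>\<^sup>\<or>) - 1\<close> shows that the partner
  of a pair contributes as well.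
\<close>

section \<open>Multivariate polynomials\<close>

text \<open>The Poisson bracket arises because q_i d/dq_i, commuted with \<Lambda>_j, puts the
  factor \<omega>_i(\<beta>^v) beside the factor \<omega>_j(\<beta>^v) already there. By this
  symmetry [K, \<Lambda>_k] is the q_k d/dq_k derivative of the quadratic operator, which is
  multiplication by Q plus a linear form in q. Only simple roots enter that form, since a divided
  difference of length at least two kills linear forms; its coefficients with reversed sign are the
  constants in the generators of the ideal. The invariance of Q is read off from the Hamiltonian at
  q = 0. Uniqueness is a recursion over the exponents e of q: the bracket multiplies the coefficient
  of q^e by the linear form 2 sum e_i \<alpha>_i^v, which is nonzero for e \<noteq> 0. The obstacle
  to commutativity is the presence of several root lengths. A pair (\<beta>, \<gamma>) has two
  possible partners, built from \<gamma> or from \<beta> - \<gamma>, and a partner must consist of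
  positive roots. Only a configuration of type G2 could spoil both, and there the length bound gives
  a contradiction.\<close>

lemma mpoly_decomp:
  "f = (\<Sum>m\<in>Poly_Mapping.keys f. Poly_Mapping.single m (Poly_Mapping.lookup f m))"
proof (rule poly_mapping_eqI)
  fix k
  show "Poly_Mapping.lookup f k = Poly_Mapping.lookup (\<Sum>m\<in>Poly_Mapping.keys f.
      Poly_Mapping.single m (Poly_Mapping.lookup f m)) k"
    by (auto simp: lookup_sum lookup_single when_def in_keys_iff sum.delta cong: if_cong)
qed

lemma mpoly_single_induct [case_names zero single add]:
  fixes f :: "'v mpoly"
  assumes "P 0" and "\<And>m c. P (Poly_Mapping.single m c)" and "\<And>f g. P f \<Longrightarrow> P g \<Longrightarrow> P (f + g)"
  shows "P f"
proof -
  have "P (\<Sum>m\<in>S. Poly_Mapping.single m (Poly_Mapping.lookup f m))" if "finite S" for S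
    using that by (induction S) (auto intro: assms)
  then show ?thesis
    using mpoly_decomp[of f] by (metis finite_keys)
qed

lemma monomial_induct [case_names zero var]:
  fixes m :: "'v \<Rightarrow>\<^sub>0 nat"
  assumes "P 0" and "\<And>v m. P m \<Longrightarrow> P (Poly_Mapping.single v 1 + m)"
  shows "P m"
proof (induction "\<Sum>v\<in>Poly_Mapping.keys m. Poly_Mapping.lookup m v" arbitrary: m rule: less_induct)
  case less
  show ?case
  proof (cases "m = 0")
    case True
    then show ?thesis using assms by simp
  next
    case False
    then obtain v where v: "v \<in> Poly_Mapping.keys m" by fastforce
    define m' where "m' = m - Poly_Mapping.single v 1"
    have lm: "Poly_Mapping.lookup m' x = Poly_Mapping.lookup m x - (if x = v then 1 else 0)" for x
      by (simp add: m'_def lookup_minus lookup_single when_def)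
    have m: "m = Poly_Mapping.single v 1 + m'"
      using v by (intro poly_mapping_eqI) (auto simp: lookup_add lm lookup_single when_def in_keys_iff)
    have "Poly_Mapping.keys m' \<subseteq> Poly_Mapping.keys m"
      by (auto simp: in_keys_iff lm split: if_splits)
    then have "(\<Sum>v\<in>Poly_Mapping.keys m'. Poly_Mapping.lookup m' v)
        \<le> (\<Sum>v\<in>Poly_Mapping.keys m. Poly_Mapping.lookup m' v)"
      by (intro sum_mono2) auto
    also have "\<dots> < (\<Sum>v\<in>Poly_Mapping.keys m. Poly_Mapping.lookup m v)"
      using v by (intro sum_strict_mono_ex1) (auto simp: lm in_keys_iff intro!: bexI[of _ v])
    finally have "P m'" by (rule less)
    then show ?thesis using m assms(2) by metis
  qed
qed

lemma single_var_add:
  "Poly_Mapping.single (Poly_Mapping.single v 1 + m) c = pvar v * (Poly_Mapping.single m c :: 'v mpoly)"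
  by (simp add: pvar_def mult_single)

lemma pconst_add: "pconst (a + b) = pconst a + pconst b"
  by (simp add: pconst_def single_add)

lemma pconst_mult: "pconst (a * b) = pconst a * pconst b"
  by (simp add: pconst_def mult_single)

lemma pconst_uminus: "pconst (- a) = - pconst a"
  by (simp add: pconst_def single_uminus)

lemma pconst_diff: "pconst (a - b) = pconst a - pconst b"
  by (simp add: pconst_def single_diff)

lemma pconst_0 [simp]: "pconst 0 = 0"
  by (simp add: pconst_def)

lemma pconst_1 [simp]: "pconst 1 = 1"
  by (simp add: pconst_def)

lemma pconst_power: "pconst (a ^ n) = pconst a ^ n"
  by (induction n) (simp_all add: pconst_mult)

lemma pconst_sum: "pconst (sum f A) = (\<Sum>x\<in>A. pconst (f x))"
  by (induction A rule: infinite_finite_induct) (simp_all add: pconst_add)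

lemma pconst_prod: "pconst (prod f A) = (\<Prod>x\<in>A. pconst (f x))"
  by (induction A rule: infinite_finite_induct) (simp_all add: pconst_mult)

lemma pconst_eq_iff [simp]: "pconst a = pconst b \<longleftrightarrow> a = b"
  by (metis pconst_def lookup_single_eq)

lemma pconst_numeral: "pconst (numeral n) = numeral n"
  by (simp add: pconst_def)

text \<open>Suited to operators that are known through the way they pass a single variable, such as
  \<open>dd\<close>, \<open>pdiff\<close> and \<open>psi\<close>.\<close>

lemma mpoly_induct [case_names const add var]:
  fixes f :: "'v mpoly"
  assumes const: "\<And>c. P (pconst c)" and add: "\<And>f g. P f \<Longrightarrow> P g \<Longrightarrow> P (f + g)"
    and var: "\<And>v f. P f \<Longrightarrow> P (pvar v * f)"
  shows "P f"
proof (induction f rule: mpoly_single_induct)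
  case zero
  then show ?case using const[of 0] by simp
next
  case (single m c)
  show ?case
  proof (induction m rule: monomial_induct)
    case zero
    then show ?case using const[of c] by (simp add: pconst_def)
  next
    case (var v m)
    then show ?case by (simp add: single_var_add assms(3) del: One_nat_def)
  qed
qed (rule add)

subsection \<open>Linear extension from monomials\<close>

definition lin_ext :: "(('v \<Rightarrow>\<^sub>0 nat) \<Rightarrow> 'w mpoly) \<Rightarrow> 'v mpoly \<Rightarrow> 'w mpoly" where
  "lin_ext B f = (\<Sum>m\<in>Poly_Mapping.keys f. pconst (Poly_Mapping.lookup f m) * B m)"

lemma lin_ext_superset:
  assumes "finite S" "Poly_Mapping.keys f \<subseteq> S"
  shows "lin_ext B f = (\<Sum>m\<in>S. pconst (Poly_Mapping.lookup f m) * B m)"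
  unfolding lin_ext_def
  using assms by (intro sum.mono_neutral_left) (auto simp: in_keys_iff)

lemma lin_ext_add: "lin_ext B (f + g) = lin_ext B f + lin_ext B g"
proof -
  let ?S = "Poly_Mapping.keys f \<union> Poly_Mapping.keys g"
  have "Poly_Mapping.keys (f + g) \<subseteq> ?S" by (rule keys_add)
  then show ?thesis
    by (subst (1 2 3) lin_ext_superset[of ?S])
       (simp_all add: lookup_add pconst_add algebra_simps sum.distrib)
qed

lemma lin_ext_single [simp]: "lin_ext B (Poly_Mapping.single m c) = pconst c * B m"
  by (simp add: lin_ext_superset[of "{m}"])

lemma lin_ext_zero [simp]: "lin_ext B 0 = 0"
  by (simp add: lin_ext_def)

lemma lin_ext_pconst_mult: "lin_ext B (pconst c * f) = pconst c * lin_ext B f"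
proof (induction f rule: mpoly_single_induct)
  case (single m d)
  have "pconst c * Poly_Mapping.single m d = Poly_Mapping.single m (c * d)"
    by (simp add: pconst_def mult_single)
  then show ?case by (simp add: pconst_mult mult.assoc)
qed (simp_all add: algebra_simps lin_ext_add)

text \<open>Here T is multiplication by a polynomial for \<open>psubst\<close> and
  \<open>qcoeff\<close>, but the operator \<Lambda>_j for \<open>psi\<close>; this is why T is
  merely assumed linear.\<close>

lemma lin_ext_pvar_mult:
  assumes "\<And>m. B (Poly_Mapping.single v 1 + m) = T (B m)"
    and "\<And>x y. T (x + y) = T x + T y" and "\<And>c x. T (pconst c * x) = pconst c * T x"
  shows "lin_ext B (pvar v * f) = T (lin_ext B f)"
proof (induction f rule: mpoly_single_induct)
  case zero
  then show ?case using assms(3)[of 0] by simp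
next
  case (single m c)
  have "lin_ext B (Poly_Mapping.single (Poly_Mapping.single v 1 + m) c) = pconst c * T (B m)"
    unfolding lin_ext_single assms(1) ..
  then show ?case by (simp add: single_var_add assms(3) del: One_nat_def)
next
  case (add f g)
  then show ?case by (simp add: algebra_simps lin_ext_add assms(2))
qed

subsection \<open>Substitution\<close>

definition mono_ev :: "('v \<Rightarrow> 'w mpoly) \<Rightarrow> ('v \<Rightarrow>\<^sub>0 nat) \<Rightarrow> 'w mpoly" where
  "mono_ev \<sigma> m = (\<Prod>v\<in>Poly_Mapping.keys m. \<sigma> v ^ Poly_Mapping.lookup m v)"

lemma mono_ev_superset:
  assumes "finite S" "Poly_Mapping.keys m \<subseteq> S"
  shows "mono_ev \<sigma> m = (\<Prod>v\<in>S. \<sigma> v ^ Poly_Mapping.lookup m v)"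
  unfolding mono_ev_def
  using assms by (intro prod.mono_neutral_left) (auto simp: in_keys_iff)

lemma mono_ev_add: "mono_ev \<sigma> (m + n) = mono_ev \<sigma> m * mono_ev \<sigma> n"
proof -
  let ?S = "Poly_Mapping.keys m \<union> Poly_Mapping.keys n"
  have "Poly_Mapping.keys (m + n) \<subseteq> ?S" by (rule keys_add)
  then show ?thesis
    by (subst (1 2 3) mono_ev_superset[of ?S])
       (simp_all add: lookup_add power_add prod.distrib)
qed

lemma mono_ev_zero [simp]: "mono_ev \<sigma> 0 = 1"
  by (simp add: mono_ev_def)

lemma mono_ev_single [simp]: "mono_ev \<sigma> (Poly_Mapping.single v n) = \<sigma> v ^ n"
  by (subst mono_ev_superset[of "{v}"]) auto

lemma psubst_eq_lin_ext: "psubst \<sigma> = lin_ext (mono_ev \<sigma>)"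
  by (rule ext) (simp add: psubst_def lin_ext_def mono_ev_def)

lemma psubst_add: "psubst \<sigma> (f + g) = psubst \<sigma> f + psubst \<sigma> g"
  by (simp add: psubst_eq_lin_ext lin_ext_add)

lemma psubst_pconst [simp]: "psubst \<sigma> (pconst c) = pconst c"
  unfolding psubst_eq_lin_ext by (subst (1) pconst_def) simp

lemma psubst_0 [simp]: "psubst \<sigma> 0 = 0"
  by (simp add: psubst_eq_lin_ext)

lemma psubst_1 [simp]: "psubst \<sigma> 1 = 1"
  using psubst_pconst[of \<sigma> 1] by simp

lemma psubst_pvar_mult: "psubst \<sigma> (pvar v * f) = \<sigma> v * psubst \<sigma> f"
  unfolding psubst_eq_lin_ext
  by (rule lin_ext_pvar_mult) (simp_all add: mono_ev_add algebra_simps del: One_nat_def)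

lemma psubst_pvar [simp]: "psubst \<sigma> (pvar v) = \<sigma> v"
  using psubst_pvar_mult[of \<sigma> v 1] by simp

lemma psubst_pconst_mult: "psubst \<sigma> (pconst c * f) = pconst c * psubst \<sigma> f"
  by (simp add: psubst_eq_lin_ext lin_ext_pconst_mult)

lemma psubst_mult: "psubst \<sigma> (f * g) = psubst \<sigma> f * psubst \<sigma> g"
  by (induction f rule: mpoly_induct)
     (simp_all add: psubst_pconst_mult psubst_pvar_mult psubst_add distrib_right mult.assoc)

lemma psubst_uminus: "psubst \<sigma> (- f) = - psubst \<sigma> f"
  using psubst_add[of \<sigma> f "- f"] by (simp add: eq_neg_iff_add_eq_0 add.commute)

lemma psubst_diff: "psubst \<sigma> (f - g) = psubst \<sigma> f - psubst \<sigma> g"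
  using psubst_add[of \<sigma> f "- g"] by (simp add: psubst_uminus)

lemma psubst_sum: "psubst \<sigma> (sum f A) = (\<Sum>x\<in>A. psubst \<sigma> (f x))"
  by (induction A rule: infinite_finite_induct) (simp_all add: psubst_add)

lemma psubst_power: "psubst \<sigma> (f ^ n) = psubst \<sigma> f ^ n"
  by (induction n) (simp_all add: psubst_mult)

lemma psubst_prod: "psubst \<sigma> (prod f A) = (\<Prod>x\<in>A. psubst \<sigma> (f x))"
  by (induction A rule: infinite_finite_induct) (simp_all add: psubst_mult)

lemmas psubst_simps = psubst_add psubst_mult psubst_uminus psubst_diff psubst_sum psubst_power
  psubst_prod

lemma psubst_psubst: "psubst \<sigma> (psubst \<tau> f) = psubst (\<lambda>v. psubst \<sigma> (\<tau> v)) f"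
  by (induction f rule: mpoly_induct) (simp_all add: psubst_simps)

lemma psubst_pvar_id [simp]: "psubst pvar f = f"
  by (induction f rule: mpoly_induct) (simp_all add: psubst_simps)

section \<open>Evaluation at real points and absence of zero divisors\<close>

lemma psubst_pconst_eq_peval: "psubst (\<lambda>v. pconst (x v)) f = pconst (peval x f)"
  by (simp add: psubst_def peval_def pconst_sum pconst_prod pconst_mult pconst_power)

lemma peval_add: "peval x (f + g) = peval x f + peval x g"
proof -
  have "(pconst (peval x (f + g)) :: 'a mpoly) = pconst (peval x f + peval x g)"
    by (simp add: pconst_add psubst_add flip: psubst_pconst_eq_peval)
  then show ?thesis by simp
qed

lemma peval_mult: "peval x (f * g) = peval x f * peval x g"
proof -
  have "(pconst (peval x (f * g)) :: 'a mpoly) = pconst (peval x f * peval x g)"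
    by (simp add: pconst_mult psubst_mult flip: psubst_pconst_eq_peval)
  then show ?thesis by simp
qed

lemma peval_pconst [simp]: "peval x (pconst c) = c"
proof -
  have "(pconst (peval x (pconst c)) :: 'a mpoly) = pconst c"
    by (simp flip: psubst_pconst_eq_peval)
  then show ?thesis by simp
qed

lemma peval_pvar [simp]: "peval x (pvar v) = x v"
proof -
  have "(pconst (peval x (pvar v)) :: 'a mpoly) = pconst (x v)"
    by (simp flip: psubst_pconst_eq_peval)
  then show ?thesis by simp
qed

lemma peval_0 [simp]: "peval x 0 = 0"
  using peval_pconst[of x 0] by simp

lemma peval_sum: "peval x (sum f A) = (\<Sum>a\<in>A. peval x (f a))"
  by (induction A rule: infinite_finite_induct) (simp_all add: peval_add)

lemma mpoly_mult_eq_0_iff: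
  fixes f g :: "'v::countable mpoly"
  shows "f * g = 0 \<longleftrightarrow> f = 0 \<or> g = 0"
proof
  \<comment> \<open>The library proves that there are no zero divisors for linearly ordered sets of variables.\<close>
  define \<phi> :: "'v mpoly \<Rightarrow> nat mpoly" where "\<phi> = psubst (\<lambda>v. pvar (to_nat v))"
  have inj: "h = 0" if "\<phi> h = 0" for h
  proof -
    have "psubst (\<lambda>n. pvar (from_nat n)) (\<phi> h) = h"
      by (simp add: \<phi>_def psubst_psubst)
    then show ?thesis using that by simp
  qed
  assume "f * g = 0"
  then have "\<phi> f * \<phi> g = 0"
    by (simp add: \<phi>_def flip: psubst_mult)
  then show "f = 0 \<or> g = 0"
    using inj by auto
qed auto

lemma mpoly_mult_cancel:
  fixes f g h :: "'v::countable mpoly"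
  assumes "f * h = g * h" "h \<noteq> 0"
  shows "f = g"
  using assms mpoly_mult_eq_0_iff[of "f - g" h] by (simp add: algebra_simps)

section \<open>Root systems and the length function\<close>

lemma coroot_uminus: "coroot (- \<alpha>) = - coroot \<alpha>"
  by (simp add: coroot_def)

lemma inner_coroot: "v \<bullet> coroot \<alpha> = 2 * (v \<bullet> \<alpha>) / (\<alpha> \<bullet> \<alpha>)"
  by (simp add: coroot_def)

lemma self_inner_coroot: "\<alpha> \<noteq> 0 \<Longrightarrow> \<alpha> \<bullet> coroot \<alpha> = 2"
  by (simp add: inner_coroot)

lemma reflection_uminus_root: "reflection (- \<alpha>) = reflection \<alpha>"
  by (rule ext) (simp add: reflection_def coroot_uminus)

lemma reflection_add: "reflection \<alpha> (u + v) = reflection \<alpha> u + reflection \<alpha> v"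
  by (simp add: reflection_def inner_add_left scaleR_add_left)

lemma reflection_scale: "reflection \<alpha> (c *\<^sub>R v) = c *\<^sub>R reflection \<alpha> v"
  by (simp add: reflection_def scaleR_diff_right)

lemma linear_reflection: "linear (reflection \<alpha>)"
  by (rule linearI) (simp_all add: reflection_add reflection_scale)

lemma reflection_minus: "reflection \<alpha> (- v) = - reflection \<alpha> v"
  by (simp add: linear_neg linear_reflection)

lemma reflection_self: "\<alpha> \<noteq> 0 \<Longrightarrow> reflection \<alpha> \<alpha> = - \<alpha>"
  by (simp add: reflection_def self_inner_coroot scaleR_2)

lemma reflection_inner:
  "\<alpha> \<noteq> 0 \<Longrightarrow> reflection \<alpha> u \<bullet> reflection \<alpha> v = u \<bullet> v"
  by (simp add: reflection_def inner_diff_left inner_diff_right inner_coroot inner_commute)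

lemma reflection_reflection: "\<alpha> \<noteq> 0 \<Longrightarrow> reflection \<alpha> (reflection \<alpha> v) = v"
  by (simp add: reflection_def inner_diff_left self_inner_coroot algebra_simps)

lemma reflection_comp_self: "\<alpha> \<noteq> 0 \<Longrightarrow> reflection \<alpha> \<circ> reflection \<alpha> = id"
  by (rule ext) (simp add: reflection_reflection)

lemma coroot_isometry:
  assumes "linear g" "\<And>u v. g u \<bullet> g v = u \<bullet> v"
  shows "coroot (g \<alpha>) = g (coroot \<alpha>)"
  using assms by (simp add: coroot_def linear_scale)

lemma reflection_isometry:
  assumes "linear g" "\<And>u v. g u \<bullet> g v = u \<bullet> v"
  shows "reflection (g \<alpha>) (g v) = g (reflection \<alpha> v)"
  using assms by (simp add: reflection_def coroot_isometry[OF assms] linear_diff linear_scale)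

lemma coroot_reflection: "\<beta> \<noteq> 0 \<Longrightarrow> coroot (reflection \<beta> \<alpha>) = reflection \<beta> (coroot \<alpha>)"
  by (rule coroot_isometry) (simp_all add: linear_reflection reflection_inner)

lemma reflection_coroot:
  "\<beta> \<noteq> 0 \<Longrightarrow> reflection \<beta> (coroot \<alpha>) = coroot \<alpha> - (\<beta> \<bullet> coroot \<alpha>) *\<^sub>R coroot \<beta>"
  by (simp add: reflection_def coroot_def inner_commute)

lemma reflection_conj:
  assumes "\<beta> \<noteq> 0"
  shows "reflection (reflection \<beta> \<alpha>) = reflection \<beta> \<circ> reflection \<alpha> \<circ> reflection \<beta>"
proof
  fix v
  have "reflection (reflection \<beta> \<alpha>) (reflection \<beta> (reflection \<beta> v))
      = reflection \<beta> (reflection \<alpha> (reflection \<beta> v))"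
    by (rule reflection_isometry) (simp_all add: linear_reflection reflection_inner assms)
  then show "reflection (reflection \<beta> \<alpha>) v = (reflection \<beta> \<circ> reflection \<alpha> \<circ> reflection \<beta>) v"
    by (simp add: reflection_reflection assms)
qed

locale root_base =
  fixes \<Phi> :: "'a::euclidean_space set" and al :: "'l::finite \<Rightarrow> 'a"
  assumes rs: "root_system \<Phi>" and sr: "simple_roots \<Phi> al"
begin

abbreviation "P \<equiv> positive_roots \<Phi> al"
abbreviation "s i \<equiv> reflection (al i)"
abbreviation "sw \<equiv> simple_word al"
abbreviation "wl \<equiv> weyl_length al"
abbreviation "\<omega> \<equiv> fund_weight al"

lemma finite_roots: "finite \<Phi>"
  using rs by (simp add: root_system_def)

lemma root_nonzero: "\<alpha> \<in> \<Phi> \<Longrightarrow> \<alpha> \<noteq> 0"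
  using rs by (auto simp: root_system_def)

lemma root_reflection: "\<alpha> \<in> \<Phi> \<Longrightarrow> \<beta> \<in> \<Phi> \<Longrightarrow> reflection \<alpha> \<beta> \<in> \<Phi>"
  using rs by (auto simp: root_system_def)

lemma root_uminus: "\<alpha> \<in> \<Phi> \<Longrightarrow> - \<alpha> \<in> \<Phi>"
  using root_reflection[of \<alpha> \<alpha>] by (simp add: reflection_self root_nonzero)

lemma root_integral: "\<alpha> \<in> \<Phi> \<Longrightarrow> \<beta> \<in> \<Phi> \<Longrightarrow> \<beta> \<bullet> coroot \<alpha> \<in> \<int>"
  using rs by (auto simp: root_system_def)

lemma root_reduced: "\<alpha> \<in> \<Phi> \<Longrightarrow> c *\<^sub>R \<alpha> \<in> \<Phi> \<Longrightarrow> c = 1 \<or> c = -1"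
  using rs by (auto simp: root_system_def)

lemma simple_root: "al i \<in> \<Phi>"
  using sr by (auto simp: simple_roots_def)

lemma simple_nonzero [simp]: "al i \<noteq> 0"
  using simple_root root_nonzero by blast

lemma simple_inj: "inj al"
  using sr by (auto simp: simple_roots_def)

lemma simple_independent: "independent (range al)"
  using sr by (auto simp: simple_roots_def)

lemma simple_combination:
  "\<beta> \<in> \<Phi> \<Longrightarrow> \<exists>c::'l \<Rightarrow> nat. \<beta> = (\<Sum>i\<in>UNIV. real (c i) *\<^sub>R al i)
      \<or> \<beta> = - (\<Sum>i\<in>UNIV. real (c i) *\<^sub>R al i)"
  using sr unfolding simple_roots_def by (elim conjE bspec)

lemma simple_span: "span (range al) = UNIV"
proof -
  have "\<beta> \<in> span (range al)" if b: "\<beta> \<in> \<Phi>" for \<beta>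
  proof -
    obtain c :: "'l \<Rightarrow> nat" where c: "\<beta> = (\<Sum>i\<in>UNIV. real (c i) *\<^sub>R al i)
        \<or> \<beta> = - (\<Sum>i\<in>UNIV. real (c i) *\<^sub>R al i)"
      using simple_combination[OF b] by blast
    have "(\<Sum>i\<in>UNIV. real (c i) *\<^sub>R al i) \<in> span (range al)"
      by (intro span_sum span_scale span_base) auto
    then show ?thesis using c by (elim disjE) (simp_all add: span_neg)
  qed
  then have "span \<Phi> \<subseteq> span (range al)" by (intro span_minimal) auto
  moreover have "span \<Phi> = UNIV" using rs by (simp only: root_system_def)
  ultimately show ?thesis by blast
qed

lemma eq_if_inner_simple:
  assumes "\<And>j. u \<bullet> al j = v \<bullet> al j"
  shows "u = v"
proof -
  have "(u - v) \<bullet> x = 0" if "x \<in> span (range al)" for x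
    using that
    by (induction rule: span_induct_alt)
       (auto simp: inner_add_right inner_diff_left assms)
  then have "(u - v) \<bullet> (u - v) = 0" using simple_span by auto
  then show ?thesis by simp
qed

lemma inner_coroot_simple_eq: "u \<bullet> coroot (al j) = v \<bullet> coroot (al j) \<longleftrightarrow> u \<bullet> al j = v \<bullet> al j"
  by (simp add: inner_coroot)

lemma fund_weight_coroot: "\<omega> i \<bullet> coroot (al j) = (if i = j then 1 else 0)"
proof -
  \<comment> \<open>The value |\<alpha>_i|^2 / 2 on \<alpha>_i becomes 1 on the coroot 2 \<alpha>_i
    / |\<alpha>_i|^2.\<close>
  obtain g :: "'a \<Rightarrow> real" where g: "linear g" "\<forall>x\<in>range al. g x = (if x = al i then (al i \<bullet> al i) / 2 else 0)"
    using linear_independent_extend[OF simple_independent,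
        of "\<lambda>x. if x = al i then (al i \<bullet> al i) / 2 else 0"] by (elim exE conjE)
  \<comment> \<open>The vector that represents the functional g: the inner product of
    \<open>adjoint g 1\<close> with x is 1 times g x.\<close>
  define v where "v = adjoint g 1"
  have gv: "v \<bullet> x = g x" for x
    using adjoint_works[OF g(1), of x 1] by (simp add: v_def inner_commute)
  have 1: "\<forall>j. v \<bullet> coroot (al j) = (if i = j then 1 else 0)"
    using g(2) simple_inj by (auto simp: inner_coroot gv inj_eq)
  have 2: "w = v" if "\<forall>j. w \<bullet> coroot (al j) = (if i = j then 1 else 0)" for w
  proof (rule eq_if_inner_simple)
    fix k
    have "w \<bullet> coroot (al k) = v \<bullet> coroot (al k)" using 1 that by simp
    then show "w \<bullet> al k = v \<bullet> al k" by (simp only: inner_coroot_simple_eq)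
  qed
  have "\<omega> i = v"
    unfolding fund_weight_def using 1 2 by (rule the_equality)
  then show ?thesis using 1 by simp
qed

lemma fund_weight_simple: "\<omega> i \<bullet> al j = (if i = j then (al i \<bullet> al i) / 2 else 0)"
  using fund_weight_coroot[of i j] simple_nonzero[of j]
  by (auto simp: inner_coroot split: if_splits)

lemma weight_expansion: "v = (\<Sum>j\<in>UNIV. (v \<bullet> coroot (al j)) *\<^sub>R \<omega> j)"
proof (rule eq_if_inner_simple)
  fix k
  have "v \<bullet> coroot (al k) = (\<Sum>j\<in>UNIV. (v \<bullet> coroot (al j)) *\<^sub>R \<omega> j) \<bullet> coroot (al k)"
    by (simp add: inner_sum_left fund_weight_coroot if_distrib sum.delta cong: if_cong)
  then show "v \<bullet> al k = (\<Sum>j\<in>UNIV. (v \<bullet> coroot (al j)) *\<^sub>R \<omega> j) \<bullet> al k"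
    by (simp only: inner_coroot_simple_eq)
qed

text \<open>The coordinate of v at the simple root \<alpha>_i: \<omega>_i is dual to the coroots,
  hence dual to the simple roots up to the factor |\<alpha>_i|^2 / 2, which is divided out.\<close>

definition cf :: "'l \<Rightarrow> 'a \<Rightarrow> real" where
  "cf i v = 2 * (\<omega> i \<bullet> v) / (al i \<bullet> al i)"

lemma cf_simple: "cf i (al j) = (if i = j then 1 else 0)"
  by (simp add: cf_def fund_weight_simple)

lemma cf_add: "cf i (u + v) = cf i u + cf i v"
  by (simp add: cf_def inner_add_right add_divide_distrib distrib_left)

lemma cf_scale: "cf i (c *\<^sub>R v) = c * cf i v"
  by (simp add: cf_def)

lemma cf_minus: "cf i (- v) = - cf i v"
  by (simp add: cf_def)

lemma cf_diff: "cf i (u - v) = cf i u - cf i v"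
  by (simp add: cf_def inner_diff_right diff_divide_distrib right_diff_distrib)

lemma cf_sum: "cf i (sum f A) = (\<Sum>x\<in>A. cf i (f x))"
  by (simp add: cf_def inner_sum_right sum_distrib_left sum_divide_distrib)

lemma cf_combination: "cf j (\<Sum>i\<in>UNIV. c i *\<^sub>R al i) = c j"
  by (simp add: cf_sum cf_scale cf_simple if_distrib sum.delta cong: if_cong)

lemma cf_expansion: "v = (\<Sum>i\<in>UNIV. cf i v *\<^sub>R al i)"
proof -
  have "v \<in> span (range al)" using simple_span by auto
  then obtain d where "v = (\<Sum>x\<in>range al. d x *\<^sub>R x)"
    using span_finite[of "range al"] by auto
  then have v: "v = (\<Sum>i\<in>UNIV. d (al i) *\<^sub>R al i)"
    by (simp add: sum.reindex[OF simple_inj])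
  show ?thesis
    by (subst v, subst v) (simp only: cf_combination)
qed

text \<open>Kept real valued and linear on the whole space, so that the sign of a root can be
  decided by adding inequalities.\<close>

definition hgt :: "'a \<Rightarrow> real" where
  "hgt v = (\<Sum>i\<in>UNIV. cf i v)"

lemma hgt_add: "hgt (u + v) = hgt u + hgt v"
  by (simp add: hgt_def cf_add sum.distrib)

lemma hgt_scale: "hgt (c *\<^sub>R v) = c * hgt v"
  by (simp add: hgt_def cf_scale sum_distrib_left)

lemma hgt_minus: "hgt (- v) = - hgt v"
  by (simp add: hgt_def cf_minus sum_negf)

lemma hgt_diff: "hgt (u - v) = hgt u - hgt v"
  by (simp add: hgt_def cf_diff sum_subtractf)

lemma hgt_simple: "hgt (al i) = 1"
  by (simp add: hgt_def cf_simple)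

section \<open>Positive roots and their behaviour under simple reflections\<close>

lemma pos_root: "\<beta> \<in> P \<Longrightarrow> \<beta> \<in> \<Phi>"
  by (simp add: positive_roots_def)

lemma finite_pos: "finite P"
  using finite_roots by (auto simp: positive_roots_def)

lemma pos_nonzero: "\<beta> \<in> P \<Longrightarrow> \<beta> \<noteq> 0"
  using pos_root root_nonzero by blast

lemma pos_or_neg:
  assumes "\<beta> \<in> \<Phi>"
  shows "\<beta> \<in> P \<or> - \<beta> \<in> P"
proof -
  obtain c :: "'l \<Rightarrow> nat" where "\<beta> = (\<Sum>i\<in>UNIV. real (c i) *\<^sub>R al i)
      \<or> \<beta> = - (\<Sum>i\<in>UNIV. real (c i) *\<^sub>R al i)"
    using simple_combination[OF assms] by blast
  then show ?thesis
    using assms root_uminus[OF assms]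
    by (elim disjE) (unfold positive_roots_def, auto intro!: exI[of _ c])
qed

lemma pos_cf_nat: "\<beta> \<in> P \<Longrightarrow> cf i \<beta> \<in> \<nat>"
  unfolding positive_roots_def by (auto simp: cf_combination)

lemma pos_cf_nonneg: "\<beta> \<in> P \<Longrightarrow> cf i \<beta> \<ge> 0"
  using pos_cf_nat[of \<beta> i] by (auto simp: Nats_def)

lemma pos_hgt: "\<beta> \<in> P \<Longrightarrow> hgt \<beta> > 0"
proof -
  assume b: "\<beta> \<in> P"
  have "hgt \<beta> \<ge> 0" unfolding hgt_def by (intro sum_nonneg pos_cf_nonneg b)
  moreover have "hgt \<beta> \<noteq> 0"
  proof
    assume "hgt \<beta> = 0"
    then have "cf i \<beta> = 0" for i
      using sum_nonneg_eq_0_iff[of UNIV "\<lambda>i. cf i \<beta>"] pos_cf_nonneg[OF b] by (auto simp: hgt_def)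
    then have "\<beta> = 0" using cf_expansion[of \<beta>] by simp
    then show False using pos_nonzero b by auto
  qed
  ultimately show ?thesis by simp
qed

lemma pos_iff: "\<beta> \<in> \<Phi> \<Longrightarrow> \<beta> \<in> P \<longleftrightarrow> hgt \<beta> > 0"
  using pos_hgt pos_or_neg[of \<beta>] pos_hgt[of "- \<beta>"] by (auto simp: hgt_minus)

lemma not_pos_iff: "\<beta> \<in> \<Phi> \<Longrightarrow> \<beta> \<notin> P \<longleftrightarrow> hgt \<beta> < 0"
  using pos_hgt[of \<beta>] pos_or_neg[of \<beta>] pos_hgt[of "- \<beta>"] by (auto simp: hgt_minus)

lemma simple_pos: "al i \<in> P"
  using pos_iff simple_root hgt_simple by simp

lemma pos_hgt_nat: "\<beta> \<in> P \<Longrightarrow> hgt \<beta> \<in> \<nat>"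
proof -
  assume b: "\<beta> \<in> P"
  have "(\<Sum>i\<in>A. cf i \<beta>) \<in> \<nat>" for A
    by (induction A rule: infinite_finite_induct) (simp_all add: pos_cf_nat b)
  then show ?thesis by (simp add: hgt_def)
qed

text \<open>The reflection changes only the coordinate at \<alpha>_i. If the image were negative,
  all other coordinates of \<beta> would vanish, and a positive root proportional to \<alpha>_i is
  \<alpha>_i because the system is reduced.\<close>

lemma simple_reflection_pos:
  assumes "\<beta> \<in> P" "\<beta> \<noteq> al i"
  shows "s i \<beta> \<in> P"
proof (rule ccontr)
  assume neg: "s i \<beta> \<notin> P"
  have r: "s i \<beta> \<in> \<Phi>" using root_reflection simple_root pos_root assms by blast
  then have n: "- s i \<beta> \<in> P" using neg pos_or_neg by blast
  have "cf j \<beta> = 0" if "j \<noteq> i" for j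
  proof -
    have "cf j (s i \<beta>) = cf j \<beta>"
      using that by (simp add: reflection_def cf_diff cf_scale cf_simple)
    then show ?thesis using pos_cf_nonneg[OF n, of j] pos_cf_nonneg[OF assms(1), of j]
      by (simp add: cf_minus)
  qed
  then have "\<beta> = (\<Sum>j\<in>UNIV. (if j = i then cf i \<beta> *\<^sub>R al i else 0))"
    by (subst cf_expansion) (intro sum.cong, auto)
  then have b: "\<beta> = cf i \<beta> *\<^sub>R al i" by simp
  then have "cf i \<beta> = 1 \<or> cf i \<beta> = -1"
    using root_reduced[OF simple_root, of "cf i \<beta>" i] pos_root[OF assms(1)] by simp
  then have "cf i \<beta> = 1" using pos_cf_nonneg[OF assms(1), of i] by auto
  then show False using b assms(2) by simp
qed

lemma simple_reflection_neg_iff: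
  assumes "\<beta> \<in> \<Phi>" "\<beta> \<noteq> al i" "\<beta> \<noteq> - al i"
  shows "s i \<beta> \<in> P \<longleftrightarrow> \<beta> \<in> P"
proof
  assume "s i \<beta> \<in> P"
  moreover have "s i \<beta> \<noteq> al i"
    using assms(3) reflection_reflection[of "al i" \<beta>] reflection_self[of "al i"] by auto
  ultimately show "\<beta> \<in> P"
    using simple_reflection_pos[of "s i \<beta>" i] by (simp add: reflection_reflection)
qed (use assms simple_reflection_pos in auto)

text \<open>Since |\<beta>|^2 is the sum of the coordinates of \<beta> times its inner products with
  the simple roots, some \<alpha>_i has positive inner product with \<beta>; reflecting in it lowers
  the height.\<close>

lemma pos_induct [consumes 1, case_names simple reflect]:
  assumes "\<beta> \<in> P" "\<And>i. Q (al i)" "\<And>\<beta> i. \<beta> \<in> P \<Longrightarrow> s i \<beta> \<in> P \<Longrightarrow> Q \<beta> \<Longrightarrow> Q (s i \<beta>)"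
  shows "Q \<beta>"
  using assms(1)
proof (induction "nat \<lfloor>hgt \<beta>\<rfloor>" arbitrary: \<beta> rule: less_induct)
  case less
  have "\<exists>i. \<beta> \<bullet> al i > 0"
  proof (rule ccontr)
    assume "\<not> (\<exists>i. \<beta> \<bullet> al i > 0)"
    then have "\<beta> \<bullet> al i \<le> 0" for i by (auto simp: not_less)
    then have "(\<Sum>i\<in>UNIV. cf i \<beta> * (\<beta> \<bullet> al i)) \<le> 0"
      using pos_cf_nonneg[OF less.prems] by (intro sum_nonpos) (simp add: mult_nonneg_nonpos)
    also have "(\<Sum>i\<in>UNIV. cf i \<beta> * (\<beta> \<bullet> al i)) = \<beta> \<bullet> \<beta>"
      by (subst (4) cf_expansion) (simp add: inner_sum_right)
    finally show False using pos_nonzero[OF less.prems] inner_gt_zero_iff[of \<beta>] by linarith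
  qed
  then obtain i where i: "\<beta> \<bullet> al i > 0" by blast
  show ?case
  proof (cases "\<beta> = al i")
    case False
    then have p: "s i \<beta> \<in> P" using simple_reflection_pos less.prems by blast
    have "hgt (s i \<beta>) < hgt \<beta>"
      using i by (simp add: reflection_def hgt_diff hgt_scale hgt_simple inner_coroot)
    moreover obtain m n where "hgt (s i \<beta>) = of_nat m" "hgt \<beta> = of_nat n"
      using pos_hgt_nat[OF p] pos_hgt_nat[OF less.prems] by (metis Nats_cases)
    ultimately have "nat \<lfloor>hgt (s i \<beta>)\<rfloor> < nat \<lfloor>hgt \<beta>\<rfloor>" by simp
    then have "Q (s i \<beta>)" using less.hyps p by blast
    then have "Q (s i (s i \<beta>))" using assms(3)[of "s i \<beta>" i] p less.prems by (simp add: reflection_reflection)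
    then show ?thesis by (simp add: reflection_reflection)
  qed (use assms(2) in simp)
qed

subsection \<open>Words in the simple reflections\<close>

lemma sw_Nil [simp]: "sw [] = id"
  by (simp add: simple_word_def)

lemma sw_Cons [simp]: "sw (i # ws) = s i \<circ> sw ws"
  by (simp add: simple_word_def)

lemma sw_append: "sw (xs @ ys) = sw xs \<circ> sw ys"
  by (induction xs) (simp_all add: comp_assoc)

lemma sw_linear: "linear (sw ws)"
proof (induction ws)
  case (Cons i ws)
  then show ?case unfolding sw_Cons by (intro linear_compose linear_reflection)
qed (simp add: id_def module_hom_ident)

lemma sw_inner: "sw ws u \<bullet> sw ws v = u \<bullet> v"
  by (induction ws) (simp_all add: reflection_inner)

lemma sw_root: "\<beta> \<in> \<Phi> \<Longrightarrow> sw ws \<beta> \<in> \<Phi>"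
  by (induction ws) (simp_all add: root_reflection simple_root)

lemma sw_rev_left [simp]: "sw (rev ws) (sw ws v) = v"
  by (induction ws arbitrary: v) (simp_all add: sw_append reflection_reflection)

lemma sw_rev_right [simp]: "sw ws (sw (rev ws) v) = v"
  using sw_rev_left[of "rev ws" v] by simp

lemma sw_reflection: "reflection (sw ws \<alpha>) (sw ws v) = sw ws (reflection \<alpha> v)"
  by (rule reflection_isometry) (simp_all add: sw_linear sw_inner)

lemma sw_coroot: "coroot (sw ws \<alpha>) = sw ws (coroot \<alpha>)"
  by (rule coroot_isometry) (simp_all add: sw_linear sw_inner)

lemma reflection_word: "\<beta> \<in> P \<Longrightarrow> \<exists>ws. reflection \<beta> = sw ws"
proof (induction rule: pos_induct)
  case (simple i)
  have "reflection (al i) = sw [i]" by simp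
  then show ?case by blast
next
  case (reflect \<beta> i)
  then obtain ws where "reflection \<beta> = sw ws" by blast
  then have "reflection (s i \<beta>) = sw ([i] @ ws @ [i])"
    unfolding sw_append by (simp add: reflection_conj comp_assoc)
  then show ?case by blast
qed

text \<open>The strong exchange condition. When the letters are applied to \<gamma> one after the
  other, the sign changes at some letter i; there the partial image is \<alpha>_i, and deleting this
  letter amounts to multiplying by the reflection in \<gamma>.\<close>

lemma exchange:
  assumes "\<gamma> \<in> P" "sw ws \<gamma> \<notin> P"
  shows "\<exists>xs i ys. ws = xs @ i # ys \<and> sw ys \<gamma> = al i \<and> sw (xs @ ys) = sw ws \<circ> reflection \<gamma>"
  using assms(2)
proof (induction ws)
  case Nil
  then show ?case using assms by simp
next
  case (Cons i ws)
  show ?case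
  proof (cases "sw ws \<gamma> \<in> P")
    case True
    then have e: "sw ws \<gamma> = al i"
      using Cons.prems simple_reflection_pos by auto
    have "s i (sw ws v) = sw ws (reflection \<gamma> v)" for v
      using sw_reflection[of ws \<gamma> v] e by simp
    then have "s i (sw ws (reflection \<gamma> v)) = sw ws v" for v
      using reflection_reflection[of "al i" "sw ws v"] by simp
    then have "sw ([] @ ws) = sw (i # ws) \<circ> reflection \<gamma>" by (intro ext) simp
    moreover have "i # ws = [] @ i # ws" by simp
    ultimately show ?thesis using e by blast
  next
    case False
    then obtain xs j ys where "ws = xs @ j # ys" "sw ys \<gamma> = al j"
      "sw (xs @ ys) = sw ws \<circ> reflection \<gamma>" using Cons.IH by blast
    then have "i # ws = (i # xs) @ j # ys" "sw ys \<gamma> = al j"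
      "sw ((i # xs) @ ys) = sw (i # ws) \<circ> reflection \<gamma>"
      by (simp_all add: comp_assoc)
    then show ?thesis by blast
  qed
qed

lemma wl_le: "wl (sw ws) \<le> length ws"
  unfolding weyl_length_def by (rule Least_le) auto

lemma reduced_exists: "\<exists>vs. reduced_word al (sw ws) vs"
proof -
  have "\<exists>vs. length vs = wl (sw ws) \<and> sw vs = sw ws"
    unfolding weyl_length_def by (rule LeastI[of _ "length ws"]) auto
  then show ?thesis by (auto simp: reduced_word_def)
qed

abbreviation reduced :: "'l list \<Rightarrow> bool" where
  "reduced ws \<equiv> wl (sw ws) = length ws"

lemma reduced_exists': obtains vs where "sw vs = sw ws" "reduced vs" "length vs = wl (sw ws)"
  using reduced_exists[of ws] unfolding reduced_word_def by metis

lemma wl_mult_le: "wl (sw xs \<circ> sw ys) \<le> wl (sw xs) + wl (sw ys)"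
proof -
  obtain xs' ys' where "sw xs' = sw xs" "length xs' = wl (sw xs)" "sw ys' = sw ys" "length ys' = wl (sw ys)"
    using reduced_exists' by metis
  then show ?thesis using wl_le[of "xs' @ ys'"] by (simp add: sw_append)
qed

lemma sw_eq_rev: "sw xs = sw ys \<Longrightarrow> sw (rev xs) = sw (rev ys)"
proof
  fix v
  assume e: "sw xs = sw ys"
  have "sw (rev xs) v = sw (rev xs) (sw xs (sw (rev ys) v))" unfolding e by simp
  then show "sw (rev xs) v = sw (rev ys) v" by simp
qed

lemma wl_rev: "wl (sw (rev ws)) = wl (sw ws)"
proof -
  have "wl (sw (rev ws)) \<le> wl (sw ws)" for ws
  proof -
    obtain vs where "sw vs = sw ws" "length vs = wl (sw ws)" using reduced_exists' by metis
    then show ?thesis using wl_le[of "rev vs"] sw_eq_rev[of vs ws] by simp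
  qed
  from this[of ws] this[of "rev ws"] show ?thesis by simp
qed

lemma reduced_append: "reduced (xs @ ys) \<Longrightarrow> reduced xs \<and> reduced ys"
  using wl_mult_le[of xs ys] wl_le[of xs] wl_le[of ys] by (simp add: sw_append)

lemma wl_reflection_less:
  assumes "\<gamma> \<in> P" "sw ws \<gamma> \<notin> P"
  shows "wl (sw ws \<circ> reflection \<gamma>) < wl (sw ws)"
proof -
  obtain vs where vs: "sw vs = sw ws" "length vs = wl (sw ws)" using reduced_exists' by metis
  obtain xs i ys where "vs = xs @ i # ys" "sw (xs @ ys) = sw vs \<circ> reflection \<gamma>"
    using exchange[of \<gamma> vs] assms vs by auto
  then show ?thesis using wl_le[of "xs @ ys"] vs by simp
qed

text \<open>The element obtained by composing with the reflection makes \<gamma> negative, so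
  \<open>wl_reflection_less\<close> applies to it and leads back to the original element.\<close>

lemma wl_reflection_greater:
  assumes "\<gamma> \<in> P" "sw ws \<gamma> \<in> P"
  shows "wl (sw ws) < wl (sw ws \<circ> reflection \<gamma>)"
proof -
  obtain rs where rs: "reflection \<gamma> = sw rs" using reflection_word assms by blast
  have r: "reflection \<gamma> \<gamma> = - \<gamma>" using pos_nonzero assms by (simp add: reflection_self)
  have "sw (ws @ rs) \<gamma> = - sw ws \<gamma>"
    by (simp add: sw_append flip: rs) (simp add: r linear_neg sw_linear)
  moreover have "- sw ws \<gamma> \<notin> P"
    using pos_hgt[of "- sw ws \<gamma>"] pos_hgt[OF assms(2)] by (auto simp: hgt_minus)
  ultimately have "wl (sw (ws @ rs) \<circ> reflection \<gamma>) < wl (sw (ws @ rs))"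
    using assms by (intro wl_reflection_less) simp_all
  moreover have "sw (ws @ rs) \<circ> reflection \<gamma> = sw ws"
    using reflection_comp_self[of \<gamma>] pos_nonzero[OF assms(1)]
    by (simp add: sw_append comp_assoc flip: rs)
  ultimately show ?thesis by (simp add: sw_append flip: rs)
qed

subsection \<open>Inversions\<close>

definition inversions :: "('a \<Rightarrow> 'a) \<Rightarrow> 'a set" where
  "inversions w = {\<gamma> \<in> P. w \<gamma> \<notin> P}"

lemma finite_inversions: "finite (inversions w)"
  by (simp add: inversions_def finite_pos)

text \<open>The root belonging to a letter is the one whose reflection, multiplied from the right,
  deletes that letter; see \<open>sw_del_nth\<close>.\<close>

fun word_roots :: "'l list \<Rightarrow> 'a list" where
  "word_roots [] = []"
| "word_roots (i # ws) = sw (rev ws) (al i) # word_roots ws"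

lemma length_word_roots [simp]: "length (word_roots ws) = length ws"
  by (induction ws) auto

lemma reduced_Cons_root_pos:
  assumes "reduced (i # ws)"
  shows "sw (rev ws) (al i) \<in> P"
proof (rule ccontr)
  assume "sw (rev ws) (al i) \<notin> P"
  then have "wl (sw (rev ws) \<circ> s i) < wl (sw (rev ws))"
    by (intro wl_reflection_less simple_pos)
  moreover have "sw (rev ws) \<circ> s i = sw (rev (i # ws))" by (simp add: sw_append)
  ultimately have "wl (sw (i # ws)) < wl (sw ws)"
    using wl_rev[of ws] wl_rev[of "i # ws"] by simp
  then show False using assms wl_le[of ws] by simp
qed

text \<open>A new first letter i changes the sign only of roots that the rest of the word sends to
  \<alpha>_i or its negative. Among positive roots this is just the new entry \<gamma>, which is
  positive because the longer word is reduced.\<close>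

lemma reduced_word_roots:
  "reduced ws \<Longrightarrow> distinct (word_roots ws) \<and> set (word_roots ws) = inversions (sw ws)"
proof (induction ws)
  case Nil
  then show ?case by (auto simp: inversions_def)
next
  case (Cons i ws)
  define \<gamma> where "\<gamma> = sw (rev ws) (al i)"
  have red: "reduced ws" using reduced_append[of "[i]" ws] Cons.prems by (metis append_Cons append_Nil)
  have IH: "distinct (word_roots ws)" "set (word_roots ws) = inversions (sw ws)"
    using Cons.IH red by auto
  have g: "\<gamma> \<in> P" unfolding \<gamma>_def by (rule reduced_Cons_root_pos[OF Cons.prems])
  have wg: "sw ws \<gamma> = al i" by (simp add: \<gamma>_def)
  have ng: "\<gamma> \<notin> inversions (sw ws)" using wg simple_pos by (simp add: inversions_def)
  have na: "- al i \<notin> P" using pos_hgt[of "- al i"] by (auto simp: hgt_minus hgt_simple)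
  have other: "\<delta> \<in> inversions (sw (i # ws)) \<longleftrightarrow> \<delta> \<in> inversions (sw ws)" if "\<delta> \<noteq> \<gamma>" for \<delta>
  proof (cases "\<delta> \<in> P")
    case True
    have 1: "sw ws \<delta> \<noteq> al i" using that \<gamma>_def sw_rev_left by metis
    have 2: "sw ws \<delta> \<noteq> - al i"
    proof
      assume "sw ws \<delta> = - al i"
      then have "\<delta> = sw (rev ws) (- al i)" using sw_rev_left[of ws \<delta>] by simp
      then have "\<delta> = - \<gamma>" by (simp add: \<gamma>_def linear_neg sw_linear)
      then show False using pos_hgt[OF True] pos_hgt[OF g] by (simp add: hgt_minus)
    qed
    show ?thesis
      using simple_reflection_neg_iff[OF sw_root[OF pos_root[OF True]] 1 2] True
      by (simp add: inversions_def)
  qed (simp add: inversions_def)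
  have self: "\<gamma> \<in> inversions (sw (i # ws))"
    using g wg na by (simp add: inversions_def reflection_self)
  have "inversions (sw (i # ws)) = insert \<gamma> (inversions (sw ws))"
  proof (rule Set.set_eqI)
    fix \<delta>
    show "\<delta> \<in> inversions (sw (i # ws)) \<longleftrightarrow> \<delta> \<in> insert \<gamma> (inversions (sw ws))"
      using other[of \<delta>] self by (cases "\<delta> = \<gamma>") (simp_all only: insert_iff simp_thms)
  qed
  then show ?case using IH ng by (simp add: \<gamma>_def comp_def)
qed

lemma wl_eq_card_inversions: "wl (sw ws) = card (inversions (sw ws))"
proof -
  obtain vs where vs: "sw vs = sw ws" "reduced vs" using reduced_exists' by metis
  then have "card (inversions (sw vs)) = length (word_roots vs)"
    using reduced_word_roots distinct_card by metis
  then show ?thesis using vs by simp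
qed

subsection \<open>Coroot heights and quantum roots\<close>

lemma coroot_int: "\<beta> \<in> P \<Longrightarrow> \<omega> j \<bullet> coroot \<beta> \<in> \<int>"
proof (induction rule: pos_induct)
  case (simple i)
  then show ?case by (simp add: fund_weight_coroot)
next
  case (reflect \<beta> i)
  then show ?case
    by (auto simp: coroot_reflection reflection_coroot inner_diff_right fund_weight_coroot
        intro!: root_integral pos_root simple_root)
qed

lemma coroot_nonneg: "\<beta> \<in> P \<Longrightarrow> \<omega> j \<bullet> coroot \<beta> \<ge> 0"
proof -
  assume b: "\<beta> \<in> P"
  have "\<omega> j \<bullet> \<beta> = cf j \<beta> * (al j \<bullet> al j) / 2" by (simp add: cf_def)
  moreover have "cf j \<beta> * (al j \<bullet> al j) / 2 \<ge> 0" using pos_cf_nonneg[OF b, of j] by simp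
  ultimately have "\<omega> j \<bullet> \<beta> \<ge> 0" by linarith
  then show ?thesis by (simp add: inner_coroot)
qed

lemma coroot_expansion: "v = (\<Sum>i\<in>UNIV. (\<omega> i \<bullet> v) *\<^sub>R coroot (al i))"
  by (subst cf_expansion) (simp add: cf_def coroot_def ac_simps)

lemma coroot_coeff:
  assumes "\<beta> \<in> P"
  shows "real (coroot_coeff al \<beta> i) = \<omega> i \<bullet> coroot \<beta>"
proof -
  define m where "m i = nat \<lfloor>\<omega> i \<bullet> coroot \<beta>\<rfloor>" for i
  have m: "real (m i) = \<omega> i \<bullet> coroot \<beta>" for i
    using coroot_int[OF assms, of i] coroot_nonneg[OF assms, of i] by (auto simp: m_def elim: Ints_cases)
  have u: "n = m" if "coroot \<beta> = (\<Sum>i\<in>UNIV. real (n i) *\<^sub>R coroot (al i))" for n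
  proof
    fix j
    have "\<omega> j \<bullet> coroot \<beta> = real (n j)"
      by (subst that) (simp add: inner_sum_right fund_weight_coroot if_distrib sum.delta cong: if_cong)
    then show "n j = m j" using m[of j] by linarith
  qed
  have "coroot \<beta> = (\<Sum>i\<in>UNIV. real (m i) *\<^sub>R coroot (al i))"
    by (subst coroot_expansion) (simp add: m)
  then have "coroot_coeff al \<beta> = m"
    unfolding coroot_coeff_def using u by (intro the_equality) auto
  then show ?thesis using m by simp
qed

lemma coroot_coeff_add:
  assumes "\<beta> \<in> P" "\<gamma> \<in> P" "\<delta> \<in> P" "coroot \<beta> = coroot \<gamma> + coroot \<delta>"
  shows "coroot_coeff al \<beta> i = coroot_coeff al \<gamma> i + coroot_coeff al \<delta> i"
proof -
  have "real (coroot_coeff al \<beta> i) = real (coroot_coeff al \<gamma> i + coroot_coeff al \<delta> i)"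
    using assms by (simp add: coroot_coeff inner_add_right)
  then show ?thesis by linarith
qed

lemma coroot_height_add:
  assumes "\<beta> \<in> P" "\<gamma> \<in> P" "\<delta> \<in> P" "coroot \<beta> = coroot \<gamma> + coroot \<delta>"
  shows "coroot_height al \<beta> = coroot_height al \<gamma> + coroot_height al \<delta>"
  using coroot_coeff_add[OF assms] by (simp add: coroot_height_def sum.distrib)

text \<open>The reflection permutes the positive roots that it keeps positive and reverses the sign
  of their pairing with the coroot of \<beta>, so their contributions cancel.\<close>

lemma inversion_reflection_sum:
  assumes "\<beta> \<in> P"
  shows "(\<Sum>\<gamma>\<in>P. \<gamma> \<bullet> coroot \<beta>) = (\<Sum>\<gamma>\<in>inversions (reflection \<beta>). \<gamma> \<bullet> coroot \<beta>)"
proof -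
  let ?N = "inversions (reflection \<beta>)"
  have nz: "\<beta> \<noteq> 0" using pos_nonzero assms by blast
  have e: "reflection \<beta> \<gamma> \<bullet> coroot \<beta> = - (\<gamma> \<bullet> coroot \<beta>)" for \<gamma>
    using nz by (simp add: reflection_def inner_diff_left self_inner_coroot)
  have "(\<Sum>\<gamma>\<in>P - ?N. \<gamma> \<bullet> coroot \<beta>) = (\<Sum>\<gamma>\<in>P - ?N. - (\<gamma> \<bullet> coroot \<beta>))"
    by (rule sum.reindex_bij_witness[of _ "reflection \<beta>" "reflection \<beta>"])
       (auto simp: inversions_def reflection_reflection[OF nz] e)
  then have "(\<Sum>\<gamma>\<in>P - ?N. \<gamma> \<bullet> coroot \<beta>) = 0" by (simp add: sum_negf)
  moreover have "(\<Sum>\<gamma>\<in>P. \<gamma> \<bullet> coroot \<beta>) = (\<Sum>\<gamma>\<in>P - ?N. \<gamma> \<bullet> coroot \<beta>) + (\<Sum>\<gamma>\<in>?N. \<gamma> \<bullet> coroot \<beta>)"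
    by (rule sum.subset_diff) (auto simp: inversions_def finite_pos)
  ultimately show ?thesis by simp
qed

lemma inversions_simple: "inversions (s i) = {al i}"
proof -
  have "- al i \<notin> P" using pos_hgt[of "- al i"] by (auto simp: hgt_minus hgt_simple)
  then show ?thesis
    using simple_reflection_pos simple_pos by (auto simp: inversions_def reflection_self)
qed

text \<open>The sum of all positive roots (twice the Weyl vector) pairs to 2 with every simple
  coroot, hence to twice the height with any positive coroot.\<close>

lemma sum_inversions_coroot:
  assumes "\<beta> \<in> P"
  shows "(\<Sum>\<gamma>\<in>inversions (reflection \<beta>). \<gamma> \<bullet> coroot \<beta>) = 2 * real (coroot_height al \<beta>)"
proof -
  have 2: "(\<Sum>\<gamma>\<in>P. \<gamma>) \<bullet> coroot (al i) = 2" for i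
    using inversion_reflection_sum[OF simple_pos[of i]]
    by (simp add: inversions_simple inner_sum_left self_inner_coroot)
  have "(\<Sum>\<gamma>\<in>inversions (reflection \<beta>). \<gamma> \<bullet> coroot \<beta>) = (\<Sum>\<gamma>\<in>P. \<gamma>) \<bullet> coroot \<beta>"
    using inversion_reflection_sum[OF assms] by (simp add: inner_sum_left)
  also have "\<dots> = (\<Sum>i\<in>UNIV. (\<omega> i \<bullet> coroot \<beta>) * 2)"
    by (subst coroot_expansion) (simp add: inner_sum_right 2)
  also have "\<dots> = 2 * real (coroot_height al \<beta>)"
    by (simp add: coroot_height_def sum_distrib_left coroot_coeff[OF assms] mult.commute)
  finally show ?thesis .
qed

text \<open>Subtracting the multiple of \<beta> makes the positive height of \<gamma> negative, so
  the multiple is positive; it is an integer.\<close>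

lemma inversion_reflection_ge1:
  assumes "\<beta> \<in> P" "\<gamma> \<in> inversions (reflection \<beta>)"
  shows "\<gamma> \<bullet> coroot \<beta> \<ge> 1"
proof -
  have g: "\<gamma> \<in> P" and n: "reflection \<beta> \<gamma> \<notin> P" using assms by (auto simp: inversions_def)
  have "hgt (reflection \<beta> \<gamma>) < 0"
    using n not_pos_iff root_reflection pos_root assms(1) g by blast
  then have "hgt \<gamma> < (\<gamma> \<bullet> coroot \<beta>) * hgt \<beta>" by (simp add: reflection_def hgt_diff hgt_scale)
  then have "(\<gamma> \<bullet> coroot \<beta>) * hgt \<beta> > 0" using pos_hgt[OF g] by linarith
  then have "\<gamma> \<bullet> coroot \<beta> > 0" using pos_hgt[OF assms(1)] by (simp add: zero_less_mult_iff)
  then show ?thesis using root_integral[OF pos_root pos_root, OF assms(1) g] by (auto elim!: Ints_cases)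
qed

lemma self_inversion: "\<beta> \<in> P \<Longrightarrow> \<beta> \<in> inversions (reflection \<beta>)"
  using pos_hgt[of \<beta>] pos_hgt[of "- \<beta>"]
  by (auto simp: inversions_def reflection_self pos_nonzero hgt_minus)

lemma wl_reflection_card: "\<beta> \<in> P \<Longrightarrow> wl (reflection \<beta>) = card (inversions (reflection \<beta>))"
  using reflection_word wl_eq_card_inversions by metis

text \<open>The root \<beta> contributes 2 to the preceding sum and every other inversion at least
  1. The defect in the length bound is thus a sum of nonnegative terms, which yields both the bound
  and a description of equality.\<close>

lemma wl_reflection_excess:
  assumes "\<beta> \<in> P"
  shows "2 * real (coroot_height al \<beta>) - 1 - real (wl (reflection \<beta>))
      = (\<Sum>\<gamma>\<in>inversions (reflection \<beta>) - {\<beta>}. \<gamma> \<bullet> coroot \<beta> - 1)"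
proof -
  let ?N = "inversions (reflection \<beta>)"
  have "(\<Sum>\<gamma>\<in>?N. \<gamma> \<bullet> coroot \<beta> - 1) = 2 * real (coroot_height al \<beta>) - real (wl (reflection \<beta>))"
    by (simp add: sum_subtractf sum_inversions_coroot assms wl_reflection_card)
  moreover have "(\<Sum>\<gamma>\<in>?N. \<gamma> \<bullet> coroot \<beta> - 1) = 1 + (\<Sum>\<gamma>\<in>?N - {\<beta>}. \<gamma> \<bullet> coroot \<beta> - 1)"
    using sum.remove[OF finite_inversions self_inversion[OF assms], of "\<lambda>\<gamma>. \<gamma> \<bullet> coroot \<beta> - 1"]
    by (simp add: self_inner_coroot pos_nonzero[OF assms])
  ultimately show ?thesis by simp
qed

lemma wl_reflection_le:
  assumes "\<beta> \<in> P"
  shows "wl (reflection \<beta>) + 1 \<le> 2 * coroot_height al \<beta>"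
proof -
  have "(\<Sum>\<gamma>\<in>inversions (reflection \<beta>) - {\<beta>}. \<gamma> \<bullet> coroot \<beta> - 1) \<ge> 0"
    using inversion_reflection_ge1[OF assms] by (intro sum_nonneg) auto
  then have "2 * real (coroot_height al \<beta>) \<ge> real (wl (reflection \<beta>)) + 1"
    using wl_reflection_excess[OF assms] by simp
  then show ?thesis by linarith
qed

abbreviation "QR \<equiv> quantum_roots \<Phi> al"

lemma QR_pos: "\<beta> \<in> QR \<Longrightarrow> \<beta> \<in> P"
  by (simp add: quantum_roots_def)

lemma QR_iff: "\<beta> \<in> QR \<longleftrightarrow> \<beta> \<in> P \<and> wl (reflection \<beta>) + 1 = 2 * coroot_height al \<beta>"
  by (auto simp: quantum_roots_def)

lemma finite_QR: "finite QR"
  using finite_pos by (auto simp: quantum_roots_def)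

lemma QR_inversion:
  assumes "\<beta> \<in> QR" "\<gamma> \<in> inversions (reflection \<beta>)" "\<gamma> \<noteq> \<beta>"
  shows "\<gamma> \<bullet> coroot \<beta> = 1"
proof -
  have b: "\<beta> \<in> P" using assms QR_pos by blast
  have "real (wl (reflection \<beta>) + 1) = real (2 * coroot_height al \<beta>)"
    using assms(1) unfolding QR_iff by presburger
  then have "(\<Sum>\<gamma>\<in>inversions (reflection \<beta>) - {\<beta>}. \<gamma> \<bullet> coroot \<beta> - 1) = 0"
    using wl_reflection_excess[OF b] by simp
  then have "\<forall>\<gamma>\<in>inversions (reflection \<beta>) - {\<beta>}. \<gamma> \<bullet> coroot \<beta> - 1 = 0"
    using inversion_reflection_ge1[OF b]
    by (subst (asm) sum_nonneg_eq_0_iff) (auto simp: finite_inversions)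
  then show ?thesis using assms by auto
qed

lemma simple_QR: "al i \<in> QR"
proof -
  have "wl (s i) = 1" using wl_reflection_card[OF simple_pos] by (simp add: inversions_simple)
  moreover have "2 * real (coroot_height al (al i)) = 2"
    using sum_inversions_coroot[OF simple_pos[of i]] by (simp add: inversions_simple self_inner_coroot)
  ultimately show ?thesis by (simp add: QR_iff simple_pos)
qed

end

section \<open>Cancelling pairs of reflections\<close>

context root_base
begin

text \<open>Strict Cauchy-Schwarz inequality: the component u of x orthogonal to y is nonzero
  because the system is reduced.\<close>

lemma inner_coroot_product_less_4:
  assumes "x \<in> \<Phi>" "y \<in> \<Phi>" "x \<noteq> y" "x \<noteq> - y"
  shows "(x \<bullet> coroot y) * (y \<bullet> coroot x) < 4"
proof -
  have nz: "x \<bullet> x > 0" "y \<bullet> y > 0" using root_nonzero assms by auto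
  define u where "u = x - ((x \<bullet> y) / (y \<bullet> y)) *\<^sub>R y"
  have "u \<noteq> 0"
  proof
    assume "u = 0"
    then obtain c where x: "x = c *\<^sub>R y" by (auto simp: u_def)
    then have "c = 1 \<or> c = -1"
      using root_reduced[OF assms(2), of c] assms(1) by simp
    then show False using x assms(3,4) by auto
  qed
  then have "u \<bullet> u > 0" by simp
  moreover have "u \<bullet> u = x \<bullet> x - (x \<bullet> y) * (x \<bullet> y) / (y \<bullet> y)"
    using nz by (simp add: u_def inner_diff_left inner_diff_right inner_commute)
  ultimately have "(x \<bullet> y) * (x \<bullet> y) / (y \<bullet> y) < x \<bullet> x" by linarith
  then have less: "(x \<bullet> y) * (x \<bullet> y) < (x \<bullet> x) * (y \<bullet> y)"
    by (simp only: pos_divide_less_eq[OF nz(2)])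
  have "(x \<bullet> coroot y) * (y \<bullet> coroot x) = 4 * ((x \<bullet> y) * (x \<bullet> y)) / ((x \<bullet> x) * (y \<bullet> y))"
    by (simp add: inner_coroot inner_commute mult.commute)
  also have "\<dots> < 4"
    using less mult_pos_pos[OF nz] by (subst pos_divide_less_eq) linarith+
  finally show ?thesis .
qed

section \<open>Lengths of products of two reflections\<close>

lemma reflection_word_rev: "\<beta> \<in> P \<Longrightarrow> reflection \<beta> = sw ws \<Longrightarrow> sw (rev ws) = reflection \<beta>"
proof
  fix v
  assume b: "\<beta> \<in> P" and ws: "reflection \<beta> = sw ws"
  have "sw (rev ws) v = sw (rev ws) (sw ws (reflection \<beta> v))"
    using reflection_reflection[OF pos_nonzero[OF b]] by (simp flip: ws)
  then show "sw (rev ws) v = reflection \<beta> v" by simp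
qed

lemma wl_two_reflections_le:
  assumes "x \<in> P" "y \<in> P"
  shows "wl (reflection x \<circ> reflection y) \<le> wl (reflection x) + wl (reflection y)"
  using reflection_word[OF assms(1)] reflection_word[OF assms(2)] wl_mult_le by metis

lemma wl_two_reflections_commute:
  assumes "x \<in> P" "y \<in> P"
  shows "wl (reflection x \<circ> reflection y) = wl (reflection y \<circ> reflection x)"
proof -
  obtain xs ys where xs: "reflection x = sw xs" and ys: "reflection y = sw ys"
    using reflection_word assms by metis
  have "wl (sw (rev (xs @ ys))) = wl (sw (xs @ ys))" by (rule wl_rev)
  then show ?thesis
    using reflection_word_rev[OF assms(1) xs] reflection_word_rev[OF assms(2) ys]
    by (simp add: sw_append flip: xs ys)
qed

lemma wl_comp_reflection_less:
  assumes "x \<in> P" "\<gamma> \<in> P" "reflection x \<gamma> \<notin> P"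
  shows "wl (reflection x \<circ> reflection \<gamma>) < wl (reflection x)"
  using reflection_word[OF assms(1)] wl_reflection_less[OF assms(2)] assms(3) by metis

text \<open>The length of the product is at most the sum of the lengths, and each length is at most
  twice the height minus one. The hypothesis forces equality in all three bounds.\<close>

lemma QR_pair:
  assumes "x \<in> P" "y \<in> P"
    and "2 * (coroot_height al x + coroot_height al y) \<le> wl (reflection x \<circ> reflection y) + 2"
  shows "x \<in> QR" "y \<in> QR"
    and "wl (reflection x \<circ> reflection y) = wl (reflection x) + wl (reflection y)"
  using assms wl_two_reflections_le[OF assms(1,2)] wl_reflection_le[OF assms(1)]
    wl_reflection_le[OF assms(2)]
  by (auto simp: QR_iff)

text \<open>The index sets of the two kinds of terms in the commutator of \<open>\<Lambda>\<^sub>i\<close> and \<open>\<Lambda>\<^sub>j\<close>: those that come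
  from moving a variable past \<open>\<Delta>\<^sub>w\<close>, and those that come from products \<open>\<Delta>\<^sub>u \<Delta>\<^sub>v\<close>.\<close>

definition chevalley_pairs :: "('a \<times> 'a) set" where
  "chevalley_pairs = {(\<beta>, \<gamma>). \<beta> \<in> QR \<and> \<gamma> \<in> inversions (reflection \<beta>) \<and> \<gamma> \<noteq> \<beta> \<and>
     wl (reflection \<beta> \<circ> reflection \<gamma>) + 1 = wl (reflection \<beta>)}"

definition product_pairs :: "('a \<times> 'a) set" where
  "product_pairs = {(\<alpha>, \<beta>). \<alpha> \<in> QR \<and> \<beta> \<in> QR \<and>
     wl (reflection \<alpha> \<circ> reflection \<beta>) = wl (reflection \<alpha>) + wl (reflection \<beta>)}"

lemma finite_chevalley_pairs: "finite chevalley_pairs"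
  by (rule finite_subset[of _ "P \<times> P"])
     (auto simp: chevalley_pairs_def inversions_def QR_pos finite_pos)

lemma finite_product_pairs: "finite product_pairs"
  by (rule finite_subset[of _ "P \<times> P"]) (auto simp: product_pairs_def QR_pos finite_pos)

text \<open>Here \<open>\<beta>\<close> is a long and \<open>\<gamma>\<close> a short root of a subsystem of type \<open>G\<^sub>2\<close>. The product of the two
  reflections is also the product of the reflections in \<open>3 \<gamma> - \<beta>\<close> and \<open>\<beta> - 2 \<gamma>\<close>, which are short
  enough for the bound.\<close>

lemma wl_G2_less:
  assumes P: "\<beta> \<in> P" "\<gamma> \<in> P" and gb: "\<gamma> \<bullet> coroot \<beta> = 1" and bg: "\<beta> \<bullet> coroot \<gamma> = 3"
    and neg: "reflection \<gamma> \<beta> \<notin> P" and eps: "\<beta> - 2 *\<^sub>R \<gamma> \<in> P"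
  shows "wl (reflection \<beta> \<circ> reflection \<gamma>) + 2 < 2 * coroot_height al \<beta>"
proof -
  define \<mu> where "\<mu> = - reflection \<gamma> \<beta>"
  define \<epsilon> where "\<epsilon> = \<beta> - 2 *\<^sub>R \<gamma>"
  have nz: "\<beta> \<noteq> 0" "\<gamma> \<noteq> 0" using P pos_nonzero by auto
  have mu: "\<mu> \<in> P"
    using neg pos_or_neg[OF root_reflection[OF pos_root pos_root, OF P(2,1)]] by (simp add: \<mu>_def)
  have mu_nz: "\<mu> \<noteq> 0" using mu pos_nonzero by blast
  have cmu: "coroot \<mu> = coroot \<gamma> - coroot \<beta>"
    unfolding \<mu>_def coroot_uminus coroot_reflection[OF nz(2)] reflection_coroot[OF nz(2)] gb by simp
  have mug: "\<mu> = 3 *\<^sub>R \<gamma> - \<beta>" by (simp add: \<mu>_def reflection_def bg)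
  have gmu: "\<gamma> \<bullet> coroot \<mu> = 1" by (simp add: cmu inner_diff_right gb self_inner_coroot nz)
  have mucg: "\<mu> \<bullet> coroot \<gamma> = 3" by (simp add: mug inner_diff_left bg self_inner_coroot nz)
  have e: "reflection \<mu> \<gamma> = \<epsilon>"
  proof -
    have "reflection \<mu> \<gamma> = \<gamma> - \<mu>" by (simp add: reflection_def gmu)
    then show ?thesis using scaleR_add_left[of 1 2 \<gamma>] by (simp add: \<epsilon>_def mug)
  qed
  have ce: "coroot \<epsilon> = coroot \<gamma> - 3 *\<^sub>R coroot \<mu>"
    unfolding e[symmetric] coroot_reflection[OF mu_nz] reflection_coroot[OF mu_nz] mucg ..
  have "reflection \<mu> = reflection \<gamma> \<circ> reflection \<beta> \<circ> reflection \<gamma>"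
    unfolding \<mu>_def reflection_uminus_root by (rule reflection_conj[OF nz(2)])
  moreover have "reflection \<epsilon> = reflection \<mu> \<circ> reflection \<gamma> \<circ> reflection \<mu>"
    unfolding e[symmetric] by (rule reflection_conj[OF mu_nz])
  ultimately have r: "reflection \<mu> \<circ> reflection \<epsilon> = reflection \<beta> \<circ> reflection \<gamma>"
    by (intro ext) (simp add: reflection_reflection nz mu_nz)
  have "coroot \<gamma> = coroot \<beta> + coroot \<mu>" by (simp add: cmu)
  then have h1: "coroot_height al \<gamma> = coroot_height al \<beta> + coroot_height al \<mu>"
    using coroot_height_add[OF P(2,1) mu] by blast
  have h2: "coroot_height al \<epsilon> + 3 * coroot_height al \<mu> = coroot_height al \<gamma>"
  proof -
    have ep: "\<epsilon> \<in> P" using eps by (simp add: \<epsilon>_def)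
    have "real (coroot_coeff al \<epsilon> i) + 3 * real (coroot_coeff al \<mu> i) = real (coroot_coeff al \<gamma> i)" for i
      using coroot_coeff[OF ep, of i] coroot_coeff[OF mu, of i] coroot_coeff[OF P(2), of i]
      by (simp add: ce inner_diff_right)
    then have "coroot_coeff al \<epsilon> i + 3 * coroot_coeff al \<mu> i = coroot_coeff al \<gamma> i" for i
      by (metis (no_types) of_nat_add of_nat_eq_iff of_nat_mult of_nat_numeral)
    then show ?thesis
      unfolding coroot_height_def by (simp add: sum_distrib_left flip: sum.distrib)
  qed
  have "wl (reflection \<mu> \<circ> reflection \<epsilon>) + 2 \<le> 2 * coroot_height al \<mu> + 2 * coroot_height al \<epsilon>"
    using wl_two_reflections_le[OF mu eps] wl_reflection_le[OF mu] wl_reflection_le[OF eps]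
    by (simp add: \<epsilon>_def)
  \<comment> \<open>By \<open>h1\<close> and \<open>h2\<close> the heights of \<mu> and \<epsilon>
    add up to that of \<beta> minus that of \<mu>; this makes the final inequality strict.\<close>
  moreover have "coroot_height al \<mu> > 0" using wl_reflection_le[OF mu] by simp
  ultimately show ?thesis using h1 h2 by (simp add: r)
qed

text \<open>For a quantum root every other inversion pairs to exactly 1, so reflecting \<gamma> in
  \<beta> subtracts \<beta> once and makes \<beta> - \<gamma> a positive root.\<close>

lemma chevalley_pair:
  assumes "(\<beta>, \<gamma>) \<in> chevalley_pairs"
  shows "\<beta> \<in> P" "\<gamma> \<in> P" "\<gamma> \<bullet> coroot \<beta> = 1" "\<beta> - \<gamma> \<in> P" "reflection \<beta> \<gamma> = \<gamma> - \<beta>"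
    "wl (reflection \<beta> \<circ> reflection \<gamma>) + 2 = 2 * coroot_height al \<beta>"
proof -
  have b: "\<beta> \<in> QR" and g: "\<gamma> \<in> inversions (reflection \<beta>)" "\<gamma> \<noteq> \<beta>"
    and l: "wl (reflection \<beta> \<circ> reflection \<gamma>) + 1 = wl (reflection \<beta>)"
    using assms by (auto simp: chevalley_pairs_def)
  show bP: "\<beta> \<in> P" and gP: "\<gamma> \<in> P" using b g by (auto simp: QR_pos inversions_def)
  show gb: "\<gamma> \<bullet> coroot \<beta> = 1" using QR_inversion b g by blast
  show r: "reflection \<beta> \<gamma> = \<gamma> - \<beta>" by (simp add: reflection_def gb)
  have "reflection \<beta> \<gamma> \<in> \<Phi>" "reflection \<beta> \<gamma> \<notin> P"
    using g bP gP root_reflection pos_root by (auto simp: inversions_def)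
  then show "\<beta> - \<gamma> \<in> P" using pos_or_neg[of "reflection \<beta> \<gamma>"] by (simp add: r)
  show "wl (reflection \<beta> \<circ> reflection \<gamma>) + 2 = 2 * coroot_height al \<beta>"
    using b l by (simp add: QR_iff)
qed

text \<open>The root \<delta> is minus the reflection of \<gamma> in \<beta>. It factors the same
  group element in the opposite order and so offers a second candidate for the partner of the
  pair.\<close>

lemma chevalley_pair_complement:
  assumes "(\<beta>, \<gamma>) \<in> chevalley_pairs"
  defines "\<delta> \<equiv> \<beta> - \<gamma>"
  shows "\<delta> \<bullet> coroot \<beta> = 1" "\<beta> \<bullet> coroot \<delta> = \<beta> \<bullet> coroot \<gamma>"
    "coroot \<gamma> = (\<beta> \<bullet> coroot \<gamma>) *\<^sub>R coroot \<beta> - coroot \<delta>"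
    "reflection \<delta> \<circ> reflection \<beta> = reflection \<beta> \<circ> reflection \<gamma>"
proof -
  note c = chevalley_pair[OF assms(1)]
  have nz: "\<beta> \<noteq> 0" using c pos_nonzero by blast
  have d: "\<delta> = - reflection \<beta> \<gamma>" by (simp add: \<delta>_def c(5))
  show "\<delta> \<bullet> coroot \<beta> = 1"
    by (simp add: \<delta>_def inner_diff_left c(3) self_inner_coroot nz)
  have cd: "coroot \<delta> = (\<beta> \<bullet> coroot \<gamma>) *\<^sub>R coroot \<beta> - coroot \<gamma>"
    unfolding d coroot_uminus coroot_reflection[OF nz] reflection_coroot[OF nz] by simp
  then show "coroot \<gamma> = (\<beta> \<bullet> coroot \<gamma>) *\<^sub>R coroot \<beta> - coroot \<delta>" by simp
  show "\<beta> \<bullet> coroot \<delta> = \<beta> \<bullet> coroot \<gamma>"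
    by (simp add: cd inner_diff_right self_inner_coroot nz)
  have "reflection \<delta> = reflection \<beta> \<circ> reflection \<gamma> \<circ> reflection \<beta>"
    unfolding d reflection_uminus_root by (rule reflection_conj[OF nz])
  then show "reflection \<delta> \<circ> reflection \<beta> = reflection \<beta> \<circ> reflection \<gamma>"
    by (intro ext) (simp add: reflection_reflection nz)
qed

text \<open>At least one of the two candidate partners consists of positive roots. The second
  conclusion keeps the two cases apart: it shows that a partner of the second kind does not have the
  pairing -1 that marks the first kind.\<close>

lemma chevalley_pair_dichotomy:
  assumes "(\<beta>, \<gamma>) \<in> chevalley_pairs" "reflection \<gamma> \<beta> \<notin> P"
  shows "reflection (\<beta> - \<gamma>) \<beta> \<in> P" "\<beta> \<bullet> coroot \<gamma> \<noteq> 1"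
proof -
  note c = chevalley_pair[OF assms(1)]
  note cc = chevalley_pair_complement[OF assms(1)]
  define \<delta> where "\<delta> = \<beta> - \<gamma>"
  define n where "n = \<beta> \<bullet> coroot \<gamma>"
  have nz: "\<beta> \<noteq> 0" "\<gamma> \<noteq> 0" using c pos_nonzero by auto
  have r1: "reflection \<gamma> \<beta> = \<beta> - n *\<^sub>R \<gamma>" by (simp add: reflection_def n_def)
  have r2: "reflection \<delta> \<beta> = \<beta> - n *\<^sub>R \<delta>" by (simp add: reflection_def n_def \<delta>_def cc(2))
  show "n \<noteq> 1" using assms(2) c(4) r1 by auto
  show "reflection \<delta> \<beta> \<in> P"
  proof (rule ccontr)
    assume neg: "reflection \<delta> \<beta> \<notin> P"
    have h1: "hgt \<beta> - n * hgt \<gamma> < 0"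
      using assms(2) not_pos_iff[OF root_reflection[OF pos_root pos_root, OF c(2,1)]]
      by (simp add: r1 hgt_diff hgt_scale)
    have dP: "\<delta> \<in> P" using c by (simp add: \<delta>_def)
    have h2: "hgt \<beta> - n * hgt \<delta> < 0"
      using neg not_pos_iff[OF root_reflection[OF pos_root pos_root, OF dP c(1)]]
      by (simp add: r2 hgt_diff hgt_scale)
    \<comment> \<open>Sum of \<open>h1\<close> and \<open>h2\<close>, as the heights of \<gamma> and
      \<delta> add up to that of \<beta>.\<close>
    have "(2 - n) * hgt \<beta> < 0" using h1 h2 by (simp add: \<delta>_def hgt_diff algebra_simps)
    then have n2: "n > 2" using pos_hgt[OF c(1)] by (simp add: mult_less_0_iff)
    have "\<gamma> \<noteq> \<beta>" "\<gamma> \<noteq> - \<beta>" using c(3) self_inner_coroot[OF nz(1)] by auto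
    then have "1 * n < 4"
      using inner_coroot_product_less_4[of \<gamma> \<beta>] c by (simp add: n_def pos_root)
    moreover have "n \<in> \<int>" using root_integral c pos_root by (simp add: n_def)
    ultimately have n3: "n = 3" using n2 by (auto elim!: Ints_cases)
    have mnz: "reflection \<gamma> \<beta> \<in> \<Phi>" using root_reflection pos_root c by blast
    have "reflection (reflection \<gamma> \<beta>) \<gamma> = \<beta> - 2 *\<^sub>R \<gamma>"
    proof -
      have "\<gamma> \<bullet> coroot (reflection \<gamma> \<beta>) = -1"
        unfolding coroot_reflection[OF nz(2)] reflection_coroot[OF nz(2)]
        by (simp add: inner_diff_right c(3) self_inner_coroot nz)
      then have "reflection (reflection \<gamma> \<beta>) \<gamma> = \<gamma> + reflection \<gamma> \<beta>"
        by (simp add: reflection_def[of "reflection \<gamma> \<beta>"])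
      then show ?thesis using scaleR_add_left[of 1 2 \<gamma>] by (simp add: r1 n3)
    qed
    then have eps: "\<beta> - 2 *\<^sub>R \<gamma> \<in> \<Phi>" using root_reflection[OF mnz pos_root[OF c(2)]] by simp
    \<comment> \<open>The roots \<gamma> and \<delta> play symmetric roles: \<beta> - 2 \<gamma> and
      \<beta> - 2 \<delta> are opposite, so one of them is positive, and the two products with
      \<beta> have equal length.\<close>
    show False
    proof (cases "\<beta> - 2 *\<^sub>R \<gamma> \<in> P")
      case True
      then show False using wl_G2_less[OF c(1,2,3) _ assms(2) True] n3 c(6) by (simp add: n_def)
    next
      case False
      have "\<beta> - 2 *\<^sub>R \<delta> = - (\<beta> - 2 *\<^sub>R \<gamma>)" by (simp add: \<delta>_def scaleR_2 algebra_simps)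
      then have "\<beta> - 2 *\<^sub>R \<delta> \<in> P" using False pos_or_neg[OF eps] by simp
      then have "wl (reflection \<beta> \<circ> reflection \<delta>) + 2 < 2 * coroot_height al \<beta>"
        using cc(1,2) n3 neg by (intro wl_G2_less c(1) dP) (simp_all add: \<delta>_def n_def)
      moreover have "wl (reflection \<beta> \<circ> reflection \<delta>) = wl (reflection \<beta> \<circ> reflection \<gamma>)"
        using wl_two_reflections_commute[OF c(1) dP] cc(4) by (simp add: \<delta>_def)
      ultimately show False using c(6) by simp
    qed
  qed
qed

text \<open>Partner of the first kind. The coroots, hence the heights, of \<gamma> and \<nu> add up
  to those of \<beta>, and the group element is unchanged, so equality for \<beta> carries over to
  the new pair by \<open>QR_pair\<close>.\<close>

lemma chevalley_to_product1:
  assumes "(\<beta>, \<gamma>) \<in> chevalley_pairs" "reflection \<gamma> \<beta> \<in> P"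
  defines "\<nu> \<equiv> reflection \<gamma> \<beta>"
  shows "(\<gamma>, \<nu>) \<in> product_pairs" "\<gamma> \<bullet> coroot \<nu> = -1" "coroot \<beta> = coroot \<gamma> + coroot \<nu>"
    "reflection \<gamma> \<circ> reflection \<nu> = reflection \<beta> \<circ> reflection \<gamma>"
proof -
  note c = chevalley_pair[OF assms(1)]
  have nz: "\<beta> \<noteq> 0" "\<gamma> \<noteq> 0" using c pos_nonzero by auto
  have cn: "coroot \<nu> = coroot \<beta> - coroot \<gamma>"
    unfolding \<nu>_def coroot_reflection[OF nz(2)] reflection_coroot[OF nz(2)] by (simp add: c(3))
  then show cb: "coroot \<beta> = coroot \<gamma> + coroot \<nu>" by simp
  show "\<gamma> \<bullet> coroot \<nu> = -1" by (simp add: cn inner_diff_right c(3) self_inner_coroot nz)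
  have "reflection \<nu> = reflection \<gamma> \<circ> reflection \<beta> \<circ> reflection \<gamma>"
    unfolding \<nu>_def by (rule reflection_conj[OF nz(2)])
  then show r: "reflection \<gamma> \<circ> reflection \<nu> = reflection \<beta> \<circ> reflection \<gamma>"
    by (intro ext) (simp add: reflection_reflection nz)
  have nP: "\<nu> \<in> P" using assms by simp
  have "coroot_height al \<beta> = coroot_height al \<gamma> + coroot_height al \<nu>"
    by (rule coroot_height_add[OF c(1,2) nP cb])
  then have "2 * (coroot_height al \<gamma> + coroot_height al \<nu>) \<le> wl (reflection \<gamma> \<circ> reflection \<nu>) + 2"
    using c(6) r by simp
  from QR_pair[OF c(2) nP this] show "(\<gamma>, \<nu>) \<in> product_pairs" by (simp add: product_pairs_def)
qed

text \<open>Partner of the second kind, with \<delta> in place of \<gamma> and the order of the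
  factors reversed; \<open>chevalley_pair_dichotomy\<close> supplies the positivity of
  \<nu>.\<close>

lemma chevalley_to_product2:
  assumes "(\<beta>, \<gamma>) \<in> chevalley_pairs" "reflection \<gamma> \<beta> \<notin> P"
  defines "\<delta> \<equiv> \<beta> - \<gamma>"
  defines "\<nu> \<equiv> reflection \<delta> \<beta>"
  shows "(\<nu>, \<delta>) \<in> product_pairs" "\<delta> \<bullet> coroot \<nu> = -1" "\<nu> \<bullet> coroot \<delta> \<noteq> -1"
    "coroot \<beta> = coroot \<nu> + coroot \<delta>"
    "reflection \<nu> \<circ> reflection \<delta> = reflection \<beta> \<circ> reflection \<gamma>"
proof -
  note c = chevalley_pair[OF assms(1)]
  note cc = chevalley_pair_complement[OF assms(1), folded \<delta>_def]
  note d = chevalley_pair_dichotomy[OF assms(1,2), folded \<delta>_def]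
  have dP: "\<delta> \<in> P" using c by (simp add: \<delta>_def)
  have nz: "\<beta> \<noteq> 0" "\<delta> \<noteq> 0" using c dP pos_nonzero by auto
  have cn: "coroot \<nu> = coroot \<beta> - coroot \<delta>"
    unfolding \<nu>_def coroot_reflection[OF nz(2)] reflection_coroot[OF nz(2)] by (simp add: cc(1))
  then show cb: "coroot \<beta> = coroot \<nu> + coroot \<delta>" by simp
  show "\<delta> \<bullet> coroot \<nu> = -1" by (simp add: cn inner_diff_right cc(1) self_inner_coroot nz)
  have "\<nu> \<bullet> coroot \<delta> = - (\<beta> \<bullet> coroot \<delta>)"
    by (simp add: \<nu>_def reflection_def inner_diff_left self_inner_coroot nz)
  then show "\<nu> \<bullet> coroot \<delta> \<noteq> -1" using d(2) cc(2) by simp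
  have "reflection \<nu> = reflection \<delta> \<circ> reflection \<beta> \<circ> reflection \<delta>"
    unfolding \<nu>_def by (rule reflection_conj[OF nz(2)])
  then have "reflection \<nu> \<circ> reflection \<delta> = reflection \<delta> \<circ> reflection \<beta>"
    by (intro ext) (simp add: reflection_reflection nz)
  then show r: "reflection \<nu> \<circ> reflection \<delta> = reflection \<beta> \<circ> reflection \<gamma>" by (simp add: cc(4))
  have nP: "\<nu> \<in> P" using d by (simp add: \<nu>_def)
  have "coroot_height al \<beta> = coroot_height al \<nu> + coroot_height al \<delta>"
    by (rule coroot_height_add[OF c(1) nP dP cb])
  then have "2 * (coroot_height al \<nu> + coroot_height al \<delta>) \<le> wl (reflection \<nu> \<circ> reflection \<delta>) + 2"
    using c(6) r by simp
  from QR_pair[OF nP dP this] show "(\<nu>, \<delta>) \<in> product_pairs" by (simp add: product_pairs_def)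
qed

text \<open>If one reflection made the root of the other negative, the product of the two would be
  shorter than a single factor, against additivity of the lengths.\<close>

lemma product_pair:
  assumes "(x, y) \<in> product_pairs"
  shows "x \<in> P" "y \<in> P" "reflection x y \<in> P" "reflection y x \<in> P"
    "wl (reflection x \<circ> reflection y) + 2 = 2 * (coroot_height al x + coroot_height al y)"
proof -
  have q: "x \<in> QR" "y \<in> QR"
    and l: "wl (reflection x \<circ> reflection y) = wl (reflection x) + wl (reflection y)"
    using assms by (auto simp: product_pairs_def)
  show xP: "x \<in> P" and yP: "y \<in> P" using q QR_pos by auto
  show "reflection x y \<in> P" using wl_comp_reflection_less[OF xP yP] l by fastforce
  show "reflection y x \<in> P"
    using wl_comp_reflection_less[OF yP xP] l wl_two_reflections_commute[OF xP yP] by fastforce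
  show "wl (reflection x \<circ> reflection y) + 2 = 2 * (coroot_height al x + coroot_height al y)"
    using q l by (simp add: QR_iff)
qed

text \<open>An acute angle is impossible: the product of the pairings is below 4, so one of them
  would be 1, and positivity of both reflected roots would put each height strictly above the other.
  For an obtuse angle the same bound makes one pairing -1.\<close>

lemma product_pair_nonorth:
  assumes "(x, y) \<in> product_pairs" "x \<bullet> y \<noteq> 0"
  shows "x \<bullet> coroot y \<le> -1" "y \<bullet> coroot x \<le> -1" "x \<bullet> coroot y = -1 \<or> y \<bullet> coroot x = -1"
proof -
  note p = product_pair[OF assms(1)]
  define a where "a = x \<bullet> coroot y"
  define b where "b = y \<bullet> coroot x"
  have nz: "x \<bullet> x > 0" "y \<bullet> y > 0" using p pos_nonzero by auto
  have hx: "hgt x > 0" and hy: "hgt y > 0" using p pos_hgt by auto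
  have h1: "hgt y - b * hgt x > 0" using pos_hgt[OF p(3)] by (simp add: reflection_def hgt_diff hgt_scale b_def)
  have h2: "hgt x - a * hgt y > 0" using pos_hgt[OF p(4)] by (simp add: reflection_def hgt_diff hgt_scale a_def)
  have "x \<noteq> y" using h1 hx self_inner_coroot[of x] nz by (auto simp: b_def)
  moreover have "x \<noteq> - y" using hx hy by (auto simp: hgt_minus)
  ultimately have ab: "a * b < 4"
    using inner_coroot_product_less_4[of x y] p pos_root by (simp add: a_def b_def)
  obtain m n :: int where mn: "a = of_int m" "b = of_int n"
    using root_integral p pos_root by (metis Ints_cases a_def b_def)
  have m0: "m \<noteq> 0" and n0: "n \<noteq> 0" using assms(2) mn nz by (auto simp: a_def b_def inner_coroot inner_commute)
  have "a * b > 0"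
  proof -
    have "a * b = 4 * (x \<bullet> y)\<^sup>2 / ((x \<bullet> x) * (y \<bullet> y))"
      by (simp add: a_def b_def inner_coroot inner_commute power2_eq_square)
    then show ?thesis using assms(2) nz by simp
  qed
  then have mn0: "m * n > 0" and mn4: "m * n < 4" using ab
    by (simp_all add: mn flip: of_int_mult)
  have neg: "m < 0"
  proof (rule ccontr)
    assume "\<not> m < 0"
    then have mp: "m \<ge> 1" "n \<ge> 1" using m0 n0 mn0 by (auto simp: zero_less_mult_iff)
    have "m = 1 \<or> n = 1"
    proof (rule ccontr)
      assume "\<not> (m = 1 \<or> n = 1)"
      then have "m \<ge> 2" "n \<ge> 2" using mp by auto
      then have "2 * 2 \<le> m * n" by (intro mult_mono) auto
      then show False using mn4 by simp
    qed
    then show False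
    proof
      assume "m = 1"
      then have "hgt x > hgt y" using h2 mn by simp
      moreover have "b * hgt x \<ge> 1 * hgt x" using mp mn hx by (intro mult_right_mono) auto
      ultimately show False using h1 by linarith
    next
      assume "n = 1"
      then have "hgt y > hgt x" using h1 mn by simp
      moreover have "a * hgt y \<ge> 1 * hgt y" using mp mn hy by (intro mult_right_mono) auto
      ultimately show False using h2 by linarith
    qed
  qed
  then have neg': "n < 0" using mn0 by (simp add: zero_less_mult_iff)
  have "m = -1 \<or> n = -1"
  proof (rule ccontr)
    assume "\<not> (m = -1 \<or> n = -1)"
    then have "- m \<ge> 2" "- n \<ge> 2" using neg neg' by auto
    then have "2 * 2 \<le> (- m) * (- n)" by (intro mult_mono) auto
    then show False using mn4 by simp
  qed
  then show "x \<bullet> coroot y = -1 \<or> y \<bullet> coroot x = -1" using mn by (auto simp: a_def b_def)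
  show "x \<bullet> coroot y \<le> -1" "y \<bullet> coroot x \<le> -1" using neg neg' mn by (auto simp: a_def b_def)
qed

text \<open>The length of the product is strictly below that of the reflection in \<beta>, which is
  at most twice the height minus one; the last hypothesis leaves no gap in either
  inequality.\<close>

lemma chevalley_pairI:
  assumes "\<beta> \<in> P" "\<gamma> \<in> P" "reflection \<beta> \<gamma> \<notin> P" "\<gamma> \<noteq> \<beta>"
    and "wl (reflection \<beta> \<circ> reflection \<gamma>) + 2 = 2 * coroot_height al \<beta>"
  shows "(\<beta>, \<gamma>) \<in> chevalley_pairs"
  using assms wl_comp_reflection_less[OF assms(1-3)] wl_reflection_le[OF assms(1)]
  by (auto simp: chevalley_pairs_def QR_iff inversions_def)

text \<open>Inverse of the passage in \<open>chevalley_to_product1\<close>: the reflected root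
  \<beta> is the one whose coroot is the sum of the two given coroots.\<close>

lemma product_to_chevalley1:
  assumes "(x, y) \<in> product_pairs" "x \<bullet> y \<noteq> 0" "x \<bullet> coroot y = -1"
  defines "\<beta> \<equiv> reflection x y"
  shows "(\<beta>, x) \<in> chevalley_pairs" "reflection x \<beta> = y"
proof -
  note p = product_pair[OF assms(1)]
  note n = product_pair_nonorth[OF assms(1,2)]
  have nz: "x \<noteq> 0" "y \<noteq> 0" using p pos_nonzero by auto
  show rb: "reflection x \<beta> = y" by (simp add: \<beta>_def reflection_reflection nz)
  have bP: "\<beta> \<in> P" using p by (simp add: \<beta>_def)
  have cb: "coroot \<beta> = coroot x + coroot y"
    unfolding \<beta>_def coroot_reflection[OF nz(1)] reflection_coroot[OF nz(1)] by (simp add: assms(3))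
  have xb: "x \<bullet> coroot \<beta> = 1" by (simp add: cb inner_add_right assms(3) self_inner_coroot nz)
  have "reflection \<beta> = reflection x \<circ> reflection y \<circ> reflection x"
    unfolding \<beta>_def by (rule reflection_conj[OF nz(1)])
  then have r: "reflection \<beta> \<circ> reflection x = reflection x \<circ> reflection y"
    by (intro ext) (simp add: reflection_reflection nz)
  have be: "hgt \<beta> = hgt y - (y \<bullet> coroot x) * hgt x"
    by (simp add: \<beta>_def reflection_def hgt_diff hgt_scale)
  have "hgt (reflection \<beta> x) < 0"
  proof -
    have "hgt (reflection \<beta> x) = (1 + (y \<bullet> coroot x)) * hgt x - hgt y"
      using be by (simp add: reflection_def[of \<beta>] xb hgt_diff hgt_scale algebra_simps)
    moreover have "(1 + (y \<bullet> coroot x)) * hgt x \<le> 0"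
      using n(2) pos_hgt[OF p(1)] by (simp add: mult_le_0_iff)
    ultimately show ?thesis using pos_hgt[OF p(2)] by linarith
  qed
  then have "reflection \<beta> x \<notin> P" using pos_hgt by fastforce
  moreover have "x \<noteq> \<beta>" using xb self_inner_coroot[OF nz(1)] by auto
  moreover have "wl (reflection \<beta> \<circ> reflection x) + 2 = 2 * coroot_height al \<beta>"
    using p(5) coroot_height_add[OF bP p(1,2) cb] r by simp
  ultimately show "(\<beta>, x) \<in> chevalley_pairs" using chevalley_pairI bP p(1) by blast
qed

text \<open>Inverse of the passage in \<open>chevalley_to_product2\<close>. Here the other pairing
  must be -1, so \<beta> is obtained by reflecting x in y instead.\<close>

lemma product_to_chevalley2:
  assumes "(x, y) \<in> product_pairs" "x \<bullet> y \<noteq> 0" "x \<bullet> coroot y \<noteq> -1"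
  defines "\<beta> \<equiv> reflection y x"
  shows "(\<beta>, \<beta> - y) \<in> chevalley_pairs" "reflection (\<beta> - y) \<beta> \<notin> P" "reflection y \<beta> = x"
proof -
  note p = product_pair[OF assms(1)]
  note n = product_pair_nonorth[OF assms(1,2)]
  define a where "a = x \<bullet> coroot y"
  define \<gamma> where "\<gamma> = \<beta> - y"
  have nz: "x \<noteq> 0" "y \<noteq> 0" using p pos_nonzero by auto
  have yx: "y \<bullet> coroot x = -1" using n(3) assms(3) by auto
  have a2: "a \<le> -2"
  proof -
    have "a \<in> \<int>" using root_integral p pos_root by (simp add: a_def)
    then obtain z where z: "a = of_int z" by (rule Ints_cases)
    have "z \<le> -1" "z \<noteq> -1" using n(1) assms(3) z by (auto simp: a_def)
    then have "z \<le> -2" by simp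
    then show ?thesis by (simp add: z)
  qed
  show rb: "reflection y \<beta> = x" by (simp add: \<beta>_def reflection_reflection nz)
  have bP: "\<beta> \<in> P" using p by (simp add: \<beta>_def)
  have bnz: "\<beta> \<noteq> 0" using bP pos_nonzero by blast
  have be: "\<beta> = x - a *\<^sub>R y" by (simp add: \<beta>_def reflection_def a_def)
  have cb: "coroot \<beta> = coroot x + coroot y"
    unfolding \<beta>_def coroot_reflection[OF nz(2)] reflection_coroot[OF nz(2)] by (simp add: yx)
  have yb: "y \<bullet> coroot \<beta> = 1" by (simp add: cb inner_add_right yx self_inner_coroot nz)
  have g: "\<gamma> = - reflection \<beta> y" by (simp add: \<gamma>_def reflection_def yb)
  have hg: "hgt \<gamma> > 0"
  proof -
    have "(- a - 1) * hgt y > 0" using a2 pos_hgt[OF p(2)] by simp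
    moreover have "hgt \<gamma> = hgt x + (- a - 1) * hgt y"
    proof -
      have "hgt \<beta> = hgt x - a * hgt y" by (simp add: be hgt_diff hgt_scale)
      then show ?thesis by (simp add: \<gamma>_def hgt_diff left_diff_distrib)
    qed
    ultimately show ?thesis using pos_hgt[OF p(1)] by linarith
  qed
  have gP: "\<gamma> \<in> P"
    using hg root_uminus[OF root_reflection[OF pos_root pos_root, OF bP p(2)]] pos_iff by (simp add: g)
  have "reflection \<gamma> = reflection \<beta> \<circ> reflection y \<circ> reflection \<beta>"
    unfolding g reflection_uminus_root by (rule reflection_conj[OF bnz])
  moreover have "reflection \<beta> = reflection y \<circ> reflection x \<circ> reflection y"
    unfolding \<beta>_def by (rule reflection_conj[OF nz(2)])
  ultimately have r: "reflection \<beta> \<circ> reflection \<gamma> = reflection x \<circ> reflection y"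
    by (intro ext) (simp add: reflection_reflection nz)
  have "reflection \<beta> \<gamma> = - y"
    by (simp add: g reflection_minus reflection_reflection bnz)
  then have "reflection \<beta> \<gamma> \<notin> P"
    using pos_hgt[of "- y"] pos_hgt[OF p(2)] by (auto simp: hgt_minus)
  moreover have "\<gamma> \<noteq> \<beta>" using nz by (simp add: \<gamma>_def)
  moreover have "wl (reflection \<beta> \<circ> reflection \<gamma>) + 2 = 2 * coroot_height al \<beta>"
    using p(5) coroot_height_add[OF bP p(1,2) cb] r by simp
  ultimately show "(\<beta>, \<gamma>) \<in> chevalley_pairs" using chevalley_pairI bP gP by blast
  note cc = chevalley_pair_complement[OF this]
  have "\<beta> \<bullet> coroot \<gamma> = - a"
  proof -
    have "\<beta> \<bullet> coroot y = - a" by (simp add: be inner_diff_left self_inner_coroot nz a_def)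
    moreover have "\<beta> - \<gamma> = y" by (simp add: \<gamma>_def)
    ultimately show ?thesis using cc(2) by simp
  qed
  then have "reflection \<gamma> \<beta> = \<beta> + a *\<^sub>R \<gamma>" by (simp add: reflection_def)
  then have "hgt (reflection \<gamma> \<beta>) = hgt \<beta> + a * hgt \<gamma>" by (simp add: hgt_add hgt_scale)
  moreover have "hgt x = hgt \<beta> + a * hgt y" by (simp add: be hgt_diff hgt_scale)
  moreover have "hgt \<gamma> = hgt \<beta> - hgt y" by (simp add: \<gamma>_def hgt_diff)
  ultimately have "hgt (reflection \<gamma> \<beta>) + hgt x = (2 + a) * hgt \<beta>" by (simp add: algebra_simps)
  moreover have "(2 + a) * hgt \<beta> \<le> 0" using a2 pos_hgt[OF bP] by (simp add: mult_le_0_iff)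
  ultimately have "hgt (reflection \<gamma> \<beta>) < 0" using pos_hgt[OF p(1)] by linarith
  then show "reflection \<gamma> \<beta> \<notin> P" using pos_hgt by fastforce
qed

text \<open>The alternating form \<omega>_i \<and> \<omega>_j on coroots. It arises by
  antisymmetrizing the coefficients of \<Lambda>_i \<Lambda>_j, and each passage to a partner
  reverses its sign.\<close>

definition wedge :: "'l \<Rightarrow> 'l \<Rightarrow> 'a \<Rightarrow> 'a \<Rightarrow> real" where
  "wedge i j x y = (\<omega> i \<bullet> coroot x) * (\<omega> j \<bullet> coroot y) - (\<omega> j \<bullet> coroot x) * (\<omega> i \<bullet> coroot y)"

text \<open>Each pair is matched with a partner that has the same coroot sum and the same group
  element but the opposite \<open>wedge\<close>: A1 with B1, A2 with B2. Orthogonal product pairs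
  are matched among themselves by swapping. T stands for any summand built from these three data,
  which separates the combinatorics from the operators.\<close>

lemma pair_cancellation:
  fixes T :: "real \<Rightarrow> 'a \<Rightarrow> ('a \<Rightarrow> 'a) \<Rightarrow> 'm::ab_group_add"
  assumes T: "\<And>c d w. T (- c) d w = - T c d w" and two: "\<And>x::'m. x = - x \<Longrightarrow> x = 0"
  shows "(\<Sum>(\<beta>, \<gamma>)\<in>chevalley_pairs. T (wedge i j \<beta> \<gamma>) (coroot \<beta>) (reflection \<beta> \<circ> reflection \<gamma>))
    + (\<Sum>(x, y)\<in>product_pairs. T (wedge i j x y) (coroot x + coroot y) (reflection x \<circ> reflection y)) = 0"
proof -
  let ?f = "\<lambda>(\<beta>, \<gamma>). T (wedge i j \<beta> \<gamma>) (coroot \<beta>) (reflection \<beta> \<circ> reflection \<gamma>)"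
  let ?g = "\<lambda>(x, y). T (wedge i j x y) (coroot x + coroot y) (reflection x \<circ> reflection y)"
  define A1 where "A1 = {(\<beta>, \<gamma>) \<in> chevalley_pairs. reflection \<gamma> \<beta> \<in> P}"
  define A2 where "A2 = {(\<beta>, \<gamma>) \<in> chevalley_pairs. reflection \<gamma> \<beta> \<notin> P}"
  define B0 where "B0 = {(x, y) \<in> product_pairs. x \<bullet> y = 0}"
  define B1 where "B1 = {(x, y) \<in> product_pairs. x \<bullet> y \<noteq> 0 \<and> x \<bullet> coroot y = -1}"
  define B2 where "B2 = {(x, y) \<in> product_pairs. x \<bullet> y \<noteq> 0 \<and> x \<bullet> coroot y \<noteq> -1}"
  have fin: "finite A1" "finite A2" "finite B0" "finite B1" "finite B2"
    using finite_chevalley_pairs finite_product_pairs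
    by (auto simp: A1_def A2_def B0_def B1_def B2_def intro: rev_finite_subset)
  have "chevalley_pairs = A1 \<union> A2" by (auto simp: A1_def A2_def)
  then have f: "sum ?f chevalley_pairs = sum ?f A1 + sum ?f A2"
    using fin by (simp only:) (rule sum.union_disjoint, auto simp: A1_def A2_def)
  have "product_pairs = B0 \<union> (B1 \<union> B2)" by (auto simp: B0_def B1_def B2_def)
  moreover have "sum ?g (B0 \<union> (B1 \<union> B2)) = sum ?g B0 + sum ?g (B1 \<union> B2)"
    using fin by (intro sum.union_disjoint) (auto simp: B0_def B1_def B2_def)
  moreover have "sum ?g (B1 \<union> B2) = sum ?g B1 + sum ?g B2"
    using fin by (intro sum.union_disjoint) (auto simp: B1_def B2_def)
  ultimately have g: "sum ?g product_pairs = sum ?g B0 + (sum ?g B1 + sum ?g B2)" by simp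
  have swap: "(y, x) \<in> B0 \<and> - ?g (y, x) = ?g (x, y)" if "(x, y) \<in> B0" for x y
  proof
    have p: "(x, y) \<in> product_pairs" and o: "x \<bullet> y = 0" using that by (auto simp: B0_def)
    have o': "x \<bullet> coroot y = 0" "y \<bullet> coroot x = 0" using o by (simp_all add: inner_coroot inner_commute)
    have c: "reflection x \<circ> reflection y = reflection y \<circ> reflection x"
      by (rule ext) (simp add: reflection_def inner_diff_left o' algebra_simps)
    have "(y, x) \<in> product_pairs" using p c by (auto simp: product_pairs_def)
    then show "(y, x) \<in> B0" using o by (simp add: B0_def inner_commute)
    have "wedge i j y x = - wedge i j x y" by (simp add: wedge_def)
    then show "- ?g (y, x) = ?g (x, y)" using c by (simp add: T add.commute)
  qed
  have "sum ?g B0 = (\<Sum>z\<in>B0. - ?g z)"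
    by (rule sum.reindex_bij_witness[of _ "\<lambda>(x, y). (y, x)" "\<lambda>(x, y). (y, x)"])
       (use swap in \<open>auto split: prod.split\<close>)
  \<comment> \<open>Swapping shows only that the sum equals its own negative; this is where the
    absence of 2-torsion enters.\<close>
  then have g0: "sum ?g B0 = 0" by (intro two) (simp add: sum_negf)
  have "sum ?f A1 = (\<Sum>z\<in>B1. - ?g z)"
  proof (rule sum.reindex_bij_witness[of _ "\<lambda>(x, y). (reflection x y, x)" "\<lambda>(\<beta>, \<gamma>). (\<gamma>, reflection \<gamma> \<beta>)"])
    fix z assume "z \<in> A1"
    then obtain \<beta> \<gamma> where z: "z = (\<beta>, \<gamma>)" and p: "(\<beta>, \<gamma>) \<in> chevalley_pairs" and P: "reflection \<gamma> \<beta> \<in> P"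
      by (auto simp: A1_def)
    note c = chevalley_to_product1[OF p P]
    have gnz: "\<gamma> \<noteq> 0" using chevalley_pair[OF p] pos_nonzero by blast
    show "(case case z of (\<beta>, \<gamma>) \<Rightarrow> (\<gamma>, reflection \<gamma> \<beta>) of (x, y) \<Rightarrow> (reflection x y, x)) = z"
      by (simp add: z reflection_reflection gnz)
    have "\<gamma> \<bullet> reflection \<gamma> \<beta> \<noteq> 0" using c(2) by (auto simp: inner_coroot)
    then show "(case z of (\<beta>, \<gamma>) \<Rightarrow> (\<gamma>, reflection \<gamma> \<beta>)) \<in> B1" using c by (simp add: z B1_def)
    have "wedge i j \<gamma> (reflection \<gamma> \<beta>) = - wedge i j \<beta> \<gamma>"
      by (simp add: wedge_def c(3) inner_add_right algebra_simps)
    then show "- ?g (case z of (\<beta>, \<gamma>) \<Rightarrow> (\<gamma>, reflection \<gamma> \<beta>)) = ?f z"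
      by (simp add: z T c(4) flip: c(3))
  next
    fix z assume "z \<in> B1"
    then obtain x y where z: "z = (x, y)" and p: "(x, y) \<in> product_pairs" "x \<bullet> y \<noteq> 0" "x \<bullet> coroot y = -1"
      by (auto simp: B1_def)
    note c = product_to_chevalley1[OF p]
    show "(case case z of (x, y) \<Rightarrow> (reflection x y, x) of (\<beta>, \<gamma>) \<Rightarrow> (\<gamma>, reflection \<gamma> \<beta>)) = z"
      by (simp add: z c)
    show "(case z of (x, y) \<Rightarrow> (reflection x y, x)) \<in> A1"
      using c product_pair[OF p(1)] by (simp add: z A1_def)
  qed
  then have g1: "sum ?f A1 = - sum ?g B1" by (simp add: sum_negf)
  have "sum ?f A2 = (\<Sum>z\<in>B2. - ?g z)"
  proof (rule sum.reindex_bij_witness[of _ "\<lambda>(x, y). (reflection y x, reflection y x - y)"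
        "\<lambda>(\<beta>, \<gamma>). (reflection (\<beta> - \<gamma>) \<beta>, \<beta> - \<gamma>)"])
    fix z assume "z \<in> A2"
    then obtain \<beta> \<gamma> where z: "z = (\<beta>, \<gamma>)" and p: "(\<beta>, \<gamma>) \<in> chevalley_pairs" and P: "reflection \<gamma> \<beta> \<notin> P"
      by (auto simp: A2_def)
    note c = chevalley_to_product2[OF p P]
    have dnz: "\<beta> - \<gamma> \<noteq> 0" using chevalley_pair[OF p] pos_nonzero by blast
    show "(case case z of (\<beta>, \<gamma>) \<Rightarrow> (reflection (\<beta> - \<gamma>) \<beta>, \<beta> - \<gamma>) of
        (x, y) \<Rightarrow> (reflection y x, reflection y x - y)) = z"
      by (simp add: z reflection_reflection[OF dnz])
    have "reflection (\<beta> - \<gamma>) \<beta> \<bullet> (\<beta> - \<gamma>) \<noteq> 0" using c(2) by (auto simp: inner_coroot inner_commute)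
    then show "(case z of (\<beta>, \<gamma>) \<Rightarrow> (reflection (\<beta> - \<gamma>) \<beta>, \<beta> - \<gamma>)) \<in> B2"
      using c by (simp add: z B2_def)
    have cg: "coroot \<gamma> = (\<beta> \<bullet> coroot \<gamma>) *\<^sub>R coroot \<beta> - coroot (\<beta> - \<gamma>)"
      by (rule chevalley_pair_complement(3)[OF p])
    have "wedge i j \<beta> \<gamma> = - wedge i j \<beta> (\<beta> - \<gamma>)"
      unfolding wedge_def by (subst (1 2) cg) (simp add: inner_diff_right algebra_simps)
    also have "wedge i j \<beta> (\<beta> - \<gamma>) = wedge i j (reflection (\<beta> - \<gamma>) \<beta>) (\<beta> - \<gamma>)"
      unfolding wedge_def by (subst (1 2) c(4)) (simp add: inner_add_right algebra_simps)
    finally have "wedge i j (reflection (\<beta> - \<gamma>) \<beta>) (\<beta> - \<gamma>) = - wedge i j \<beta> \<gamma>" by simp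
    then show "- ?g (case z of (\<beta>, \<gamma>) \<Rightarrow> (reflection (\<beta> - \<gamma>) \<beta>, \<beta> - \<gamma>)) = ?f z"
      by (simp add: z T c(5) flip: c(4))
  next
    fix z assume "z \<in> B2"
    then obtain x y where z: "z = (x, y)" and p: "(x, y) \<in> product_pairs" "x \<bullet> y \<noteq> 0" "x \<bullet> coroot y \<noteq> -1"
      by (auto simp: B2_def)
    note c = product_to_chevalley2[OF p]
    show "(case case z of (x, y) \<Rightarrow> (reflection y x, reflection y x - y) of
        (\<beta>, \<gamma>) \<Rightarrow> (reflection (\<beta> - \<gamma>) \<beta>, \<beta> - \<gamma>)) = z"
      by (simp add: z c)
    show "(case z of (x, y) \<Rightarrow> (reflection y x, reflection y x - y)) \<in> A2"
      using c by (simp add: z A2_def)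
  qed
  then have g2: "sum ?f A2 = - sum ?g B2" by (simp add: sum_negf)
  show ?thesis using f g g0 g1 g2 by simp
qed

end

section \<open>Divided differences\<close>

context root_base
begin

definition L :: "'a \<Rightarrow> ('l + 'l) mpoly" where
  "L v = emb_lam (lin_form al v)"

lemma L_eq: "L v = (\<Sum>j\<in>UNIV. pconst (v \<bullet> coroot (al j)) * pvar (Inl j))"
  by (simp add: L_def emb_lam_def lin_form_def psubst_simps)

lemma L_add: "L (u + v) = L u + L v"
  by (simp add: L_eq inner_add_left pconst_add distrib_right sum.distrib)

lemma L_scale: "L (c *\<^sub>R v) = pconst c * L v"
  by (simp add: L_eq pconst_mult sum_distrib_left mult.assoc)

lemma L_diff: "L (u - v) = L u - L v"
  by (simp add: L_eq inner_diff_left pconst_diff left_diff_distrib sum_subtractf)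

lemma L_sum: "L (sum f A) = (\<Sum>x\<in>A. L (f x))"
proof (induction A rule: infinite_finite_induct)
  case empty
  then show ?case using L_scale[of 0 0] by simp
next
  case (infinite A)
  then show ?case using L_scale[of 0 0] by simp
qed (simp_all add: L_add)

lemma L_uminus: "L (- v) = - L v"
  using L_scale[of "-1" v] by (simp add: pconst_uminus)

lemma L_fund_weight: "L (\<omega> i) = pvar (Inl i)"
proof -
  have "L (\<omega> i) = (\<Sum>j\<in>UNIV. if i = j then pvar (Inl j) else 0)"
    unfolding L_eq by (intro sum.cong) (auto simp: fund_weight_coroot)
  then show ?thesis by simp
qed

lemma L_nonzero: "v \<noteq> 0 \<Longrightarrow> L v \<noteq> 0"
proof
  assume v: "v \<noteq> 0" and L: "L v = 0"
  have "v \<bullet> coroot (al j) = 0 \<bullet> coroot (al j)" for j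
  proof -
    have "peval (\<lambda>x. if x = Inl j then 1 else 0) (L v) = v \<bullet> coroot (al j)"
      by (simp add: L_eq peval_sum peval_mult if_distrib sum.delta cong: if_cong)
    then show ?thesis using L by simp
  qed
  then have "v \<bullet> al j = 0 \<bullet> al j" for j by (simp only: inner_coroot_simple_eq)
  then have "v = 0" by (rule eq_if_inner_simple)
  then show False using v by simp
qed

section \<open>The action of reflections and divided differences along simple roots\<close>

abbreviation "act \<equiv> weyl_act_q al"

lemma act_pvar_Inl: "act w (pvar (Inl i)) = L (w (\<omega> i))"
  by (simp add: weyl_act_q_def L_def)

lemma act_pvar_Inr: "act w (pvar (Inr i)) = pvar (Inr i)"
  by (simp add: weyl_act_q_def)

lemma act_add: "act w (f + g) = act w f + act w g"
  by (simp add: weyl_act_q_def psubst_simps)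

lemma act_mult: "act w (f * g) = act w f * act w g"
  by (simp add: weyl_act_q_def psubst_simps)

lemma act_diff: "act w (f - g) = act w f - act w g"
  by (simp add: weyl_act_q_def psubst_simps)

lemma act_pconst: "act w (pconst c) = pconst c"
  by (simp add: weyl_act_q_def)

lemma act_sum: "act w (sum f A) = (\<Sum>x\<in>A. act w (f x))"
  by (simp add: weyl_act_q_def psubst_simps)

lemma act_L:
  assumes "linear w"
  shows "act w (L v) = L (w v)"
proof -
  have "act w (L v) = (\<Sum>j\<in>UNIV. pconst (v \<bullet> coroot (al j)) * L (w (\<omega> j)))"
    by (simp add: L_eq[of v] act_sum act_mult act_pconst act_pvar_Inl)
  also have "\<dots> = L (\<Sum>j\<in>UNIV. (v \<bullet> coroot (al j)) *\<^sub>R w (\<omega> j))" by (simp add: L_sum L_scale)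
  also have "(\<Sum>j\<in>UNIV. (v \<bullet> coroot (al j)) *\<^sub>R w (\<omega> j)) = w (\<Sum>j\<in>UNIV. (v \<bullet> coroot (al j)) *\<^sub>R \<omega> j)"
    by (simp add: linear_sum[OF assms] linear_scale[OF assms])
  also have "\<dots> = w v" by (simp flip: weight_expansion)
  finally show ?thesis .
qed

lemma act_reflection_L: "act (reflection \<alpha>) (L v) = L (reflection \<alpha> v)"
  by (rule act_L[OF linear_reflection])

lemma act_simple_involution: "act (s i) (act (s i) f) = f"
proof (induction f rule: mpoly_induct)
  case (var v f)
  have "act (s i) (act (s i) (pvar v)) = pvar v"
    by (cases v) (simp_all add: act_pvar_Inl act_pvar_Inr act_reflection_L reflection_reflection
        L_fund_weight)
  then show ?case using var by (simp add: act_mult)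
qed (simp_all add: act_pconst act_add)

lemma mult_L_simple_cancel: "f * L (al i) = g * L (al i) \<Longrightarrow> f = g"
  by (rule mpoly_mult_cancel[OF _ L_nonzero[of "al i"]]) simp_all

abbreviation "dd i \<equiv> divided_diff al (al i)"

text \<open>For a variable the difference is a constant multiple of the root, and divisibility
  passes to products by a twisted Leibniz rule.\<close>

lemma dd_exists: "\<exists>g. g * L (al i) = f - act (s i) f"
proof (induction f rule: mpoly_induct)
  case (const c)
  show ?case by (rule exI[of _ 0]) (simp add: act_pconst)
next
  case (add f f')
  then obtain g g' where "g * L (al i) = f - act (s i) f" "g' * L (al i) = f' - act (s i) f'" by blast
  then have "(g + g') * L (al i) = (f + f') - act (s i) (f + f')"
    by (simp add: act_add algebra_simps)
  then show ?case by blast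
next
  case (var v f)
  then obtain g where g: "g * L (al i) = f - act (s i) f" by blast
  obtain c where c: "pvar v - act (s i) (pvar v) = pconst c * L (al i)"
  proof (cases v)
    case (Inl j)
    have "pvar v - act (s i) (pvar v) = pconst (\<omega> j \<bullet> coroot (al i)) * L (al i)"
      by (simp add: Inl act_pvar_Inl reflection_def L_diff L_scale L_fund_weight)
    then show thesis using that by blast
  next
    case (Inr j)
    have "pvar v - act (s i) (pvar v) = pconst 0 * L (al i)"
      by (simp add: Inr act_pvar_Inr)
    then show thesis using that by blast
  qed
  have "(pvar v * g + pconst c * act (s i) f) * L (al i)
      = pvar v * (g * L (al i)) + (pconst c * L (al i)) * act (s i) f" by (simp add: algebra_simps)
  also have "\<dots> = pvar v * f - act (s i) (pvar v * f)"
    unfolding g c[symmetric] by (simp add: act_mult algebra_simps)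
  finally show ?case by blast
qed

lemma dd_spec: "dd i f * L (al i) = f - act (s i) f"
proof -
  obtain g where g: "g * L (al i) = f - act (s i) f" using dd_exists by blast
  have "dd i f = (THE g. g * L (al i) = f - act (s i) f)"
    by (simp only: divided_diff_def L_def)
  also have "\<dots> = g"
  proof (rule the_equality)
    fix h assume "h * L (al i) = f - act (s i) f"
    then have "h * L (al i) = g * L (al i)" using g by simp
    then show "h = g" by (rule mult_L_simple_cancel)
  qed (rule g)
  finally show ?thesis using g by simp
qed

lemma dd_unique: "g * L (al i) = f - act (s i) f \<Longrightarrow> dd i f = g"
  using dd_spec mult_L_simple_cancel by metis

lemma dd_add: "dd i (f + g) = dd i f + dd i g"
  by (rule dd_unique) (simp add: distrib_right dd_spec act_add)

lemma dd_invariant_mult: "act (s i) u = u \<Longrightarrow> dd i (u * f) = u * dd i f"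
  by (rule dd_unique) (simp add: mult.assoc dd_spec act_mult right_diff_distrib)

lemma dd_pconst_mult: "dd i (pconst c * f) = pconst c * dd i f"
  by (rule dd_invariant_mult) (rule act_pconst)

lemma dd_0 [simp]: "dd i 0 = 0"
  using dd_pconst_mult[of i 0 0] by simp

lemma dd_pconst [simp]: "dd i (pconst c) = 0"
  by (rule dd_unique) (simp add: act_pconst)

lemma dd_L_mult: "dd i (L v * f) = L (s i v) * dd i f + pconst (v \<bullet> coroot (al i)) * f"
proof (rule dd_unique)
  have "(L (s i v) * dd i f + pconst (v \<bullet> coroot (al i)) * f) * L (al i)
      = L (s i v) * (dd i f * L (al i)) + (pconst (v \<bullet> coroot (al i)) * L (al i)) * f"
    by (simp add: algebra_simps)
  also have "pconst (v \<bullet> coroot (al i)) * L (al i) = L v - L (s i v)"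
    by (simp add: reflection_def L_diff L_scale)
  also have "L (s i v) * (dd i f * L (al i)) = L (s i v) * (f - act (s i) f)" by (simp only: dd_spec)
  finally show "(L (s i v) * dd i f + pconst (v \<bullet> coroot (al i)) * f) * L (al i)
      = L v * f - act (s i) (L v * f)"
    by (simp add: act_mult act_reflection_L algebra_simps)
qed

text \<open>Numerator and denominator of the divided difference both change sign under the
  reflection, so the quotient is invariant and is killed by a second application.\<close>

lemma dd_dd [simp]: "dd i (dd i f) = 0"
proof (rule dd_unique)
  have "act (s i) (dd i f * L (al i)) = act (s i) (f - act (s i) f)" by (simp add: dd_spec)
  then have "act (s i) (dd i f) * - L (al i) = act (s i) f - f"
    by (simp add: act_mult act_reflection_L reflection_self L_uminus act_diff act_simple_involution)
  then have "act (s i) (dd i f) * L (al i) = dd i f * L (al i)"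
    using dd_spec[of i f] by (simp add: minus_equation_iff)
  then have "act (s i) (dd i f) = dd i f" by (rule mult_L_simple_cancel)
  then show "0 * L (al i) = dd i f - act (s i) (dd i f)" by simp
qed

subsection \<open>Compositions along words\<close>

definition ddw :: "'l list \<Rightarrow> ('l + 'l) mpoly \<Rightarrow> ('l + 'l) mpoly" where
  "ddw = foldr dd"

lemma ddw_Nil [simp]: "ddw [] f = f"
  by (simp add: ddw_def)

lemma ddw_Cons [simp]: "ddw (i # ws) f = dd i (ddw ws f)"
  by (simp add: ddw_def)

lemma ddw_append: "ddw (xs @ ys) f = ddw xs (ddw ys f)"
  by (induction xs) auto

lemma ddw_add: "ddw ws (f + g) = ddw ws f + ddw ws g"
  by (induction ws) (auto simp: dd_add)

lemma ddw_invariant_mult: "(\<And>i. act (s i) u = u) \<Longrightarrow> ddw ws (u * f) = u * ddw ws f"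
  by (induction ws) (auto simp: dd_invariant_mult)

lemma ddw_0 [simp]: "ddw ws 0 = 0"
  by (induction ws) auto

lemma ddw_pconst: "ws \<noteq> [] \<Longrightarrow> ddw ws (pconst c) = 0"
  by (cases ws rule: rev_cases) (auto simp: ddw_append)

definition del_nth :: "nat \<Rightarrow> 'l list \<Rightarrow> 'l list" where
  "del_nth k ws = take k ws @ drop (Suc k) ws"

lemma length_del_nth: "k < length ws \<Longrightarrow> length (del_nth k ws) + 1 = length ws"
  by (auto simp: del_nth_def)

lemma dd_sum: "dd i (sum f A) = (\<Sum>x\<in>A. dd i (f x))"
  by (induction A rule: infinite_finite_induct) (auto simp: dd_add)

text \<open>Iterated Leibniz rule: the linear form either passes a letter and is reflected, or is
  consumed there and the letter disappears. By isometry the resulting pairing can be written with v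
  itself and the root of that letter.\<close>

lemma ddw_L_mult:
  "ddw ws (L v * f) = L (sw ws v) * ddw ws f
    + (\<Sum>k<length ws. pconst (v \<bullet> coroot (word_roots ws ! k)) * ddw (del_nth k ws) f)"
proof (induction ws)
  case (Cons i ws)
  have e: "sw ws v \<bullet> coroot (al i) = v \<bullet> coroot (sw (rev ws) (al i))"
    using sw_inner[of "rev ws" "sw ws v" "coroot (al i)"] by (simp add: sw_coroot)
  have "ddw (i # ws) (L v * f) = L (s i (sw ws v)) * dd i (ddw ws f)
      + pconst (sw ws v \<bullet> coroot (al i)) * ddw ws f
      + (\<Sum>k<length ws. pconst (v \<bullet> coroot (word_roots ws ! k)) * dd i (ddw (del_nth k ws) f))"
    by (simp add: Cons.IH dd_add dd_L_mult dd_sum dd_pconst_mult)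
  then show ?case
    by (simp add: sum.lessThan_Suc_shift e del_nth_def del: sum.lessThan_Suc)
qed simp

lemma sw_del_nth:
  "k < length ws \<Longrightarrow> sw (del_nth k ws) = sw ws \<circ> reflection (word_roots ws ! k)"
proof (induction ws arbitrary: k)
  case (Cons i ws)
  show ?case
  proof (cases k)
    case 0
    define \<gamma> where "\<gamma> = sw (rev ws) (al i)"
    have e: "sw ws \<gamma> = al i" by (simp add: \<gamma>_def)
    have "s i (sw ws v) = sw ws (reflection \<gamma> v)" for v
      using sw_reflection[of ws \<gamma> v] e by simp
    then have "s i (sw ws (reflection \<gamma> v)) = sw ws v" for v
      using reflection_reflection[of "al i" "sw ws v"] by simp
    then show ?thesis by (intro ext) (simp add: 0 del_nth_def \<gamma>_def)
  next
    case (Suc k')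
    have "sw (del_nth k (i # ws)) = s i \<circ> sw (del_nth k' ws)" by (simp add: Suc del_nth_def)
    then show ?thesis using Cons.IH[of k'] Cons.prems Suc by (simp add: comp_assoc)
  qed
qed simp

abbreviation "DW \<equiv> divided_diff_word al"

lemma DW_eq: "DW w = ddw (SOME ws. reduced_word al w ws)"
  by (simp add: divided_diff_word_def ddw_def)

lemma sum_word_roots:
  assumes "reduced ws"
  shows "(\<Sum>k<length ws. g (word_roots ws ! k)) = (\<Sum>\<gamma>\<in>inversions (sw ws). g \<gamma>)"
proof -
  have d: "distinct (word_roots ws)" "set (word_roots ws) = inversions (sw ws)"
    using reduced_word_roots[OF assms] by auto
  have "(\<Sum>\<gamma>\<in>set (word_roots ws). g \<gamma>) = sum_list (map g (word_roots ws))"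
    by (rule sum_list_distinct_conv_sum_set[OF d(1), symmetric])
  also have "\<dots> = (\<Sum>k<length ws. g (word_roots ws ! k))"
    by (simp add: sum_list_sum_nth atLeast0LessThan)
  finally show ?thesis by (simp add: d)
qed

text \<open>If the letter i shortens the element, the element has a reduced word beginning with i. A
  non-reduced word thereby turns into one with a repeated letter, which \<open>dd_dd\<close>
  kills.\<close>

lemma reduced_Cons_cases:
  assumes "reduced ws" "\<not> reduced (i # ws)"
  shows "\<exists>vs. reduced (i # vs) \<and> sw (i # vs) = sw ws \<and> length (i # vs) = length ws"
proof -
  have e: "sw (rev ws) \<circ> s i = sw (rev (i # ws))" by (simp add: sw_append)
  have "sw (rev ws) (al i) \<notin> P"
  proof
    assume "sw (rev ws) (al i) \<in> P"
    then have "wl (sw (rev ws)) < wl (sw (rev (i # ws)))"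
      unfolding e[symmetric] by (intro wl_reflection_greater simple_pos)
    then have "wl (sw ws) < wl (sw (i # ws))" by (simp only: wl_rev)
    then show False using assms wl_le[of "i # ws"] by simp
  qed
  then have "wl (sw (rev (i # ws))) < wl (sw (rev ws))"
    unfolding e[symmetric] by (intro wl_reflection_less simple_pos)
  then have less: "wl (sw (i # ws)) < wl (sw ws)" by (simp only: wl_rev)
  obtain vs where vs: "sw vs = sw (i # ws)" "length vs = wl (sw (i # ws))" using reduced_exists' by metis
  have sv: "sw (i # vs) = sw ws"
    unfolding sw_Cons vs(1) by (intro ext) (simp add: reflection_reflection)
  have "length (i # vs) \<le> length ws" using less vs assms(1) by simp
  moreover have "length ws \<le> length (i # vs)" using wl_le[of "i # vs"] assms(1) unfolding sv by simp
  ultimately have len: "length (i # vs) = length ws" by linarith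
  then have "reduced (i # vs)" unfolding sv using assms(1) by simp
  then show ?thesis using sv len by blast
qed

lemma some_reduced:
  "sw (SOME vs. reduced_word al (sw ws) vs) = sw ws" "reduced (SOME vs. reduced_word al (sw ws) vs)"
proof -
  have "reduced_word al (sw ws) (SOME vs. reduced_word al (sw ws) vs)"
    using reduced_exists by (rule someI_ex)
  then have *: "sw (SOME vs. reduced_word al (sw ws) vs) = sw ws
      \<and> length (SOME vs. reduced_word al (sw ws) vs) = wl (sw ws)"
    by (simp only: reduced_word_def)
  then show "sw (SOME vs. reduced_word al (sw ws) vs) = sw ws" by (rule conjunct1)
  show "reduced (SOME vs. reduced_word al (sw ws) vs)"
    unfolding conjunct1[OF *] by (rule conjunct2[OF *, symmetric])
qed

text \<open>That \<open>\<Delta>\<^sub>w\<close> is well defined needs no braid relations: by induction and the Leibniz rule, the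
  difference \<open>E\<close> of two candidates satisfies \<open>E (\<lambda> f) = w \<lambda> \<cdot> E f\<close>, and \<open>E 1 = 0\<close>.\<close>

lemma ddw_well_defined:
  "(reduced ws \<longrightarrow> (\<forall>ws'. reduced ws' \<and> sw ws' = sw ws \<longrightarrow> ddw ws' = ddw ws)) \<and>
   (\<not> reduced ws \<longrightarrow> (\<forall>f. ddw ws f = 0))"
proof (induction "length ws" arbitrary: ws rule: less_induct)
  case less
  note IH = less.hyps
  have nonred: "ddw ws f = 0" if nr: "\<not> reduced ws" for f
  proof -
    have "ws \<noteq> []" using nr wl_le[of "[]"] by auto
    then obtain i us where ws: "ws = i # us" by (cases ws) auto
    show ?thesis
    proof (cases "reduced us")
      case False
      then show ?thesis using IH[of us] by (simp add: ws)
    next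
      case True
      \<comment> \<open>By induction \<open>us\<close> may be replaced by the word that begins with
        i, so that the operator for i occurs twice in succession.\<close>
      then obtain vs where vs: "reduced (i # vs)" "sw (i # vs) = sw us"
        using reduced_Cons_cases nr ws by blast
      have "length us < length ws" by (simp add: ws)
      from IH[OF this] have "ddw (i # vs) = ddw us" using True vs by blast
      then have "ddw us f = dd i (ddw vs f)" by (simp flip: ddw_Cons)
      then show ?thesis by (simp add: ws)
    qed
  qed
  have uniq: "ddw ws' = ddw ws" if r: "reduced ws" and r': "reduced ws'" "sw ws' = sw ws" for ws'
  proof (cases "ws = []")
    case True
    then show ?thesis using r r' by auto
  next
    case False
    define w where "w = sw ws"
    have len: "length ws' = length ws" using r r' by simp
    \<comment> \<open>The operator left after deleting a letter, expressed through w and the root of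
      the letter alone. In this form the Leibniz sum is the same for both words.\<close>
    define Y where "Y \<gamma> f = (if wl (w \<circ> reflection \<gamma>) + 1 = length ws then DW (w \<circ> reflection \<gamma>) f else 0)"
      for \<gamma> f
    have Y: "ddw (del_nth k us) f = Y (word_roots us ! k) f"
      if us: "sw us = w" "length us = length ws" and k: "k < length us" for us k f
    proof -
      let ?ds = "del_nth k us"
      have l: "length ?ds < length ws" "length ?ds + 1 = length ws" using length_del_nth[OF k] us by auto
      have sd: "sw ?ds = w \<circ> reflection (word_roots us ! k)" using sw_del_nth[OF k] us by simp
      show ?thesis
      proof (cases "reduced ?ds")
        case True
        have "ddw (SOME ws. reduced_word al (sw ?ds) ws) = ddw ?ds"
          using IH[OF l(1)] True some_reduced[of ?ds] by blast
        then have "DW (sw ?ds) = ddw ?ds" by (simp only: DW_eq)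
        then show ?thesis using True l by (simp add: Y_def flip: sd)
      next
        case False
        then have "ddw ?ds f = 0" using IH[OF l(1)] by blast
        then show ?thesis using False l by (simp add: Y_def flip: sd)
      qed
    qed
    have leib: "ddw us (L v * f) = L (w v) * ddw us f
        + (\<Sum>\<gamma>\<in>inversions w. pconst (v \<bullet> coroot \<gamma>) * Y \<gamma> f)"
      if us: "sw us = w" "length us = length ws" "reduced us" for us v f
    proof -
      have "(\<Sum>k<length us. pconst (v \<bullet> coroot (word_roots us ! k)) * ddw (del_nth k us) f)
          = (\<Sum>k<length us. pconst (v \<bullet> coroot (word_roots us ! k)) * Y (word_roots us ! k) f)"
        using Y us by (intro sum.cong) auto
      also have "\<dots> = (\<Sum>\<gamma>\<in>inversions w. pconst (v \<bullet> coroot \<gamma>) * Y \<gamma> f)"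
        using sum_word_roots[OF us(3)] us by simp
      finally show ?thesis using ddw_L_mult us by simp
    qed
    have "ddw ws' f - ddw ws f = 0" for f
    proof (induction f rule: mpoly_induct)
      case (const c)
      have "ws' \<noteq> []" using False len by auto
      then show ?case using False by (simp add: ddw_pconst)
    next
      case (add f g)
      then show ?case by (simp add: ddw_add)
    next
      case (var x f)
      show ?case
      proof (cases x)
        case (Inl j)
        show ?thesis
          unfolding Inl L_fund_weight[symmetric]
          using leib[of ws' "\<omega> j" f] leib[of ws "\<omega> j" f] var r r' len by (simp add: w_def)
      next
        case (Inr j)
        show ?thesis unfolding Inr using var by (simp add: ddw_invariant_mult act_pvar_Inr)
      qed
    qed
    then show ?thesis by (intro ext) simp
  qed
  show ?case using nonred uniq by blast
qed

lemma ddw_reduced: "reduced ws \<Longrightarrow> ddw ws = DW (sw ws)"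
proof -
  assume r: "reduced ws"
  have "ddw (SOME vs. reduced_word al (sw ws) vs) = ddw ws"
    using ddw_well_defined[of ws] r some_reduced[of ws] by blast
  then show ?thesis by (simp only: DW_eq)
qed

lemma ddw_eq: "ddw ws f = (if reduced ws then DW (sw ws) f else 0)"
  using ddw_reduced ddw_well_defined[of ws] by auto

text \<open>In a reduced word the deleted letters correspond to the inversions of w. A deletion that
  leaves a non-reduced word contributes zero, so only the elements of length one less
  survive.\<close>

lemma DW_L_mult:
  assumes "w = sw ws"
  shows "DW w (L v * f) = L (w v) * DW w f + (\<Sum>\<gamma>\<in>inversions w. pconst (v \<bullet> coroot \<gamma>)
    * (if wl (w \<circ> reflection \<gamma>) + 1 = wl w then DW (w \<circ> reflection \<gamma>) f else 0))"
proof -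
  obtain vs where vs: "sw vs = w" "reduced vs" "length vs = wl w" using reduced_exists' assms by metis
  have k: "ddw (del_nth k vs) f = (if wl (w \<circ> reflection (word_roots vs ! k)) + 1 = wl w
      then DW (w \<circ> reflection (word_roots vs ! k)) f else 0)" if "k < length vs" for k
    using length_del_nth[OF that] sw_del_nth[OF that] vs ddw_eq[of "del_nth k vs" f] by auto
  have "DW w (L v * f) = L (w v) * DW w f
      + (\<Sum>k<length vs. pconst (v \<bullet> coroot (word_roots vs ! k)) * ddw (del_nth k vs) f)"
    using ddw_L_mult[of vs v f] ddw_reduced[OF vs(2)] vs by simp
  also have "(\<Sum>k<length vs. pconst (v \<bullet> coroot (word_roots vs ! k)) * ddw (del_nth k vs) f)
      = (\<Sum>k<length vs. pconst (v \<bullet> coroot (word_roots vs ! k))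
        * (if wl (w \<circ> reflection (word_roots vs ! k)) + 1 = wl w
           then DW (w \<circ> reflection (word_roots vs ! k)) f else 0))"
    by (intro sum.cong) (simp_all add: k)
  also have "\<dots> = (\<Sum>\<gamma>\<in>inversions w. pconst (v \<bullet> coroot \<gamma>)
    * (if wl (w \<circ> reflection \<gamma>) + 1 = wl w then DW (w \<circ> reflection \<gamma>) f else 0))"
    using sum_word_roots[OF vs(2)] vs by simp
  finally show ?thesis .
qed

text \<open>The nil-Coxeter relation: the concatenation of two reduced words is either reduced or
  acts as zero.\<close>

lemma DW_comp:
  assumes "u = sw us" "v = sw vs"
  shows "DW u (DW v f) = (if wl (u \<circ> v) = wl u + wl v then DW (u \<circ> v) f else 0)"
proof -
  obtain us' vs' where r: "sw us' = u" "reduced us'" "length us' = wl u" "sw vs' = v" "reduced vs'" "length vs' = wl v"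
    using reduced_exists' assms by metis
  have "DW u (DW v f) = ddw (us' @ vs') f"
    using ddw_reduced[OF r(2)] ddw_reduced[OF r(5)] r by (simp add: ddw_append)
  then show ?thesis using r by (simp add: ddw_eq sw_append)
qed

lemma DW_word: "w = sw ws \<Longrightarrow> \<exists>vs. DW w = ddw vs \<and> length vs = wl w"
  using reduced_exists' ddw_reduced by metis

end

section \<open>Partial derivatives and functions on phase space\<close>

text \<open>If v does not occur in m, the truncated subtraction leaves m unchanged, but the
  coefficient is then 0.\<close>

definition pdiff :: "'v \<Rightarrow> 'v mpoly \<Rightarrow> 'v mpoly" where
  "pdiff v = lin_ext (\<lambda>m. pconst (real (Poly_Mapping.lookup m v))
     * Poly_Mapping.single (m - Poly_Mapping.single v 1) 1)"

lemma pdiff_add: "pdiff v (f + g) = pdiff v f + pdiff v g"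
  by (simp add: pdiff_def lin_ext_add)

lemma pdiff_0 [simp]: "pdiff v 0 = 0"
  by (simp add: pdiff_def)

lemma pdiff_single:
  "pdiff v (Poly_Mapping.single m c)
    = Poly_Mapping.single (m - Poly_Mapping.single v 1) (c * real (Poly_Mapping.lookup m v))"
  by (simp add: pdiff_def pconst_def mult_single del: single_of_nat)

lemma pdiff_pconst [simp]: "pdiff v (pconst c) = 0"
  unfolding pconst_def by (simp add: pdiff_single)

lemma pdiff_sum: "pdiff v (sum f A) = (\<Sum>x\<in>A. pdiff v (f x))"
  by (induction A rule: infinite_finite_induct) (simp_all add: pdiff_add)

lemma lookup_pdiff:
  "Poly_Mapping.lookup (pdiff v f) m
    = real (Poly_Mapping.lookup m v + 1) * Poly_Mapping.lookup f (Poly_Mapping.single v 1 + m)"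
proof (induction f rule: mpoly_single_induct)
  case (single n c)
  let ?e = "Poly_Mapping.single v (1::nat)"
  show ?case
  proof (cases "n = ?e + m")
    case True
    then show ?thesis by (simp add: pdiff_single lookup_add)
  next
    case False
    have "n - ?e \<noteq> m" if "Poly_Mapping.lookup n v \<noteq> 0"
    proof
      assume "n - ?e = m"
      then have "n = ?e + m"
        using that by (intro poly_mapping_eqI)
          (auto simp: lookup_add lookup_minus lookup_single when_def)
      then show False using False by simp
    qed
    then show ?thesis using False by (auto simp: pdiff_single lookup_single when_def)
  qed
qed (simp_all add: pdiff_add lookup_add algebra_simps)

lemma lookup_pvar_mult:
  "Poly_Mapping.lookup (pvar v * f) m
    = (if Poly_Mapping.lookup m v = 0 then 0 else Poly_Mapping.lookup f (m - Poly_Mapping.single v 1))"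
proof (induction f rule: mpoly_single_induct)
  case (single n c)
  let ?e = "Poly_Mapping.single v (1::nat)"
  have "?e + n = m \<longleftrightarrow> Poly_Mapping.lookup m v \<noteq> 0 \<and> n = m - ?e"
  proof
    assume "Poly_Mapping.lookup m v \<noteq> 0 \<and> n = m - ?e"
    then show "?e + n = m"
      by (intro poly_mapping_eqI) (auto simp: lookup_add lookup_minus lookup_single when_def)
  qed (auto simp: lookup_add)
  then show ?case
    by (auto simp: lookup_single when_def simp del: One_nat_def simp flip: single_var_add)
qed (simp_all add: distrib_left lookup_add)

lemma pdiff_pvar_mult:
  fixes v w :: 'v
  shows "pdiff v (pvar w * f) = (if v = w then f else 0) + pvar w * pdiff v f"
proof (rule poly_mapping_eqI)
  fix m :: "'v \<Rightarrow>\<^sub>0 nat"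
  let ?e = "Poly_Mapping.single w (1::nat)" and ?d = "Poly_Mapping.single v (1::nat)"
  consider "v = w" "Poly_Mapping.lookup m w = 0" | "v = w" "Poly_Mapping.lookup m w > 0"
    | "v \<noteq> w" "Poly_Mapping.lookup m w = 0" | "v \<noteq> w" "Poly_Mapping.lookup m w > 0"
    using gr0I by blast
  then show "Poly_Mapping.lookup (pdiff v (pvar w * f)) m
      = Poly_Mapping.lookup ((if v = w then f else 0) + pvar w * pdiff v f) m"
  proof cases
    case 2
    have "?d + (m - ?d) = m"
      using 2 by (intro poly_mapping_eqI) (auto simp: lookup_add lookup_minus lookup_single when_def)
    then show ?thesis using 2
      by (simp add: lookup_pdiff lookup_pvar_mult lookup_add lookup_minus)
        (simp add: algebra_simps of_nat_diff)
  next
    case 4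
    have "?d + m - ?e = ?d + (m - ?e)"
      using 4 by (intro poly_mapping_eqI) (auto simp: lookup_add lookup_minus lookup_single when_def)
    then show ?thesis using 4
      by (simp add: lookup_pdiff lookup_pvar_mult lookup_add lookup_minus lookup_single when_def)
  qed (simp_all add: lookup_pdiff lookup_pvar_mult lookup_add lookup_single)
qed

lemma pdiff_pvar: "pdiff v (pvar w) = (if v = w then 1 else 0)"
  using pdiff_pvar_mult[of v w 1] pdiff_pconst[of v 1] by simp

lemma pdiff_pconst_mult: "pdiff v (pconst c * f) = pconst c * pdiff v f"
  by (simp add: pdiff_def lin_ext_pconst_mult)

lemma pdiff_mult: "pdiff v (f * g) = pdiff v f * g + f * pdiff v g"
proof (induction f rule: mpoly_induct)
  case (const c)
  show ?case by (simp add: pdiff_pconst_mult)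
next
  case (add f f')
  then show ?case by (simp add: pdiff_add algebra_simps)
next
  case (var w f)
  then show ?case by (simp add: mult.assoc pdiff_pvar_mult) (simp add: algebra_simps)
qed

subsection \<open>Polynomials as functions on phase space\<close>

lemma toda_fun_add: "toda_fun (f + g) p = toda_fun f p + toda_fun g p"
  by (simp add: toda_fun_def peval_add split: prod.split)

lemma toda_fun_mult: "toda_fun (f * g) p = toda_fun f p * toda_fun g p"
  by (simp add: toda_fun_def peval_mult split: prod.split)

lemma toda_fun_pconst [simp]: "toda_fun (pconst c) p = c"
  by (simp add: toda_fun_def split: prod.split)

lemma toda_fun_0 [simp]: "toda_fun 0 p = 0"
  using toda_fun_pconst[of 0 p] by simp

lemma toda_fun_1 [simp]: "toda_fun 1 p = 1"
  using toda_fun_pconst[of 1 p] by simp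

lemma toda_fun_Inl [simp]: "toda_fun (pvar (Inl i)) p = fst p $ i"
  by (simp add: toda_fun_def split: prod.split)

lemma toda_fun_Inr [simp]: "toda_fun (pvar (Inr i)) p = exp (2 * snd p $ i)"
  by (simp add: toda_fun_def split: prod.split)

lemma toda_fun_sum: "toda_fun (sum f A) p = (\<Sum>x\<in>A. toda_fun (f x) p)"
  by (induction A rule: infinite_finite_induct) (simp_all add: toda_fun_add)

text \<open>Chain rule: the variable \<open>Inr i\<close> stands for exp (2 s_i), whose derivative
  supplies the factor 2 exp (2 s_i).\<close>

definition toda_deriv :: "('l::finite + 'l) mpoly \<Rightarrow> 'l phase \<Rightarrow> 'l phase \<Rightarrow> real" where
  "toda_deriv f p h = (\<Sum>i\<in>UNIV. fst h $ i * toda_fun (pdiff (Inl i) f) p)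
     + (\<Sum>i\<in>UNIV. 2 * exp (2 * snd p $ i) * (snd h $ i) * toda_fun (pdiff (Inr i) f) p)"

lemma toda_fun_has_derivative: "(toda_fun f has_derivative toda_deriv f p) (at p)"
proof (induction f rule: mpoly_induct)
  case (const c)
  have "toda_fun (pconst c) = (\<lambda>_. c)" "toda_deriv (pconst c) p = (\<lambda>_. 0)"
    by (auto simp: toda_deriv_def)
  then show ?case by simp
next
  case (add f g)
  have "toda_fun (f + g) = (\<lambda>p. toda_fun f p + toda_fun g p)"
    "toda_deriv (f + g) p = (\<lambda>h. toda_deriv f p h + toda_deriv g p h)"
    by (auto simp: toda_deriv_def toda_fun_add pdiff_add algebra_simps sum.distrib)
  then show ?case using add by (simp add: has_derivative_add)
next
  case (var v f)
  define d :: "'a phase \<Rightarrow> real" where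
    "d h = (case v of Inl j \<Rightarrow> fst h $ j | Inr j \<Rightarrow> 2 * exp (2 * snd p $ j) * (snd h $ j))" for h
  have v: "(toda_fun (pvar v) has_derivative d) (at p)"
  proof (cases v)
    case (Inl j)
    have "toda_fun (pvar v) = (\<lambda>p. fst p $ j)" "d = (\<lambda>h. fst h $ j)" by (auto simp: Inl d_def)
    then show ?thesis
      using bounded_linear_imp_has_derivative[OF
          bounded_linear_compose[OF bounded_linear_vec_nth bounded_linear_fst]] by simp
  next
    case (Inr j)
    have [derivative_intros]: "((\<lambda>p::'a phase. snd p $ j) has_derivative (\<lambda>h. snd h $ j)) (at p)"
      by (rule bounded_linear_imp_has_derivative[OF
          bounded_linear_compose[OF bounded_linear_vec_nth bounded_linear_snd]])
    have "toda_fun (pvar v) = (\<lambda>p. exp (2 * snd p $ j))"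
      "d = (\<lambda>h. 2 * exp (2 * snd p $ j) * (snd h $ j))" by (auto simp: Inr d_def)
    then show ?thesis by (auto intro!: derivative_eq_intros)
  qed
  have "toda_fun (pvar v * f) = (\<lambda>p. toda_fun (pvar v) p * toda_fun f p)"
    by (rule ext) (rule toda_fun_mult)
  moreover have "toda_deriv (pvar v * f) p
      = (\<lambda>h. toda_fun (pvar v) p * toda_deriv f p h + d h * toda_fun f p)"
  proof
    fix h :: "'a phase"
    have 1: "(\<Sum>i\<in>UNIV. fst h $ i * toda_fun (pdiff (Inl i) (pvar v * f)) p)
      = toda_fun (pvar v) p * (\<Sum>i\<in>UNIV. fst h $ i * toda_fun (pdiff (Inl i) f) p)
        + (case v of Inl j \<Rightarrow> fst h $ j * toda_fun f p | Inr j \<Rightarrow> 0)"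
    proof -
      have "fst h $ i * toda_fun (pdiff (Inl i) (pvar v * f)) p
        = toda_fun (pvar v) p * (fst h $ i * toda_fun (pdiff (Inl i) f) p)
          + (if v = Inl i then fst h $ i * toda_fun f p else 0)" for i
        by (auto simp: pdiff_pvar_mult toda_fun_add toda_fun_mult distrib_left)
      then show ?thesis by (simp only:) (cases v, simp_all add: sum.distrib sum_distrib_left)
    qed
    have 2: "(\<Sum>i\<in>UNIV. 2 * exp (2 * snd p $ i) * (snd h $ i) * toda_fun (pdiff (Inr i) (pvar v * f)) p)
      = toda_fun (pvar v) p * (\<Sum>i\<in>UNIV. 2 * exp (2 * snd p $ i) * (snd h $ i) * toda_fun (pdiff (Inr i) f) p)
        + (case v of Inr j \<Rightarrow> 2 * exp (2 * snd p $ j) * (snd h $ j) * toda_fun f p | Inl j \<Rightarrow> 0)"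
    proof -
      have "2 * exp (2 * snd p $ i) * (snd h $ i) * toda_fun (pdiff (Inr i) (pvar v * f)) p
        = toda_fun (pvar v) p * (2 * exp (2 * snd p $ i) * (snd h $ i) * toda_fun (pdiff (Inr i) f) p)
          + (if v = Inr i then 2 * exp (2 * snd p $ i) * (snd h $ i) * toda_fun f p else 0)" for i
        by (auto simp: pdiff_pvar_mult toda_fun_add toda_fun_mult distrib_left)
      then show ?thesis by (simp only:) (cases v, simp_all add: sum.distrib sum_distrib_left)
    qed
    show "toda_deriv (pvar v * f) p h = toda_fun (pvar v) p * toda_deriv f p h + d h * toda_fun f p"
      unfolding toda_deriv_def 1 2 by (cases v) (simp_all add: d_def algebra_simps)
  qed
  ultimately show ?case using has_derivative_mult[OF v var] by simp
qed

lemma frechet_derivative_toda_fun: "frechet_derivative (toda_fun f) (at p) = toda_deriv f p"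
  by (rule frechet_derivative_at[OF toda_fun_has_derivative, symmetric])

lemma toda_deriv_r: "toda_deriv f p (axis i 1, 0) = toda_fun (pdiff (Inl i) f) p"
  by (simp add: toda_deriv_def axis_def if_distrib if_distribR sum.delta cong: if_cong)

lemma toda_deriv_s:
  "toda_deriv f p (0, axis i 1) = 2 * exp (2 * snd p $ i) * toda_fun (pdiff (Inr i) f) p"
  by (simp add: toda_deriv_def axis_def if_distrib if_distribR sum.delta cong: if_cong)

text \<open>If the function vanishes, so do its directional derivatives, and since exp has no zeros
  all partial derivatives of the polynomial represent the zero function as well. They have smaller
  degree, and a polynomial without partial derivatives is constant.\<close>

lemma toda_fun_eq_0:
  fixes f :: "('l::finite + 'l) mpoly"
  assumes "\<And>p. toda_fun f p = 0"
  shows "f = 0"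
proof -
  define deg where "deg m = (\<Sum>v\<in>UNIV. Poly_Mapping.lookup m v)" for m :: "('l + 'l) \<Rightarrow>\<^sub>0 nat"
  have deg: "deg (Poly_Mapping.single v 1 + m) = Suc (deg m)" for v m
    by (simp add: deg_def lookup_add lookup_single when_def sum.distrib)
  have "f = 0" if "\<forall>m\<in>Poly_Mapping.keys f. deg m < n" "\<And>p. toda_fun f p = 0" for n f
    using that
  proof (induction n arbitrary: f)
    case 0
    then show ?case by simp
  next
    case (Suc n)
    have d0: "toda_deriv f p h = 0" for p h
    proof -
      have "toda_fun f = (\<lambda>_. 0)" using Suc.prems by auto
      then have "frechet_derivative (toda_fun f) (at p) = (\<lambda>_. 0)" by simp
      then show ?thesis by (simp add: frechet_derivative_toda_fun)
    qed
    have "pdiff v f = 0" for v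
    proof (rule Suc.IH)
      show "\<forall>m\<in>Poly_Mapping.keys (pdiff v f). deg m < n"
      proof
        fix m assume "m \<in> Poly_Mapping.keys (pdiff v f)"
        then have "Poly_Mapping.single v 1 + m \<in> Poly_Mapping.keys f"
          by (simp add: in_keys_iff lookup_pdiff)
        then have "deg (Poly_Mapping.single v 1 + m) < Suc n" using Suc.prems(1) by blast
        then show "deg m < n" by (simp only: deg Suc_less_eq)
      qed
      show "toda_fun (pdiff v f) p = 0" for p
        using d0[of p "(axis (projl v) 1, 0)"] d0[of p "(0, axis (projr v) 1)"]
        by (cases v) (auto simp: toda_deriv_r toda_deriv_s)
    qed
    then have "Poly_Mapping.lookup f (Poly_Mapping.single v 1 + m) = 0" for v m
      using lookup_pdiff[of v f m] by simp
    then have z: "Poly_Mapping.lookup f m = 0" if "m \<noteq> 0" for m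
      using that by (induction m rule: monomial_induct) auto
    have "f = pconst (Poly_Mapping.lookup f 0)"
      by (rule poly_mapping_eqI) (auto simp: pconst_def lookup_single when_def z)
    moreover from this have "Poly_Mapping.lookup f 0 = 0"
      using Suc.prems(2) toda_fun_pconst by metis
    ultimately show ?case by simp
  qed
  moreover have "\<forall>m\<in>Poly_Mapping.keys f. deg m < Suc (\<Sum>m\<in>Poly_Mapping.keys f. deg m)"
    by (auto simp: less_Suc_eq_le intro!: member_le_sum)
  ultimately show ?thesis using assms by blast
qed

lemma toda_fun_eq:
  fixes f g :: "('l::finite + 'l) mpoly"
  assumes "toda_fun f = toda_fun g"
  shows "f = g"
proof -
  have "f + pconst (-1) * g = 0"
    by (rule toda_fun_eq_0) (simp add: toda_fun_add toda_fun_mult assms)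
  then show ?thesis by (simp add: pconst_uminus)
qed

section \<open>The operators \<open>\<Lambda>\<^sub>j\<close>\<close>

lemma mpoly_eq_uminus_self:
  fixes x :: "'v mpoly"
  assumes "x = - x"
  shows "x = 0"
proof (rule poly_mapping_eqI)
  fix m
  have "Poly_Mapping.lookup x m = - Poly_Mapping.lookup x m"
    using assms lookup_uminus by metis
  then show "Poly_Mapping.lookup x m = Poly_Mapping.lookup 0 m" by simp
qed

context root_base
begin

lemma DW_add: "\<beta> \<in> P \<Longrightarrow> DW (reflection \<beta>) (f + g) = DW (reflection \<beta>) f + DW (reflection \<beta>) g"
  using reflection_word DW_word ddw_add by metis

lemma DW_invariant_mult:
  "\<beta> \<in> P \<Longrightarrow> (\<And>i. act (s i) u = u) \<Longrightarrow> DW (reflection \<beta>) (u * f) = u * DW (reflection \<beta>) f"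
  using reflection_word DW_word ddw_invariant_mult by metis

lemma DW_sum: "\<beta> \<in> P \<Longrightarrow> DW (reflection \<beta>) (sum f A) = (\<Sum>x\<in>A. DW (reflection \<beta>) (f x))"
proof (induction A rule: infinite_finite_induct)
  case (infinite A)
  then show ?case using DW_invariant_mult[of \<beta> 0 0] act_pconst[of _ 0] by simp
next
  case empty
  then show ?case using DW_invariant_mult[of \<beta> 0 0] act_pconst[of _ 0] by simp
qed (simp_all add: DW_add)

text \<open>The monomial q^d for a vector d with nonnegative integral coordinates in the simple
  coroots. Depending on d alone, it makes the monomials of matched pairs visibly equal.\<close>

definition qm :: "'a \<Rightarrow> ('l + 'l) mpoly" where
  "qm d = (\<Prod>i\<in>UNIV. pvar (Inr i) ^ nat \<lfloor>\<omega> i \<bullet> d\<rfloor>)"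

lemma q_monom_eq_qm: "\<beta> \<in> P \<Longrightarrow> q_monom al \<beta> = qm (coroot \<beta>)"
  unfolding q_monom_def qm_def by (intro prod.cong) (simp_all flip: coroot_coeff)

lemma q_monom_mult:
  assumes "x \<in> P" "y \<in> P"
  shows "q_monom al x * q_monom al y = qm (coroot x + coroot y)"
proof -
  have "nat \<lfloor>\<omega> i \<bullet> (coroot x + coroot y)\<rfloor> = coroot_coeff al x i + coroot_coeff al y i" for i
  proof -
    have "\<omega> i \<bullet> (coroot x + coroot y) = real (coroot_coeff al x i + coroot_coeff al y i)"
      by (simp add: inner_add_right coroot_coeff assms)
    then show ?thesis by (simp only: floor_of_nat nat_int)
  qed
  then show ?thesis by (simp add: qm_def q_monom_def power_add prod.distrib)
qed

lemma act_q_monom: "act w (q_monom al \<beta>) = q_monom al \<beta>"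
  by (simp add: q_monom_def weyl_act_q_def psubst_simps)

definition wt :: "'l \<Rightarrow> 'a \<Rightarrow> ('l + 'l) mpoly" where
  "wt i \<beta> = pconst (\<omega> i \<bullet> coroot \<beta>)"

definition N :: "'l \<Rightarrow> ('l + 'l) mpoly \<Rightarrow> ('l + 'l) mpoly" where
  "N j f = (\<Sum>\<beta>\<in>QR. wt j \<beta> * q_monom al \<beta> * DW (reflection \<beta>) f)"

abbreviation "\<Lambda> \<equiv> Lambda_op \<Phi> al"

lemma Lambda_eq: "\<Lambda> j f = pvar (Inl j) * f + N j f"
  by (simp add: Lambda_op_def N_def wt_def)

lemma N_add: "N j (f + g) = N j f + N j g"
  unfolding N_def by (simp add: DW_add QR_pos distrib_left sum.distrib)

lemma N_invariant_mult: "(\<And>i. act (s i) u = u) \<Longrightarrow> N j (u * f) = u * N j f"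
  unfolding N_def sum_distrib_left by (intro sum.cong refl) (simp add: DW_invariant_mult QR_pos)

lemma Lambda_add: "\<Lambda> j (f + g) = \<Lambda> j f + \<Lambda> j g"
  by (simp add: Lambda_eq N_add distrib_left)

lemma Lambda_invariant_mult: "(\<And>i. act (s i) u = u) \<Longrightarrow> \<Lambda> j (u * f) = u * \<Lambda> j f"
  by (simp add: Lambda_eq N_invariant_mult distrib_left mult.left_commute)

lemma Lambda_pconst_mult: "\<Lambda> j (pconst c * f) = pconst c * \<Lambda> j f"
  by (rule Lambda_invariant_mult) (rule act_pconst)

lemma Lambda_q_mult: "\<Lambda> j (pvar (Inr i) * f) = pvar (Inr i) * \<Lambda> j f"
  by (rule Lambda_invariant_mult) (rule act_pvar_Inr)

lemma Lambda_0 [simp]: "\<Lambda> j 0 = 0"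
  using Lambda_pconst_mult[of j 0 0] by simp

lemma Lambda_uminus: "\<Lambda> j (- f) = - \<Lambda> j f"
  using Lambda_pconst_mult[of j "-1" f] by (simp add: pconst_uminus)

lemma Lambda_diff: "\<Lambda> j (f - g) = \<Lambda> j f - \<Lambda> j g"
  using Lambda_add[of j f "- g"] by (simp add: Lambda_uminus)

lemma Lambda_sum: "\<Lambda> j (sum f A) = (\<Sum>x\<in>A. \<Lambda> j (f x))"
  by (induction A rule: infinite_finite_induct) (simp_all add: Lambda_add)

definition cover_term :: "'a \<Rightarrow> 'a \<Rightarrow> ('l + 'l) mpoly \<Rightarrow> ('l + 'l) mpoly" where
  "cover_term \<beta> \<gamma> f = (if wl (reflection \<beta> \<circ> reflection \<gamma>) + 1 = wl (reflection \<beta>)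
     then DW (reflection \<beta> \<circ> reflection \<gamma>) f else 0)"

text \<open>Of the two correction sums, the first is symmetric in i and j and drops out of the
  commutator; the second produces the terms indexed by \<open>chevalley_pairs\<close>.\<close>

lemma N_mult_var:
  "N i (pvar (Inl j) * f) = pvar (Inl j) * N i f
    - (\<Sum>\<beta>\<in>QR. wt i \<beta> * wt j \<beta> * (q_monom al \<beta> * L \<beta> * DW (reflection \<beta>) f))
    + (\<Sum>\<beta>\<in>QR. \<Sum>\<gamma>\<in>inversions (reflection \<beta>). wt i \<beta> * wt j \<gamma> * (q_monom al \<beta> * cover_term \<beta> \<gamma> f))"
proof -
  have "wt i \<beta> * q_monom al \<beta> * DW (reflection \<beta>) (pvar (Inl j) * f)
      = pvar (Inl j) * (wt i \<beta> * q_monom al \<beta> * DW (reflection \<beta>) f)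
        - wt i \<beta> * wt j \<beta> * (q_monom al \<beta> * L \<beta> * DW (reflection \<beta>) f)
        + (\<Sum>\<gamma>\<in>inversions (reflection \<beta>). wt i \<beta> * wt j \<gamma> * (q_monom al \<beta> * cover_term \<beta> \<gamma> f))"
    if b: "\<beta> \<in> QR" for \<beta>
  proof -
    obtain ws where ws: "reflection \<beta> = sw ws" using reflection_word QR_pos b by blast
    have r: "L (reflection \<beta> (\<omega> j)) = pvar (Inl j) - wt j \<beta> * L \<beta>"
      by (simp add: reflection_def L_diff L_scale L_fund_weight wt_def)
    have "DW (reflection \<beta>) (pvar (Inl j) * f) = (pvar (Inl j) - wt j \<beta> * L \<beta>) * DW (reflection \<beta>) f
        + (\<Sum>\<gamma>\<in>inversions (reflection \<beta>). wt j \<gamma> * cover_term \<beta> \<gamma> f)"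
      using DW_L_mult[OF ws, of "\<omega> j" f] unfolding r L_fund_weight wt_def cover_term_def .
    then show ?thesis by (simp only:) (simp add: algebra_simps sum_distrib_left)
  qed
  then show ?thesis
    unfolding N_def by (simp add: sum.distrib sum_subtractf sum_distrib_left)
qed

lemma N_N:
  "N i (N j f) = (\<Sum>x\<in>QR. \<Sum>y\<in>QR. wt i x * wt j y
     * (q_monom al x * q_monom al y * DW (reflection x) (DW (reflection y) f)))"
proof -
  have "DW (reflection x) (N j f) = (\<Sum>y\<in>QR. wt j y * q_monom al y * DW (reflection x) (DW (reflection y) f))"
    if "x \<in> QR" for x
  proof -
    have "act (s i) (wt j y * q_monom al y) = wt j y * q_monom al y" for i y
      by (simp add: act_mult act_q_monom wt_def act_pconst)
    then show ?thesis
      unfolding N_def by (simp add: DW_sum[OF QR_pos[OF that]] DW_invariant_mult[OF QR_pos[OF that]])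
  qed
  then show ?thesis unfolding N_def[of i] by (simp add: sum_distrib_left mult_ac)
qed

lemma wt_wedge: "wt i x * wt j y - wt j x * wt i y = pconst (wedge i j x y)"
  by (simp add: wt_def wedge_def pconst_mult pconst_diff)

text \<open>The terms with \<gamma> = \<beta> vanish because \<open>wedge\<close> is alternating,
  the others outside the index set because the length drops by more than one.\<close>

lemma chevalley_sum:
  "(\<Sum>\<beta>\<in>QR. \<Sum>\<gamma>\<in>inversions (reflection \<beta>). pconst (wedge i j \<beta> \<gamma>) * (q_monom al \<beta> * cover_term \<beta> \<gamma> f))
  = (\<Sum>(\<beta>, \<gamma>)\<in>chevalley_pairs. pconst (wedge i j \<beta> \<gamma>) * (qm (coroot \<beta>) * DW (reflection \<beta> \<circ> reflection \<gamma>) f))"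
proof -
  have "(\<Sum>\<beta>\<in>QR. \<Sum>\<gamma>\<in>inversions (reflection \<beta>). pconst (wedge i j \<beta> \<gamma>) * (q_monom al \<beta> * cover_term \<beta> \<gamma> f))
    = (\<Sum>(\<beta>, \<gamma>)\<in>Sigma QR (\<lambda>\<beta>. inversions (reflection \<beta>)).
        pconst (wedge i j \<beta> \<gamma>) * (q_monom al \<beta> * cover_term \<beta> \<gamma> f))"
    by (rule sum.Sigma) (auto simp: finite_QR finite_inversions)
  also have "\<dots> = (\<Sum>(\<beta>, \<gamma>)\<in>chevalley_pairs. pconst (wedge i j \<beta> \<gamma>) * (q_monom al \<beta> * cover_term \<beta> \<gamma> f))"
  proof (rule sum.mono_neutral_right)
    show "\<forall>z\<in>Sigma QR (\<lambda>\<beta>. inversions (reflection \<beta>)) - chevalley_pairs.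
        (case z of (\<beta>, \<gamma>) \<Rightarrow> pconst (wedge i j \<beta> \<gamma>) * (q_monom al \<beta> * cover_term \<beta> \<gamma> f)) = 0"
    proof
      fix z assume z: "z \<in> Sigma QR (\<lambda>\<beta>. inversions (reflection \<beta>)) - chevalley_pairs"
      obtain \<beta> \<gamma> where zz: "z = (\<beta>, \<gamma>)" by (cases z)
      have "wedge i j \<beta> \<beta> = 0" by (simp add: wedge_def)
      moreover have "\<gamma> = \<beta> \<or> cover_term \<beta> \<gamma> f = 0"
        using z by (auto simp: zz chevalley_pairs_def cover_term_def)
      ultimately show "(case z of (\<beta>, \<gamma>) \<Rightarrow>
          pconst (wedge i j \<beta> \<gamma>) * (q_monom al \<beta> * cover_term \<beta> \<gamma> f)) = 0"
        by (auto simp: zz)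
    qed
  qed (auto simp: chevalley_pairs_def finite_QR finite_inversions)
  also have "\<dots> = (\<Sum>(\<beta>, \<gamma>)\<in>chevalley_pairs.
      pconst (wedge i j \<beta> \<gamma>) * (qm (coroot \<beta>) * DW (reflection \<beta> \<circ> reflection \<gamma>) f))"
    by (intro sum.cong) (auto simp: chevalley_pairs_def cover_term_def q_monom_eq_qm QR_pos)
  finally show ?thesis .
qed

text \<open>By the nil-Coxeter relation the product of two divided differences survives only if the
  lengths add.\<close>

lemma product_sum:
  "(\<Sum>x\<in>QR. \<Sum>y\<in>QR. pconst (wedge i j x y)
     * (q_monom al x * q_monom al y * DW (reflection x) (DW (reflection y) f)))
  = (\<Sum>(x, y)\<in>product_pairs. pconst (wedge i j x y)
     * (qm (coroot x + coroot y) * DW (reflection x \<circ> reflection y) f))"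
proof -
  have D: "DW (reflection x) (DW (reflection y) f)
      = (if (x, y) \<in> product_pairs then DW (reflection x \<circ> reflection y) f else 0)"
    if q: "x \<in> QR" "y \<in> QR" for x y
  proof -
    obtain xs ys where "reflection x = sw xs" "reflection y = sw ys"
      using reflection_word[OF QR_pos[OF q(1)]] reflection_word[OF QR_pos[OF q(2)]] by blast
    then have "DW (reflection x) (DW (reflection y) f)
      = (if wl (reflection x \<circ> reflection y) = wl (reflection x) + wl (reflection y)
         then DW (reflection x \<circ> reflection y) f else 0)" by (rule DW_comp)
    then show ?thesis using q by (simp add: product_pairs_def)
  qed
  have "(\<Sum>x\<in>QR. \<Sum>y\<in>QR. pconst (wedge i j x y)
     * (q_monom al x * q_monom al y * DW (reflection x) (DW (reflection y) f)))
    = (\<Sum>(x, y)\<in>QR \<times> QR. pconst (wedge i j x y)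
     * (q_monom al x * q_monom al y * DW (reflection x) (DW (reflection y) f)))"
    by (rule sum.Sigma) (auto simp: finite_QR)
  also have "\<dots> = (\<Sum>(x, y)\<in>product_pairs. pconst (wedge i j x y)
     * (q_monom al x * q_monom al y * DW (reflection x) (DW (reflection y) f)))"
    by (rule sum.mono_neutral_right) (auto simp: finite_QR D, auto simp: product_pairs_def)
  also have "\<dots> = (\<Sum>(x, y)\<in>product_pairs. pconst (wedge i j x y)
     * (qm (coroot x + coroot y) * DW (reflection x \<circ> reflection y) f))"
  proof (intro sum.cong refl)
    fix z assume "z \<in> product_pairs"
    then obtain x y where z: "z = (x, y)" and p: "(x, y) \<in> product_pairs" by (cases z) auto
    then have "x \<in> QR" "y \<in> QR" by (auto simp: product_pairs_def)
    then show "(case z of (x, y) \<Rightarrow> pconst (wedge i j x y)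
        * (q_monom al x * q_monom al y * DW (reflection x) (DW (reflection y) f)))
      = (case z of (x, y) \<Rightarrow> pconst (wedge i j x y)
        * (qm (coroot x + coroot y) * DW (reflection x \<circ> reflection y) f))"
      using p by (simp add: z D q_monom_mult QR_pos)
  qed
  finally show ?thesis .
qed

theorem Lambda_commute: "\<Lambda> i (\<Lambda> j f) = \<Lambda> j (\<Lambda> i f)"
proof -
  define M where "M i j = (\<Sum>\<beta>\<in>QR. wt i \<beta> * wt j \<beta> * (q_monom al \<beta> * L \<beta> * DW (reflection \<beta>) f))" for i j
  define R where "R i j = (\<Sum>\<beta>\<in>QR. \<Sum>\<gamma>\<in>inversions (reflection \<beta>).
      wt i \<beta> * wt j \<gamma> * (q_monom al \<beta> * cover_term \<beta> \<gamma> f))" for i j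
  have M: "M i j = M j i" by (simp add: M_def mult.commute[of "wt i _"])
  \<comment> \<open>All contributions except those of R and of the product of two corrections are
    symmetric in i and j.\<close>
  have expand: "\<Lambda> i (\<Lambda> j f) = pvar (Inl i) * pvar (Inl j) * f + pvar (Inl i) * N j f
      + pvar (Inl j) * N i f - M i j + R i j + N i (N j f)" for i j
    by (simp add: Lambda_eq N_add N_mult_var flip: M_def R_def) (simp add: algebra_simps)
  have "R i j - R j i = (\<Sum>\<beta>\<in>QR. \<Sum>\<gamma>\<in>inversions (reflection \<beta>).
      (wt i \<beta> * wt j \<gamma> - wt j \<beta> * wt i \<gamma>) * (q_monom al \<beta> * cover_term \<beta> \<gamma> f))"
    by (simp add: R_def sum_subtractf left_diff_distrib)
  moreover have "N i (N j f) - N j (N i f) = (\<Sum>x\<in>QR. \<Sum>y\<in>QR. (wt i x * wt j y - wt j x * wt i y)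
     * (q_monom al x * q_monom al y * DW (reflection x) (DW (reflection y) f)))"
    by (simp add: N_N sum_subtractf left_diff_distrib)
  ultimately have "(R i j - R j i) + (N i (N j f) - N j (N i f)) = 0"
    unfolding wt_wedge chevalley_sum product_sum
    using pair_cancellation[of "\<lambda>c d w. pconst c * (qm d * DW w f)" i j]
    by (simp add: pconst_uminus mpoly_eq_uminus_self)
  then show ?thesis using M by (simp add: expand algebra_simps)
qed

subsection \<open>Filtration by the degree in \<open>\<lambda>\<close>\<close>

definition ldeg :: "('l + 'l \<Rightarrow>\<^sub>0 nat) \<Rightarrow> nat" where
  "ldeg m = (\<Sum>i\<in>UNIV. Poly_Mapping.lookup m (Inl i))"

lemma ldeg_0 [simp]: "ldeg 0 = 0"
  by (simp add: ldeg_def)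

lemma ldeg_Inl: "ldeg (Poly_Mapping.single (Inl i) 1 + m) = Suc (ldeg m)"
  by (simp add: ldeg_def lookup_add lookup_single when_def sum.distrib)

lemma ldeg_Inr: "ldeg (Poly_Mapping.single (Inr i) 1 + m) = ldeg m"
  by (simp add: ldeg_def lookup_add lookup_single)

text \<open>The strict bound makes \<open>V 0\<close> the zero space, so inductions along the
  filtration start from 0.\<close>

definition V :: "nat \<Rightarrow> ('l + 'l) mpoly set" where
  "V d = {f. \<forall>m\<in>Poly_Mapping.keys f. ldeg m < d}"

lemma V_0 [simp]: "0 \<in> V d"
  by (simp add: V_def)

lemma V_add: "f \<in> V d \<Longrightarrow> g \<in> V d \<Longrightarrow> f + g \<in> V d"
  unfolding V_def using keys_add[of f g] by blast

lemma V_sum: "(\<And>x. x \<in> A \<Longrightarrow> f x \<in> V d) \<Longrightarrow> sum f A \<in> V d"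
  by (induction A rule: infinite_finite_induct) (auto intro: V_add)

lemma V_mono: "f \<in> V d \<Longrightarrow> d \<le> e \<Longrightarrow> f \<in> V e"
  by (force simp: V_def)

lemma V_single: "ldeg m < d \<Longrightarrow> Poly_Mapping.single m c \<in> V d"
  by (simp add: V_def)

lemma V_pconst_mult: "f \<in> V d \<Longrightarrow> pconst c * f \<in> V d"
  unfolding V_def pconst_def using keys_mult[of "Poly_Mapping.single 0 c" f] by (auto split: if_splits)

lemma V_Inl: "f \<in> V d \<Longrightarrow> pvar (Inl i) * f \<in> V (Suc d)"
  unfolding V_def pvar_def using keys_mult[of "Poly_Mapping.single (Poly_Mapping.single (Inl i) 1) 1" f]
  by (auto simp: ldeg_Inl[unfolded One_nat_def] dest!: subsetD)

lemma V_Inr: "f \<in> V d \<Longrightarrow> pvar (Inr i) * f \<in> V d"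
  unfolding V_def pvar_def using keys_mult[of "Poly_Mapping.single (Poly_Mapping.single (Inr i) 1) 1" f]
  by (auto simp: ldeg_Inr[unfolded One_nat_def] dest!: subsetD)

lemma V_L: "f \<in> V d \<Longrightarrow> L v * f \<in> V (Suc d)"
  unfolding L_eq by (auto simp: sum_distrib_right mult.assoc intro!: V_sum V_pconst_mult V_Inl)

lemma V_uminus: "f \<in> V d \<Longrightarrow> - f \<in> V d"
  using V_pconst_mult[of f d "-1"] by (simp add: pconst_uminus)

lemma V_Inr_power: "f \<in> V d \<Longrightarrow> pvar (Inr i) ^ n * f \<in> V d"
  by (induction n) (auto simp: mult.assoc intro: V_Inr)

lemma V_q_monom: "f \<in> V d \<Longrightarrow> q_monom al \<beta> * f \<in> V d"
proof -
  assume f: "f \<in> V d"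
  have "(\<Prod>i\<in>A. pvar (Inr i) ^ coroot_coeff al \<beta> i) * f \<in> V d" for A
    by (induction A rule: infinite_finite_induct) (auto simp: mult.assoc f intro: V_Inr_power)
  then show ?thesis by (simp add: q_monom_def)
qed

lemma V_exists: "\<exists>d. f \<in> V d"
proof -
  have "f \<in> V (Suc (\<Sum>m\<in>Poly_Mapping.keys f. ldeg m))"
    by (auto simp: V_def less_Suc_eq_le intro!: member_le_sum)
  then show ?thesis by blast
qed

lemma V_zero_eq: "f \<in> V 0 \<Longrightarrow> f = 0"
  by (simp add: V_def)

lemma V_linear_map:
  assumes "\<And>f g. T (f + g) = T f + T g" "\<And>m c. ldeg m < d \<Longrightarrow> T (Poly_Mapping.single m c) \<in> V e"
    and "f \<in> V d"
  shows "T f \<in> V e"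
proof -
  have T0: "T 0 = 0" using assms(1)[of 0 0] by simp
  have "T (\<Sum>m\<in>S. Poly_Mapping.single m (Poly_Mapping.lookup f m)) \<in> V e"
    if "finite S" "S \<subseteq> Poly_Mapping.keys f" for S
    using that
  proof (induction S)
    case (insert m S)
    then have "ldeg m < d" using assms(3) by (auto simp: V_def)
    then show ?case using insert assms by (auto intro: V_add)
  qed (simp add: T0)
  then show ?thesis using mpoly_decomp[of f] by (metis finite_keys order_refl)
qed

lemma dd_V_single: "dd i (Poly_Mapping.single m c) \<in> V (ldeg m)"
proof (induction m rule: monomial_induct)
  case zero
  show ?case using dd_pconst[of i c] by (simp add: pconst_def)
next
  case (var v m)
  show ?case
  proof (cases v)
    case (Inl j)
    have "dd i (pvar v * Poly_Mapping.single m c) \<in> V (Suc (ldeg m))"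
      unfolding Inl L_fund_weight[symmetric] dd_L_mult
      by (intro V_add V_L var V_pconst_mult V_single) simp
    then show ?thesis unfolding single_var_add by (simp add: Inl ldeg_Inl del: One_nat_def)
  next
    case (Inr j)
    have "dd i (pvar v * Poly_Mapping.single m c) \<in> V (ldeg m)"
      unfolding Inr dd_invariant_mult[OF act_pvar_Inr] by (intro V_Inr var)
    then show ?thesis unfolding single_var_add by (simp add: Inr ldeg_Inr del: One_nat_def)
  qed
qed

lemma dd_V: "f \<in> V (Suc d) \<Longrightarrow> dd i f \<in> V d"
  by (rule V_linear_map[of "dd i" "Suc d"]) (auto simp: dd_add intro: V_mono[OF dd_V_single])

lemma ddw_V: "ws \<noteq> [] \<Longrightarrow> f \<in> V (Suc d) \<Longrightarrow> ddw ws f \<in> V d"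
proof (induction ws)
  case (Cons i ws)
  show ?case
  proof (cases "ws = []")
    case False
    then have "ddw ws f \<in> V (Suc d)" using Cons by (auto intro: V_mono)
    then show ?thesis by (auto intro: dd_V)
  qed (use Cons in \<open>auto intro: dd_V\<close>)
qed simp

lemma DW_reflection_word:
  assumes "\<beta> \<in> P"
  obtains ws where "DW (reflection \<beta>) = ddw ws" "length ws = wl (reflection \<beta>)" "ws \<noteq> []"
proof -
  obtain rs where rs: "reflection \<beta> = sw rs" using reflection_word[OF assms] by blast
  obtain ws where ws: "DW (reflection \<beta>) = ddw ws" "length ws = wl (reflection \<beta>)"
    using DW_word[OF rs] by blast
  have "wl (reflection \<beta>) \<noteq> 0"
    using wl_reflection_card[OF assms] self_inversion[OF assms] finite_inversions by auto
  then have "ws \<noteq> []" using ws by auto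
  then show thesis using that ws by blast
qed

lemma DW_V: "\<beta> \<in> P \<Longrightarrow> f \<in> V (Suc d) \<Longrightarrow> DW (reflection \<beta>) f \<in> V d"
  using DW_reflection_word ddw_V by metis

lemma DW_pconst: "\<beta> \<in> P \<Longrightarrow> DW (reflection \<beta>) (pconst c) = 0"
  using DW_reflection_word ddw_pconst by metis

lemma N_V: "f \<in> V (Suc d) \<Longrightarrow> N j f \<in> V d"
  unfolding N_def wt_def
  by (auto simp: mult.assoc intro!: V_sum V_pconst_mult V_q_monom DW_V QR_pos)

lemma N_pconst: "N j (pconst c) = 0"
  unfolding N_def by (intro sum.neutral) (simp add: DW_pconst QR_pos)

end

section \<open>The map \<open>\<psi>\<close>\<close>

locale ordered_root_base = root_base \<Phi> al
  for \<Phi> :: "'a::euclidean_space set" and al :: "'l::{finite,linorder} \<Rightarrow> 'a"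
begin

abbreviation "\<psi> \<equiv> psi \<Phi> al"

definition psi_monom :: "('l + 'l \<Rightarrow>\<^sub>0 nat) \<Rightarrow> ('l + 'l) mpoly" where
  "psi_monom m = (\<Prod>i\<in>UNIV. pvar (Inr i) ^ Poly_Mapping.lookup m (Inr i))
     * foldr (\<lambda>j. \<Lambda> j ^^ Poly_Mapping.lookup m (Inl j)) (sorted_list_of_set UNIV) 1"

lemma psi_eq: "\<psi> = lin_ext psi_monom"
  by (rule ext) (simp add: psi_def lin_ext_def psi_monom_def mult.assoc)

lemma Lambda_funpow: "(\<Lambda> k ^^ n) (\<Lambda> j x) = \<Lambda> j ((\<Lambda> k ^^ n) x)"
  by (induction n) (simp_all add: Lambda_commute[of j])

text \<open>As the operators commute, an additional \<Lambda>_j can be pulled to the front from the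
  place of j in the list.\<close>

lemma foldr_Lambda:
  "distinct xs \<Longrightarrow> foldr (\<lambda>k. \<Lambda> k ^^ (n k + (if k = j then 1 else 0))) xs x
    = (if j \<in> set xs then \<Lambda> j (foldr (\<lambda>k. \<Lambda> k ^^ n k) xs x) else foldr (\<lambda>k. \<Lambda> k ^^ n k) xs x)"
  by (induction xs) (auto simp: Lambda_funpow)

lemma psi_monom_Inl: "psi_monom (Poly_Mapping.single (Inl j) 1 + m) = \<Lambda> j (psi_monom m)"
proof -
  have l: "Poly_Mapping.lookup (Poly_Mapping.single (Inl j) 1 + m) (Inl k)
      = Poly_Mapping.lookup m (Inl k) + (if k = j then 1 else 0)" for k
    by (simp add: lookup_add lookup_single when_def)
  have r: "Poly_Mapping.lookup (Poly_Mapping.single (Inl j) 1 + m) (Inr k)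
      = Poly_Mapping.lookup m (Inr k)" for k
    by (simp add: lookup_add lookup_single)
  have "act w (\<Prod>i\<in>UNIV. pvar (Inr i) ^ Poly_Mapping.lookup m (Inr i))
      = (\<Prod>i\<in>UNIV. pvar (Inr i) ^ Poly_Mapping.lookup m (Inr i))" for w
    by (simp add: weyl_act_q_def psubst_simps)
  then show ?thesis
    unfolding psi_monom_def l r by (subst foldr_Lambda) (simp_all add: Lambda_invariant_mult)
qed

lemma psi_monom_Inr: "psi_monom (Poly_Mapping.single (Inr j) 1 + m) = pvar (Inr j) * psi_monom m"
proof -
  have l: "Poly_Mapping.lookup (Poly_Mapping.single (Inr j) 1 + m) (Inl k)
      = Poly_Mapping.lookup m (Inl k)" for k
    by (simp add: lookup_add lookup_single)
  have r: "Poly_Mapping.lookup (Poly_Mapping.single (Inr j) 1 + m) (Inr k)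
      = (if k = j then 1 else 0) + Poly_Mapping.lookup m (Inr k)" for k
    by (simp add: lookup_add lookup_single when_def)
  have "(\<Prod>k\<in>UNIV. pvar (Inr k) ^ (if k = j then 1 else 0))
      = (\<Prod>k\<in>UNIV. if k = j then pvar (Inr k) else (1 :: ('l + 'l) mpoly))"
    by (intro prod.cong) auto
  then have "(\<Prod>k\<in>UNIV. pvar (Inr k) ^ (if k = j then 1 else 0)) = (pvar (Inr j) :: ('l + 'l) mpoly)"
    by simp
  then show ?thesis
    unfolding psi_monom_def l r power_add prod.distrib by (simp only: mult.assoc)
qed

lemma psi_add: "\<psi> (f + g) = \<psi> f + \<psi> g"
  by (simp add: psi_eq lin_ext_add)

lemma psi_0 [simp]: "\<psi> 0 = 0"
  by (simp add: psi_eq)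

lemma psi_pconst_mult: "\<psi> (pconst c * f) = pconst c * \<psi> f"
  by (simp add: psi_eq lin_ext_pconst_mult)

lemma psi_pconst [simp]: "\<psi> (pconst c) = pconst c"
proof -
  have "foldr (\<lambda>j. \<Lambda> j ^^ 0) xs x = x" for xs x
    by (induction xs) auto
  then have "psi_monom 0 = 1" by (simp add: psi_monom_def)
  then show ?thesis by (simp add: psi_eq pconst_def[where 'v = "'l + 'l"])
qed

lemma psi_1 [simp]: "\<psi> 1 = 1"
  using psi_pconst[of 1] by simp

lemma psi_uminus: "\<psi> (- f) = - \<psi> f"
  using psi_pconst_mult[of "-1" f] by (simp add: pconst_uminus)

lemma psi_diff: "\<psi> (f - g) = \<psi> f - \<psi> g"
  using psi_add[of f "- g"] by (simp add: psi_uminus)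

lemma psi_sum: "\<psi> (sum f A) = (\<Sum>x\<in>A. \<psi> (f x))"
  by (induction A rule: infinite_finite_induct) (simp_all add: psi_add)

lemma psi_lam_mult: "\<psi> (pvar (Inl j) * f) = \<Lambda> j (\<psi> f)"
  unfolding psi_eq
  by (rule lin_ext_pvar_mult) (simp_all only: psi_monom_Inl Lambda_add Lambda_pconst_mult)

lemma psi_q_mult: "\<psi> (pvar (Inr j) * f) = pvar (Inr j) * \<psi> f"
  unfolding psi_eq
  by (rule lin_ext_pvar_mult) (simp_all only: psi_monom_Inr distrib_left mult.left_commute)

lemma psi_emb_q_mult: "\<psi> (emb_q p * f) = emb_q p * \<psi> f"
  unfolding emb_q_def
  by (induction p rule: mpoly_induct)
     (simp_all add: psi_pconst_mult psubst_simps distrib_right psi_add mult.assoc psi_q_mult)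

lemma psi_V_single: "\<psi> (Poly_Mapping.single m c) - Poly_Mapping.single m c \<in> V (ldeg m)"
proof (induction m rule: monomial_induct)
  case zero
  show ?case using psi_pconst[of c] by (simp add: pconst_def)
next
  case (var v m)
  let ?x = "Poly_Mapping.single m c :: ('l + 'l) mpoly"
  show ?case
  proof (cases v)
    case (Inl j)
    have "\<psi> ?x - ?x + ?x \<in> V (Suc (ldeg m))"
      by (intro V_add V_mono[OF var] V_single) auto
    then have "N j (\<psi> ?x) \<in> V (Suc (ldeg m))" using V_mono[OF N_V] by force
    then have "pvar v * (\<psi> ?x - ?x) + N j (\<psi> ?x) \<in> V (Suc (ldeg m))"
      unfolding Inl by (intro V_add V_Inl var)
    then show ?thesis
      unfolding single_var_add by (simp add: Inl ldeg_Inl psi_lam_mult Lambda_eq right_diff_distrib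
          diff_add_eq del: One_nat_def)
  next
    case (Inr j)
    have "pvar v * (\<psi> ?x - ?x) \<in> V (ldeg m)" unfolding Inr by (intro V_Inr var)
    then show ?thesis
      unfolding single_var_add by (simp add: Inr ldeg_Inr psi_q_mult right_diff_distrib del: One_nat_def)
  qed
qed

lemma psi_V: "f \<in> V (Suc d) \<Longrightarrow> \<psi> f - f \<in> V d"
  by (rule V_linear_map[of "\<lambda>f. \<psi> f - f" "Suc d"])
     (auto simp: psi_add intro: V_mono[OF psi_V_single])

lemma psi_inj: "inj \<psi>"
proof (rule injI)
  fix f g assume "\<psi> f = \<psi> g"
  then have z: "\<psi> (f - g) = 0" by (simp add: psi_diff)
  have "h = 0" if "h \<in> V d" "\<psi> h = 0" for h d
    using that
  proof (induction d)
    case 0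
    then show ?case using V_zero_eq by blast
  next
    case (Suc d)
    then have "- h \<in> V d" using psi_V[of h d] by simp
    then show ?case using Suc V_uminus[of "- h" d] by simp
  qed
  then show "f = g" using V_exists[of "f - g"] z by (metis eq_iff_diff_eq_0)
qed

text \<open>Successive correction: the error \<psi> f - f has smaller degree in \<lambda>, hence is
  itself a value of \<psi>, which is subtracted.\<close>

lemma psi_surj: "surj \<psi>"
proof -
  have "\<exists>g. \<psi> g = f" if "f \<in> V d" for f d
    using that
  proof (induction d arbitrary: f)
    case 0
    then have "f = 0" using V_zero_eq by blast
    then have "\<psi> 0 = f" by simp
    then show ?case by blast
  next
    case (Suc d)
    have "- (\<psi> f - f) \<in> V d" using psi_V[OF Suc.prems] by (rule V_uminus)
    then obtain g where "\<psi> g = - (\<psi> f - f)" using Suc.IH by blast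
    then have "\<psi> (f + g) = f" by (simp add: psi_add)
    then show ?case by blast
  qed
  then show ?thesis using V_exists by (metis surj_def)
qed

lemma psi_bij: "bij \<psi>"
  by (simp add: bij_def psi_inj psi_surj)

lemma psi_psi_inv [simp]: "\<psi> (psi_inv \<Phi> al f) = f"
  by (simp add: surj_f_inv_f psi_surj)

lemma psi_inv_psi [simp]: "psi_inv \<Phi> al (\<psi> f) = f"
  by (simp add: psi_inj)

text \<open>Evaluation at 1 determines the operator: f(\<Lambda>, q) and multiplication by u agree
  on 1, both commute with every \<Lambda>_j and q_j, and these generate everything from 1.\<close>

lemma psi_invariant:
  assumes "\<And>i. act (s i) u = u" "\<psi> f = u"
  shows "\<psi> (f * a) = u * \<psi> a"
proof (induction a rule: mpoly_induct)
  case (const c)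
  have "\<psi> (f * pconst c) = pconst c * u" by (simp add: mult.commute[of f] psi_pconst_mult assms(2))
  then show ?case by (simp add: mult.commute)
next
  case (add a b)
  then show ?case by (simp add: distrib_left psi_add)
next
  case (var v a)
  have e: "f * (pvar v * a) = pvar v * (f * a)" by (rule mult.left_commute)
  show ?case
    unfolding e using var assms(1)
    by (cases v) (simp_all add: psi_lam_mult psi_q_mult Lambda_invariant_mult)
qed

text \<open>Every correction term of \<Lambda>_j carries a monomial q^(\<beta>^v) of positive
  degree, so at q = 0 only multiplication by \<lambda>_j remains.\<close>

lemma ev0_psi: "psubst (case_sum pvar (\<lambda>_. 0)) (\<psi> f) = psubst (case_sum pvar (\<lambda>_. 0)) f"
proof (induction f rule: mpoly_induct)
  case (var v f)
  have "psubst (case_sum pvar (\<lambda>_. 0)) (q_monom al \<beta>) = 0" if "\<beta> \<in> P" for \<beta>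
  proof -
    have "coroot_height al \<beta> \<noteq> 0" using wl_reflection_le[OF that] by auto
    then obtain i where "coroot_coeff al \<beta> i \<noteq> 0" by (auto simp: coroot_height_def)
    then show ?thesis
      by (auto simp: q_monom_def psubst_simps intro!: prod_zero bexI[of _ i])
  qed
  then have N: "psubst (case_sum pvar (\<lambda>_. 0)) (N j g) = 0" for j g
    unfolding N_def psubst_sum psubst_mult by (intro sum.neutral) (simp add: QR_pos)
  show ?case
    using var by (cases v) (simp_all add: psi_lam_mult psi_q_mult Lambda_eq psubst_simps N)
qed (simp_all add: psi_add psubst_simps)

end

section \<open>The quadratic relation and the Toda derivation\<close>

context root_base
begin

text \<open>The Euler operator q_i d/dq_i. It preserves monomials in q up to a factor, and it
  commutes with the Weyl group and with divided differences, which do not involve q.\<close>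

definition qdiff :: "'l \<Rightarrow> ('l + 'l) mpoly \<Rightarrow> ('l + 'l) mpoly" where
  "qdiff i f = pvar (Inr i) * pdiff (Inr i) f"

lemma qdiff_add: "qdiff i (f + g) = qdiff i f + qdiff i g"
  by (simp add: qdiff_def pdiff_add distrib_left)

lemma qdiff_mult: "qdiff i (f * g) = qdiff i f * g + f * qdiff i g"
  by (simp add: qdiff_def pdiff_mult algebra_simps)

lemma qdiff_pconst [simp]: "qdiff i (pconst c) = 0"
  by (simp add: qdiff_def)

lemma qdiff_0 [simp]: "qdiff i 0 = 0"
  by (simp add: qdiff_def)

lemma qdiff_1 [simp]: "qdiff i 1 = 0"
  using qdiff_pconst[of i 1] by simp

lemma qdiff_uminus: "qdiff i (- f) = - qdiff i f"
  using qdiff_mult[of i "pconst (-1)" f] qdiff_pconst[of i "-1"] by (simp add: pconst_uminus)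

lemma qdiff_diff: "qdiff i (f - g) = qdiff i f - qdiff i g"
  using qdiff_add[of i f "- g"] by (simp add: qdiff_uminus)

lemma qdiff_sum: "qdiff i (sum f A) = (\<Sum>x\<in>A. qdiff i (f x))"
  by (induction A rule: infinite_finite_induct) (simp_all add: qdiff_add)

lemma qdiff_Inl [simp]: "qdiff i (pvar (Inl j)) = 0"
  by (simp add: qdiff_def pdiff_pvar)

lemma qdiff_Inr: "qdiff i (pvar (Inr j)) = (if i = j then pvar (Inr j) else 0)"
  by (simp add: qdiff_def pdiff_pvar)

lemma qdiff_L [simp]: "qdiff i (L v) = 0"
  by (simp add: L_eq qdiff_sum qdiff_mult)

lemma qdiff_act: "qdiff i (act w f) = act w (qdiff i f)"
proof (induction f rule: mpoly_induct)
  case (var v f)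
  then show ?case
    by (cases v) (simp_all add: act_mult qdiff_mult act_add act_pvar_Inl act_pvar_Inr qdiff_Inr
        act_pconst[of _ 0, simplified])
qed (simp_all add: act_pconst act_pconst[of _ 0, simplified] act_add qdiff_add)

lemma qdiff_dd: "qdiff i (dd k f) = dd k (qdiff i f)"
proof -
  have "qdiff i (dd k f * L (al k)) = qdiff i (f - act (s k) f)" by (simp only: dd_spec)
  then have "qdiff i (dd k f) * L (al k) = qdiff i f - act (s k) (qdiff i f)"
    by (simp add: qdiff_mult qdiff_diff qdiff_act)
  then show ?thesis by (rule dd_unique[symmetric])
qed

lemma qdiff_ddw: "qdiff i (ddw ws f) = ddw ws (qdiff i f)"
  by (induction ws) (simp_all add: qdiff_dd)

lemma qdiff_DW: "\<beta> \<in> P \<Longrightarrow> qdiff i (DW (reflection \<beta>) f) = DW (reflection \<beta>) (qdiff i f)"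
  using DW_reflection_word qdiff_ddw by metis

lemma qdiff_power: "qdiff i (pvar (Inr j) ^ n) = (if i = j then of_nat n else 0) * pvar (Inr j) ^ n"
  by (induction n) (auto simp: qdiff_mult qdiff_Inr algebra_simps)

lemma qdiff_q_monom:
  assumes "\<beta> \<in> P"
  shows "qdiff i (q_monom al \<beta>) = wt i \<beta> * q_monom al \<beta>"
proof -
  have "qdiff i (\<Prod>j\<in>A. pvar (Inr j) ^ coroot_coeff al \<beta> j)
      = (if i \<in> A then of_nat (coroot_coeff al \<beta> i) else 0) * (\<Prod>j\<in>A. pvar (Inr j) ^ coroot_coeff al \<beta> j)"
    if "finite A" for A
    using that by (induction A) (auto simp: qdiff_mult qdiff_power algebra_simps)
  then have "qdiff i (q_monom al \<beta>) = of_nat (coroot_coeff al \<beta> i) * q_monom al \<beta>"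
    by (simp add: q_monom_def)
  moreover have "wt i \<beta> = of_nat (coroot_coeff al \<beta> i)"
    unfolding wt_def coroot_coeff[OF assms, symmetric] by (simp add: pconst_def)
  ultimately show ?thesis by simp
qed

definition NN :: "'l \<Rightarrow> 'l \<Rightarrow> ('l + 'l) mpoly \<Rightarrow> ('l + 'l) mpoly" where
  "NN i j f = (\<Sum>\<beta>\<in>QR. wt i \<beta> * wt j \<beta> * (q_monom al \<beta> * DW (reflection \<beta>) f))"

lemma NN_commute: "NN i j f = NN j i f"
  by (simp add: NN_def mult.commute[of "wt i _"])

text \<open>Differentiating the monomial of \<beta> inserts \<omega>_i(\<beta>^v) beside the weight
  \<omega>_j(\<beta>^v); the commutator \<open>NN i j\<close> is therefore symmetric.\<close>

lemma qdiff_Lambda: "qdiff i (\<Lambda> j f) = \<Lambda> j (qdiff i f) + NN i j f"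
proof -
  have "qdiff i (wt j \<beta> * q_monom al \<beta> * DW (reflection \<beta>) f)
      = wt j \<beta> * q_monom al \<beta> * DW (reflection \<beta>) (qdiff i f)
        + wt i \<beta> * wt j \<beta> * (q_monom al \<beta> * DW (reflection \<beta>) f)" if "\<beta> \<in> QR" for \<beta>
    using QR_pos[OF that]
    by (simp add: qdiff_mult qdiff_q_monom qdiff_DW wt_def)
  then have "qdiff i (N j f) = N j (qdiff i f) + NN i j f"
    by (simp add: N_def NN_def qdiff_sum sum.distrib)
  then show ?thesis by (simp add: Lambda_eq qdiff_add qdiff_mult)
qed

section \<open>The quadratic relation and the derivation it induces\<close>

definition gram :: "'l \<Rightarrow> 'l \<Rightarrow> real" where
  "gram i j = coroot (al i) \<bullet> coroot (al j)"

lemma gram_commute: "gram i j = gram j i"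
  by (simp add: gram_def inner_commute)

definition quad :: "('l + 'l) mpoly" where
  "quad = (\<Sum>i\<in>UNIV. \<Sum>j\<in>UNIV. pconst (gram i j) * (pvar (Inl i) * pvar (Inl j)))"

definition lin_q :: "('l + 'l) mpoly" where
  "lin_q = (\<Sum>i\<in>UNIV. pconst (gram i i) * pvar (Inr i))"

text \<open>A simple reflection turns the fundamental weight into a constant. Any other quantum root
  has a reduced word with at least two letters, and the second one applied kills this
  constant.\<close>

lemma DW_var:
  assumes "\<beta> \<in> QR"
  shows "DW (reflection \<beta>) (pvar (Inl j)) = (if \<beta> = al j then 1 else 0)"
proof -
  have bP: "\<beta> \<in> P" using assms QR_pos by blast
  obtain rs where rs: "reflection \<beta> = sw rs" using reflection_word[OF bP] by blast
  then obtain ws where ws: "sw ws = reflection \<beta>" "reduced ws"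
    using reduced_exists' by metis
  have D: "DW (reflection \<beta>) = ddw ws" using ddw_reduced[OF ws(2)] ws by simp
  have dv: "dd i (pvar (Inl j)) = pconst (if i = j then 1 else 0)" for i
    using dd_L_mult[of i "\<omega> j" 1] dd_pconst[of i 1] by (simp add: L_fund_weight fund_weight_coroot)
  have "wl (reflection \<beta>) \<noteq> 0"
    using wl_reflection_card[OF bP] self_inversion[OF bP] finite_inversions by auto
  then have "ws \<noteq> []" using ws by auto
  then obtain vs i where vi: "ws = vs @ [i]" by (cases ws rule: rev_cases) auto
  show ?thesis
  proof (cases "vs = []")
    case True
    then have r: "reflection \<beta> = s i" using ws vi by simp
    then have "\<beta> = al i" using self_inversion[OF bP] inversions_simple[of i] by simp
    then show ?thesis using D vi True dv inj_eq[OF simple_inj] by simp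
  next
    case False
    have "\<beta> \<noteq> al j"
    proof
      assume "\<beta> = al j"
      then have "wl (reflection \<beta>) = 1"
        using wl_reflection_card[OF bP] by (simp add: inversions_simple)
      then show False using ws vi False by simp
    qed
    then show ?thesis using D vi False dv by (simp add: ddw_append ddw_pconst del: if_split)
  qed
qed

lemma q_monom_simple: "q_monom al (al j) = pvar (Inr j)"
proof -
  have "real (coroot_coeff al (al j) i) = real (if i = j then 1 else 0)" for i
    by (simp add: coroot_coeff simple_pos fund_weight_coroot)
  then have c: "coroot_coeff al (al j) i = (if i = j then 1 else 0)" for i
    using of_nat_eq_iff by blast
  have "q_monom al (al j) = (\<Prod>i\<in>UNIV. if i = j then pvar (Inr i) else 1)"
    unfolding q_monom_def c by (intro prod.cong) auto
  then show ?thesis by simp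
qed

lemma Lambda_1: "\<Lambda> j 1 = pvar (Inl j)"
  using N_pconst[of j 1] by (simp add: Lambda_eq)

lemma Lambda_var: "\<Lambda> i (pvar (Inl j)) = pvar (Inl i) * pvar (Inl j) + (if i = j then pvar (Inr j) else 0)"
proof -
  have "N i (pvar (Inl j)) = (\<Sum>\<beta>\<in>QR. if \<beta> = al j then wt i \<beta> * q_monom al \<beta> else 0)"
    unfolding N_def by (intro sum.cong) (auto simp: DW_var)
  also have "\<dots> = wt i (al j) * q_monom al (al j)" by (simp add: finite_QR simple_QR)
  finally show ?thesis by (simp add: Lambda_eq wt_def fund_weight_coroot q_monom_simple)
qed

lemma quadratic_relation_1:
  "(\<Sum>i\<in>UNIV. \<Sum>j\<in>UNIV. pconst (gram i j) * \<Lambda> i (\<Lambda> j 1)) = quad + lin_q"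
proof -
  have "(\<Sum>j\<in>UNIV. pconst (gram i j) * \<Lambda> i (\<Lambda> j 1))
      = (\<Sum>j\<in>UNIV. pconst (gram i j) * (pvar (Inl i) * pvar (Inl j))) + pconst (gram i i) * pvar (Inr i)" for i
  proof -
    have "pconst (gram i j) * \<Lambda> i (\<Lambda> j 1) = pconst (gram i j) * (pvar (Inl i) * pvar (Inl j))
      + (if i = j then pconst (gram i j) * pvar (Inr j) else 0)" for j
      by (simp add: Lambda_1 Lambda_var distrib_left)
    then show ?thesis by (simp add: sum.distrib)
  qed
  then show ?thesis by (simp add: quad_def lin_q_def sum.distrib)
qed

text \<open>Half the Poisson bracket {E, f} with the Toda Hamiltonian E, after replacing exp (2 s_i)
  by -<\<alpha>_i^v, \<alpha>_i^v> q_i.\<close>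

definition tder :: "('l + 'l) mpoly \<Rightarrow> ('l + 'l) mpoly" where
  "tder f = (\<Sum>i\<in>UNIV. pconst (gram i i) * pvar (Inr i) * pdiff (Inl i) f)
     + (\<Sum>i\<in>UNIV. \<Sum>j\<in>UNIV. pconst (2 * gram i j) * pvar (Inl j) * qdiff i f)"

lemma tder_add: "tder (f + g) = tder f + tder g"
  by (simp add: tder_def pdiff_add qdiff_add distrib_left sum.distrib)

lemma tder_pconst [simp]: "tder (pconst c) = 0"
  by (simp add: tder_def)

lemma tder_mult: "tder (f * g) = tder f * g + f * tder g"
  unfolding tder_def pdiff_mult qdiff_mult
  by (simp add: distrib_left distrib_right sum.distrib sum_distrib_left sum_distrib_right mult_ac)

lemma tder_diff: "tder (f - g) = tder f - tder g"
proof -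
  have "tder (pconst (-1) * g) = pconst (-1) * tder g" by (subst tder_mult) simp
  then show ?thesis using tder_add[of f "pconst (-1) * g"] by (simp add: pconst_uminus)
qed

lemma tder_Inl: "tder (pvar (Inl k)) = pconst (gram k k) * pvar (Inr k)"
proof -
  have "(\<Sum>i\<in>UNIV. pconst (gram i i) * pvar (Inr i) * pdiff (Inl i) (pvar (Inl k)))
      = (\<Sum>i\<in>UNIV. if i = k then pconst (gram i i) * pvar (Inr i) else 0)"
    by (intro sum.cong) (auto simp: pdiff_pvar)
  then show ?thesis by (simp add: tder_def)
qed

lemma tder_Inr: "tder (pvar (Inr k)) = (\<Sum>j\<in>UNIV. pconst (2 * gram k j) * pvar (Inl j)) * pvar (Inr k)"
proof -
  have "(\<Sum>i\<in>UNIV. \<Sum>j\<in>UNIV. pconst (2 * gram i j) * pvar (Inl j) * qdiff i (pvar (Inr k)))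
      = (\<Sum>i\<in>UNIV. if i = k then (\<Sum>j\<in>UNIV. pconst (2 * gram i j) * pvar (Inl j) * pvar (Inr k)) else 0)"
    by (intro sum.cong) (auto simp: qdiff_Inr)
  then show ?thesis by (simp add: tder_def pdiff_pvar sum_distrib_right)
qed

end

context ordered_root_base
begin

lemma psi_lin_q_mult: "\<psi> (lin_q * a) = lin_q * \<psi> a"
  unfolding lin_q_def
  by (simp add: sum_distrib_right psi_sum mult.assoc psi_pconst_mult psi_q_mult)

lemma psi_quad_mult:
  "\<psi> (quad * a) = (\<Sum>i\<in>UNIV. \<Sum>j\<in>UNIV. pconst (gram i j) * \<Lambda> i (\<Lambda> j (\<psi> a)))"
  unfolding quad_def
  by (simp add: sum_distrib_right psi_sum mult.assoc psi_pconst_mult psi_lam_mult)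

text \<open>The relation at 1 says that \<psi> sends \<open>quad - lin_q\<close> to the invariant
  \<open>quad\<close>; by \<open>psi_invariant\<close> it then holds as an identity of
  operators.\<close>

lemma quadratic_relation:
  assumes "\<And>i. act (s i) quad = quad"
  shows "(\<Sum>i\<in>UNIV. \<Sum>j\<in>UNIV. pconst (gram i j) * \<Lambda> i (\<Lambda> j x)) = (quad + lin_q) * x"
proof -
  define a where "a = psi_inv \<Phi> al x"
  have x: "\<psi> a = x" by (simp add: a_def)
  have "\<psi> (quad - lin_q) = quad"
    using psi_quad_mult[of 1] psi_lin_q_mult[of 1] quadratic_relation_1 by (simp add: psi_diff)
  then have "\<psi> ((quad - lin_q) * a) = quad * x"
    using psi_invariant[OF assms, of "quad - lin_q" a] by (simp add: x)
  then have "\<psi> (quad * a) - lin_q * x = quad * x"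
    by (simp add: left_diff_distrib psi_diff psi_lin_q_mult x)
  then show ?thesis unfolding psi_quad_mult x by (simp add: distrib_right diff_eq_eq)
qed

text \<open>The coefficient of \<open>h\<close> in \<open>\<Sum> \<langle>\<alpha>\<^sub>i\<^sup>\<or>, \<alpha>\<^sub>j\<^sup>\<or>\<rangle> \<nabla>\<^sub>i \<nabla>\<^sub>j\<close> for the connection \<open>\<nabla>\<^sub>i = h q\<^sub>i \<partial>/\<partial>q\<^sub>i + \<Lambda>\<^sub>i\<close>;
  on the algebra generated by the \<open>\<Lambda>\<^sub>i\<close> and \<open>q\<^sub>i\<close> its commutator is the Poisson bracket with the Toda
  Hamiltonian.\<close>

definition K :: "('l + 'l) mpoly \<Rightarrow> ('l + 'l) mpoly" where
  "K x = (\<Sum>i\<in>UNIV. \<Sum>j\<in>UNIV. pconst (gram i j) * (\<Lambda> i (qdiff j x) + qdiff i (\<Lambda> j x)))"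

lemma K_add: "K (x + y) = K x + K y"
  by (simp add: K_def qdiff_add Lambda_add distrib_left sum.distrib algebra_simps)

lemma K_invariant_mult:
  assumes "\<And>i. act (s i) u = u" "\<And>i. qdiff i u = 0"
  shows "K (u * x) = u * K x"
  unfolding K_def
  by (simp add: qdiff_mult Lambda_invariant_mult assms sum_distrib_left distrib_left mult_ac)

lemma K_pconst_mult: "K (pconst c * x) = pconst c * K x"
  by (rule K_invariant_mult) (simp_all add: act_pconst)

text \<open>The symmetry of \<open>NN\<close> lets both commutators with \<Lambda>_k be rewritten as
  commutators with q_k d/dq_k. They telescope to the commutator of q_k d/dq_k with the quadratic
  operator, which is multiplication by \<open>quad + lin_q\<close>, so only the derivative of
  \<open>lin_q\<close> remains.\<close>

lemma K_Lambda:
  assumes "\<And>i. act (s i) quad = quad"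
  shows "K (\<Lambda> k x) = \<Lambda> k (K x) + pconst (gram k k) * (pvar (Inr k) * x)"
proof -
  have t: "\<Lambda> i (qdiff j (\<Lambda> k x)) + qdiff i (\<Lambda> j (\<Lambda> k x))
      = \<Lambda> k (\<Lambda> i (qdiff j x) + qdiff i (\<Lambda> j x)) + (qdiff k (\<Lambda> i (\<Lambda> j x)) - \<Lambda> i (\<Lambda> j (qdiff k x)))" for i j
  proof -
    have 1: "\<Lambda> i (qdiff j (\<Lambda> k x)) = \<Lambda> k (\<Lambda> i (qdiff j x)) + \<Lambda> i (NN j k x)"
      by (simp add: qdiff_Lambda Lambda_add Lambda_commute[of i k])
    have 2: "qdiff i (\<Lambda> j (\<Lambda> k x)) = \<Lambda> k (qdiff i (\<Lambda> j x)) + NN i k (\<Lambda> j x)"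
      by (simp add: Lambda_commute[of j k] qdiff_Lambda[of i k])
    have 3: "NN j k x = qdiff k (\<Lambda> j x) - \<Lambda> j (qdiff k x)"
      by (simp add: qdiff_Lambda NN_commute[of j k])
    have 4: "NN i k (\<Lambda> j x) = qdiff k (\<Lambda> i (\<Lambda> j x)) - \<Lambda> i (qdiff k (\<Lambda> j x))"
      by (simp add: qdiff_Lambda[of k i] NN_commute[of i k])
    show ?thesis unfolding 1 2 3 4 by (simp add: Lambda_add Lambda_diff)
  qed
  have "K (\<Lambda> k x) = (\<Sum>i\<in>UNIV. \<Sum>j\<in>UNIV. pconst (gram i j) * \<Lambda> k (\<Lambda> i (qdiff j x) + qdiff i (\<Lambda> j x)))
      + ((\<Sum>i\<in>UNIV. \<Sum>j\<in>UNIV. pconst (gram i j) * qdiff k (\<Lambda> i (\<Lambda> j x)))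
       - (\<Sum>i\<in>UNIV. \<Sum>j\<in>UNIV. pconst (gram i j) * \<Lambda> i (\<Lambda> j (qdiff k x))))"
    unfolding K_def t by (simp add: distrib_left right_diff_distrib sum.distrib sum_subtractf)
  also have "(\<Sum>i\<in>UNIV. \<Sum>j\<in>UNIV. pconst (gram i j) * \<Lambda> k (\<Lambda> i (qdiff j x) + qdiff i (\<Lambda> j x))) = \<Lambda> k (K x)"
    by (simp add: K_def Lambda_sum Lambda_pconst_mult)
  also have "(\<Sum>i\<in>UNIV. \<Sum>j\<in>UNIV. pconst (gram i j) * qdiff k (\<Lambda> i (\<Lambda> j x)))
      = qdiff k (\<Sum>i\<in>UNIV. \<Sum>j\<in>UNIV. pconst (gram i j) * \<Lambda> i (\<Lambda> j x))"
    by (simp add: qdiff_sum qdiff_mult)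
  also have "\<dots> = qdiff k ((quad + lin_q) * x)" by (simp only: quadratic_relation[OF assms])
  also have "(\<Sum>i\<in>UNIV. \<Sum>j\<in>UNIV. pconst (gram i j) * \<Lambda> i (\<Lambda> j (qdiff k x))) = (quad + lin_q) * qdiff k x"
    by (rule quadratic_relation[OF assms])
  also have "qdiff k ((quad + lin_q) * x) - (quad + lin_q) * qdiff k x = qdiff k (quad + lin_q) * x"
    by (simp add: qdiff_mult)
  also have "qdiff k (quad + lin_q) = pconst (gram k k) * pvar (Inr k)"
  proof -
    have "qdiff k quad = 0" by (simp add: quad_def qdiff_sum qdiff_mult)
    moreover have "qdiff k lin_q = (\<Sum>i\<in>UNIV. if k = i then pconst (gram i i) * pvar (Inr i) else 0)"
      unfolding lin_q_def qdiff_sum by (intro sum.cong) (auto simp: qdiff_mult qdiff_Inr)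
    ultimately show ?thesis by (simp add: qdiff_add)
  qed
  finally show ?thesis by (simp add: mult.assoc)
qed

text \<open>The Euler operator differentiates q_k once in each of the two summands of K; symmetry of
  the Gram matrix merges both contributions into the factor 2.\<close>

lemma K_q:
  "K (pvar (Inr k) * x) = pvar (Inr k) * K x
    + (\<Sum>j\<in>UNIV. pconst (2 * gram k j) * (pvar (Inr k) * \<Lambda> j x))"
proof -
  let ?q = "pvar (Inr k) :: ('l + 'l) mpoly"
  have qd: "qdiff j (?q * y) = (if j = k then ?q * y else 0) + ?q * qdiff j y" for j y
    by (simp add: qdiff_mult qdiff_Inr)
  have t: "pconst (gram i j) * (\<Lambda> i (qdiff j (?q * x)) + qdiff i (\<Lambda> j (?q * x)))
      = ?q * (pconst (gram i j) * (\<Lambda> i (qdiff j x) + qdiff i (\<Lambda> j x)))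
        + (if j = k then pconst (gram i j) * (?q * \<Lambda> i x) else 0)
        + (if i = k then pconst (gram i j) * (?q * \<Lambda> j x) else 0)" for i j
  proof -
    have a: "\<Lambda> i (qdiff j (?q * x)) = (if j = k then ?q * \<Lambda> i x else 0) + ?q * \<Lambda> i (qdiff j x)"
      by (simp add: qd Lambda_add Lambda_q_mult)
    have b: "qdiff i (\<Lambda> j (?q * x)) = (if i = k then ?q * \<Lambda> j x else 0) + ?q * qdiff i (\<Lambda> j x)"
      by (simp add: Lambda_q_mult qd)
    show ?thesis unfolding a b by (auto simp: algebra_simps)
  qed
  have "K (?q * x) = ?q * K x + (\<Sum>i\<in>UNIV. pconst (gram i k) * (?q * \<Lambda> i x))
      + (\<Sum>j\<in>UNIV. pconst (gram k j) * (?q * \<Lambda> j x))"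
  proof -
    have "(\<Sum>i\<in>UNIV. \<Sum>j\<in>UNIV. if i = k then pconst (gram i j) * (?q * \<Lambda> j x) else 0)
        = (\<Sum>i\<in>UNIV. if i = k then (\<Sum>j\<in>UNIV. pconst (gram i j) * (?q * \<Lambda> j x)) else 0)"
      by (intro sum.cong) auto
    then show ?thesis unfolding K_def t by (simp add: sum.distrib sum_distrib_left)
  qed
  also have "(\<Sum>i\<in>UNIV. pconst (gram i k) * (?q * \<Lambda> i x)) = (\<Sum>j\<in>UNIV. pconst (gram k j) * (?q * \<Lambda> j x))"
    by (simp add: gram_commute)
  also have "?q * K x + (\<Sum>j\<in>UNIV. pconst (gram k j) * (?q * \<Lambda> j x)) + (\<Sum>j\<in>UNIV. pconst (gram k j) * (?q * \<Lambda> j x))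
      = ?q * K x + (\<Sum>j\<in>UNIV. pconst (gram k j) * (?q * \<Lambda> j x) + pconst (gram k j) * (?q * \<Lambda> j x))"
    by (simp only: sum.distrib add.assoc)
  also have "(\<Sum>j\<in>UNIV. pconst (gram k j) * (?q * \<Lambda> j x) + pconst (gram k j) * (?q * \<Lambda> j x))
      = (\<Sum>j\<in>UNIV. pconst (2 * gram k j) * (?q * \<Lambda> j x))"
    by (intro sum.cong) (simp_all add: pconst_mult pconst_numeral)
  finally show ?thesis .
qed

text \<open>The commutator of K with f(\<Lambda>, q) is (tder f)(\<Lambda>, q), applied to \<psi> a.
  The remaining term, where K acts on \<psi> a, is brought back to a polynomial through the inverse
  of \<psi>.\<close>

lemma K_psi:
  assumes "\<And>i. act (s i) quad = quad"
  shows "K (\<psi> (f * a)) = \<psi> (tder f * a + f * psi_inv \<Phi> al (K (\<psi> a)))"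
proof (induction f rule: mpoly_induct)
  case (const c)
  show ?case by (simp add: psi_pconst_mult K_pconst_mult)
next
  case (add f g)
  then show ?case by (simp add: distrib_right psi_add K_add tder_add)
next
  case (var v f)
  define b where "b = tder f * a + f * psi_inv \<Phi> al (K (\<psi> a))"
  have IH: "K (\<psi> (f * a)) = \<psi> b" using var by (simp add: b_def)
  have "K (\<psi> (pvar v * (f * a))) = \<psi> (pvar v * b + tder (pvar v) * (f * a))"
  proof (cases v)
    case (Inl k)
    show ?thesis
      unfolding Inl tder_Inl
      by (simp add: psi_lam_mult K_Lambda[OF assms] IH psi_add mult.assoc psi_pconst_mult psi_q_mult)
  next
    case (Inr k)
    have "tder (pvar (Inr k)) * (f * a)
        = (\<Sum>j\<in>UNIV. pconst (2 * gram k j) * (pvar (Inr k) * (pvar (Inl j) * (f * a))))"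
      unfolding tder_Inr sum_distrib_right by (intro sum.cong) (simp_all add: mult_ac)
    then show ?thesis
      unfolding Inr
      by (simp add: psi_q_mult K_q IH psi_add psi_sum psi_pconst_mult psi_lam_mult)
  qed
  moreover have "pvar v * b + tder (pvar v) * (f * a)
      = tder (pvar v * f) * a + pvar v * f * psi_inv \<Phi> al (K (\<psi> a))"
    by (simp add: b_def tder_mult algebra_simps)
  ultimately show ?case by (simp add: mult.assoc)
qed

lemma tder_psi_inv:
  assumes quad: "\<And>i. act (s i) quad = quad" and u: "\<And>i. act (s i) u = u" "\<And>i. qdiff i u = 0"
  shows "tder (psi_inv \<Phi> al u) = 0"
proof -
  define f where "f = psi_inv \<Phi> al u"
  \<comment> \<open>The contribution f b of K 1 stands on both sides of the comparison and
    cancels.\<close>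
  define b where "b = psi_inv \<Phi> al (K 1)"
  have fu: "\<psi> f = u" by (simp add: f_def)
  have "\<psi> (tder f + f * b) = K (\<psi> f)" using K_psi[OF quad, of f 1] by (simp add: b_def)
  also have "\<dots> = u * K 1" using K_invariant_mult[OF u, of 1] by (simp add: fu)
  also have "\<dots> = \<psi> (f * b)" using psi_invariant[OF u(1) fu, of b] by (simp add: b_def)
  finally have "\<psi> (tder f) = \<psi> 0" by (simp add: psi_add)
  then show ?thesis using psi_inj unfolding f_def inj_def by blast
qed

end

section \<open>Uniqueness of integrals of motion\<close>

text \<open>Reads a polynomial in \<lambda> and q as a polynomial in q over R[\<lambda>];
  \<open>map_key\<close> along \<open>Inr\<close> and \<open>Inl\<close> separates the two parts of
  an exponent.\<close>

definition qcoeff :: "('l \<Rightarrow>\<^sub>0 nat) \<Rightarrow> ('l + 'l) mpoly \<Rightarrow> 'l mpoly" where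
  "qcoeff e = lin_ext (\<lambda>m. if Poly_Mapping.map_key Inr m = e
     then Poly_Mapping.single (Poly_Mapping.map_key Inl m) 1 else 0)"

lemma lookup_map_key_Inl [simp]: "Poly_Mapping.lookup (Poly_Mapping.map_key Inl m) i = Poly_Mapping.lookup m (Inl i)"
  by (simp add: map_key.rep_eq)

lemma lookup_map_key_Inr [simp]: "Poly_Mapping.lookup (Poly_Mapping.map_key Inr m) i = Poly_Mapping.lookup m (Inr i)"
  by (simp add: map_key.rep_eq)

lemma map_key_Inl_Inr: "Poly_Mapping.map_key Inl (Poly_Mapping.single (Inr j) n + m) = Poly_Mapping.map_key Inl m"
  by (rule poly_mapping_eqI) (simp add: lookup_add lookup_single)

lemma map_key_Inr_Inl: "Poly_Mapping.map_key Inr (Poly_Mapping.single (Inl j) n + m) = Poly_Mapping.map_key Inr m"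
  by (rule poly_mapping_eqI) (simp add: lookup_add lookup_single)

lemma map_key_Inl_Inl:
  "Poly_Mapping.map_key Inl (Poly_Mapping.single (Inl j) n + m) = Poly_Mapping.single j n + Poly_Mapping.map_key Inl m"
  by (rule poly_mapping_eqI) (simp add: lookup_add lookup_single when_def)

lemma map_key_Inr_Inr:
  "Poly_Mapping.map_key Inr (Poly_Mapping.single (Inr j) n + m) = Poly_Mapping.single j n + Poly_Mapping.map_key Inr m"
  by (rule poly_mapping_eqI) (simp add: lookup_add lookup_single when_def)

lemma qcoeff_add: "qcoeff e (f + g) = qcoeff e f + qcoeff e g"
  by (simp add: qcoeff_def lin_ext_add)

lemma qcoeff_0 [simp]: "qcoeff e 0 = 0"
  by (simp add: qcoeff_def)

lemma qcoeff_sum: "qcoeff e (sum f A) = (\<Sum>x\<in>A. qcoeff e (f x))"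
  by (induction A rule: infinite_finite_induct) (simp_all add: qcoeff_add)

lemma qcoeff_pconst_mult: "qcoeff e (pconst c * f) = pconst c * qcoeff e f"
  by (simp add: qcoeff_def lin_ext_pconst_mult)

lemma qcoeff_pconst: "qcoeff e (pconst c) = (if e = 0 then pconst c else 0)"
  unfolding qcoeff_def by (subst (1) pconst_def) auto

lemma qcoeff_Inl: "qcoeff e (pvar (Inl j) * f) = pvar j * qcoeff e f"
  unfolding qcoeff_def
proof (rule lin_ext_pvar_mult)
  fix m :: "'a + 'a \<Rightarrow>\<^sub>0 nat"
  show "(if Poly_Mapping.map_key Inr (Poly_Mapping.single (Inl j) 1 + m) = e
      then Poly_Mapping.single (Poly_Mapping.map_key Inl (Poly_Mapping.single (Inl j) 1 + m)) 1 else 0)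
    = pvar j * (if Poly_Mapping.map_key Inr m = e then Poly_Mapping.single (Poly_Mapping.map_key Inl m) 1 else 0)"
    unfolding map_key_Inr_Inl map_key_Inl_Inl single_var_add by simp
qed (simp_all add: algebra_simps)

lemma qcoeff_Inr:
  "qcoeff e (pvar (Inr j) * f)
    = (if Poly_Mapping.lookup e j = 0 then 0 else qcoeff (e - Poly_Mapping.single j 1) f)"
proof (induction f rule: mpoly_single_induct)
  case (single m c)
  have "Poly_Mapping.single j 1 + Poly_Mapping.map_key Inr m = e
      \<longleftrightarrow> Poly_Mapping.lookup e j \<noteq> 0 \<and> Poly_Mapping.map_key Inr m = e - Poly_Mapping.single j 1"
  proof
    assume "Poly_Mapping.lookup e j \<noteq> 0 \<and> Poly_Mapping.map_key Inr m = e - Poly_Mapping.single j 1"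
    then show "Poly_Mapping.single j 1 + Poly_Mapping.map_key Inr m = e"
      by (intro poly_mapping_eqI) (auto simp: lookup_add lookup_minus lookup_single when_def)
  qed (auto simp: lookup_add)
  then show ?case
    unfolding single_var_add[symmetric] qcoeff_def lin_ext_single map_key_Inr_Inr map_key_Inl_Inr
    by auto
qed (simp_all add: distrib_left qcoeff_add)

lemma lookup_qcoeff:
  "Poly_Mapping.lookup (qcoeff (Poly_Mapping.map_key Inr m) f) (Poly_Mapping.map_key Inl m) = Poly_Mapping.lookup f m"
proof (induction f rule: mpoly_single_induct)
  case (single n c)
  have "m = n" if "Poly_Mapping.map_key Inr n = Poly_Mapping.map_key Inr m"
    "Poly_Mapping.map_key Inl n = Poly_Mapping.map_key Inl m"
  proof (rule poly_mapping_eqI)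
    fix v
    show "Poly_Mapping.lookup m v = Poly_Mapping.lookup n v"
      using that by (cases v) (metis lookup_map_key_Inl, metis lookup_map_key_Inr)
  qed
  then show ?case
    by (auto simp: qcoeff_def pconst_def mult_single lookup_single when_def)
qed (simp_all add: qcoeff_add lookup_add)

lemma qcoeff_eq_0:
  assumes "\<And>e. qcoeff e f = 0"
  shows "f = 0"
proof (rule poly_mapping_eqI)
  fix m
  show "Poly_Mapping.lookup f m = Poly_Mapping.lookup 0 m"
    using lookup_qcoeff[of m f] assms by simp
qed

lemma qcoeff_zero_eq: "qcoeff 0 f = psubst (case_sum pvar (\<lambda>_. 0)) f"
proof (induction f rule: mpoly_induct)
  case (var v f)
  then show ?case by (cases v) (simp_all add: qcoeff_Inl qcoeff_Inr psubst_simps)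
qed (simp_all add: qcoeff_pconst qcoeff_add psubst_simps)

lemma qcoeff_pdiff: "qcoeff e (pdiff (Inl i) f) = pdiff i (qcoeff e f)"
proof (induction f arbitrary: e rule: mpoly_induct)
  case (var v f)
  then show ?case
    by (cases v) (simp_all add: pdiff_pvar_mult qcoeff_add qcoeff_Inl qcoeff_Inr)
qed (simp_all add: qcoeff_pconst pdiff_add qcoeff_add)

context root_base
begin

lemma qcoeff_qdiff: "qcoeff e (qdiff i f) = pconst (real (Poly_Mapping.lookup e i)) * qcoeff e f"
proof (induction f arbitrary: e rule: mpoly_induct)
  case (const c)
  show ?case by (simp add: qcoeff_pconst)
next
  case (add f g)
  then show ?case by (simp add: qdiff_add qcoeff_add distrib_left)
next
  case (var v f)
  show ?case
  proof (cases v)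
    case (Inl j)
    then show ?thesis using var by (simp add: qdiff_mult qcoeff_Inl mult.left_commute)
  next
    case (Inr j)
    show ?thesis
    proof (cases "Poly_Mapping.lookup e j = 0")
      case True
      then show ?thesis by (auto simp: Inr qdiff_mult qdiff_Inr qcoeff_Inr qcoeff_add)
    next
      case False
      define e' where "e' = e - Poly_Mapping.single j 1"
      have l: "real (Poly_Mapping.lookup e' i) = real (Poly_Mapping.lookup e i) - (if i = j then 1 else 0)"
        using False by (auto simp: e'_def lookup_minus lookup_single when_def)
      have q: "qdiff i (pvar (Inr j) * f) = (if i = j then pvar (Inr j) * f else 0) + pvar (Inr j) * qdiff i f"
        by (simp add: qdiff_mult qdiff_Inr)
      have c: "qcoeff e (pvar (Inr j) * g) = qcoeff e' g" for g
        using False by (simp add: qcoeff_Inr e'_def)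
      show ?thesis
        unfolding Inr q by (auto simp: qcoeff_add c var l pconst_diff left_diff_distrib)
    qed
  qed
qed

lemma lin_form_nonzero: "v \<noteq> 0 \<Longrightarrow> lin_form al v \<noteq> 0"
  using L_nonzero[of v] by (auto simp: L_def emb_lam_def)

text \<open>In the coefficient of q^e in \<open>tder f\<close>, the first sum involves only smaller
  exponents and vanishes by induction. The second multiplies the coefficient of f by the linear form
  of \<xi>, which is nonzero for e \<noteq> 0, and there are no zero divisors.\<close>

lemma tder_unique:
  assumes "tder f = 0" "psubst (case_sum pvar (\<lambda>_. 0)) f = 0"
  shows "f = 0"
proof (rule qcoeff_eq_0)
  fix e
  show "qcoeff e f = 0"
  proof (induction "\<Sum>i\<in>UNIV. Poly_Mapping.lookup e i" arbitrary: e rule: less_induct)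
    case less
    show ?case
    proof (cases "e = 0")
      case True
      then show ?thesis using assms(2) by (simp add: qcoeff_zero_eq)
    next
      case False
      have lower: "qcoeff (e - Poly_Mapping.single i 1) f = 0" if "Poly_Mapping.lookup e i \<noteq> 0" for i
      proof (rule less)
        show "(\<Sum>j\<in>UNIV. Poly_Mapping.lookup (e - Poly_Mapping.single i 1) j) < (\<Sum>j\<in>UNIV. Poly_Mapping.lookup e j)"
          using that by (intro sum_strict_mono_ex1)
            (auto simp: lookup_minus lookup_single when_def intro!: exI[of _ i])
      qed
      have 1: "qcoeff e (pconst (gram i i) * pvar (Inr i) * pdiff (Inl i) f) = 0" for i
        using lower[of i] by (simp add: mult.assoc qcoeff_pconst_mult qcoeff_Inr qcoeff_pdiff)
      define \<xi> where "\<xi> = (\<Sum>i\<in>UNIV. (2 * real (Poly_Mapping.lookup e i)) *\<^sub>R coroot (al i))"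
      have 2: "qcoeff e (\<Sum>i\<in>UNIV. \<Sum>j\<in>UNIV. pconst (2 * gram i j) * pvar (Inl j) * qdiff i f)
          = lin_form al \<xi> * qcoeff e f"
      proof -
        have "qcoeff e (\<Sum>i\<in>UNIV. \<Sum>j\<in>UNIV. pconst (2 * gram i j) * pvar (Inl j) * qdiff i f)
          = (\<Sum>i\<in>UNIV. \<Sum>j\<in>UNIV. pconst (2 * real (Poly_Mapping.lookup e i) * gram i j) * pvar j * qcoeff e f)"
          unfolding qcoeff_sum
          by (intro sum.cong refl)
            (simp add: mult.assoc qcoeff_pconst_mult qcoeff_Inl qcoeff_qdiff, simp add: pconst_mult mult_ac)
        also have "\<dots> = (\<Sum>j\<in>UNIV. \<Sum>i\<in>UNIV. pconst (2 * real (Poly_Mapping.lookup e i) * gram i j) * pvar j * qcoeff e f)"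
          by (rule sum.swap)
        also have "\<dots> = lin_form al \<xi> * qcoeff e f"
          by (simp add: lin_form_def \<xi>_def inner_sum_left pconst_sum sum_distrib_right gram_def)
        finally show ?thesis .
      qed
      have "lin_form al \<xi> * qcoeff e f = qcoeff e (tder f)"
        unfolding tder_def qcoeff_add 2 by (simp add: qcoeff_sum 1)
      then have z: "lin_form al \<xi> * qcoeff e f = 0" using assms(1) by simp
      have "\<xi> \<noteq> 0"
      proof
        assume c0: "\<xi> = 0"
        have "\<omega> i \<bullet> \<xi> = 2 * real (Poly_Mapping.lookup e i)" for i
          by (simp add: \<xi>_def inner_sum_right fund_weight_coroot if_distrib sum.delta cong: if_cong)
        then have "Poly_Mapping.lookup e i = 0" for i using c0 by simp
        then have "e = 0" by (intro poly_mapping_eqI) simp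
        then show False using False by simp
      qed
      then show ?thesis using z mpoly_mult_eq_0_iff lin_form_nonzero by blast
    qed
  qed
qed

subsection \<open>Integrals of motion of the Toda lattice\<close>

definition toda_poly :: "('l + 'l) mpoly" where
  "toda_poly = quad + (\<Sum>i\<in>UNIV. pvar (Inr i))"

lemma toda_hamiltonian_eq: "toda_hamiltonian al = toda_fun toda_poly"
  by (rule ext) (simp add: toda_hamiltonian_def toda_poly_def quad_def toda_fun_add toda_fun_sum
      toda_fun_mult gram_def mult.assoc split: prod.split)

lemma pdiff_toda_poly_Inr: "pdiff (Inr i) toda_poly = 1"
  by (simp add: toda_poly_def quad_def pdiff_add pdiff_sum pdiff_mult pdiff_pvar)

lemma pdiff_toda_poly_Inl: "pdiff (Inl i) toda_poly = (\<Sum>j\<in>UNIV. pconst (2 * gram i j) * pvar (Inl j))"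
proof -
  have t: "pdiff (Inl i) (pconst (gram a b) * (pvar (Inl a) * pvar (Inl b)))
      = (if a = i then pconst (gram a b) * pvar (Inl b) else 0)
      + (if b = i then pconst (gram a b) * pvar (Inl a) else 0)" for a b
    by (auto simp: pdiff_mult pdiff_pvar distrib_left)
  have "(\<Sum>a\<in>UNIV. \<Sum>b\<in>UNIV. if a = i then pconst (gram a b) * pvar (Inl b) else 0)
      = (\<Sum>a\<in>UNIV. if a = i then (\<Sum>b\<in>UNIV. pconst (gram a b) * pvar (Inl b)) else (0 :: ('l + 'l) mpoly))"
    by (intro sum.cong) auto
  then have "pdiff (Inl i) toda_poly = (\<Sum>b\<in>UNIV. pconst (gram i b) * pvar (Inl b))
      + (\<Sum>a\<in>UNIV. pconst (gram a i) * pvar (Inl a))"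
    by (simp add: toda_poly_def quad_def pdiff_add pdiff_sum t pdiff_pvar sum.distrib)
  also have "(\<Sum>a\<in>UNIV. pconst (gram a i) * pvar (Inl a)) = (\<Sum>b\<in>UNIV. pconst (gram i b) * pvar (Inl b))"
    by (intro sum.cong refl) (metis gram_commute)
  also have "(\<Sum>b\<in>UNIV. pconst (gram i b) * pvar (Inl b)) + (\<Sum>b\<in>UNIV. pconst (gram i b) * pvar (Inl b))
      = (\<Sum>j\<in>UNIV. pconst (gram i j) * pvar (Inl j) + pconst (gram i j) * pvar (Inl j))"
    by (simp only: sum.distrib)
  also have "\<dots> = (\<Sum>j\<in>UNIV. pconst (2 * gram i j) * pvar (Inl j))"
    by (intro sum.cong) (simp_all add: pconst_mult pconst_numeral)
  finally show ?thesis .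
qed

definition toda_subst :: "('l + 'l) mpoly \<Rightarrow> ('l + 'l) mpoly" where
  "toda_subst = psubst (case_sum (\<lambda>i. pvar (Inl i))
     (\<lambda>i. pconst (- (coroot (al i) \<bullet> coroot (al i))) * pvar (Inr i)))"

lemma toda_subst_pdiff: "toda_subst (pdiff (Inl i) f) = pdiff (Inl i) (toda_subst f)"
proof (induction f rule: mpoly_induct)
  case (var v f)
  then show ?case
    by (cases v) (simp_all add: toda_subst_def pdiff_pvar_mult psubst_simps pdiff_mult pdiff_pvar)
qed (simp_all add: toda_subst_def pdiff_add psubst_simps)

lemma toda_subst_qdiff: "toda_subst (qdiff i f) = qdiff i (toda_subst f)"
proof (induction f rule: mpoly_induct)
  case (var v f)
  then show ?case
    by (cases v) (simp_all add: toda_subst_def psubst_simps qdiff_mult qdiff_Inr)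
qed (simp_all add: toda_subst_def qdiff_add psubst_simps)

text \<open>The derivative of exp (2 s_i) gives the bracket a common factor 2. Substituting negative
  multiples of q_i reverses the sign of one sum, so that both become the corresponding parts of
  -\<open>tder\<close>.\<close>

lemma integral_of_motion_tder:
  assumes "integral_of_motion (toda_hamiltonian al) (toda_fun F)"
  shows "tder (toda_subst F) = 0"
proof -
  define S :: "'l \<Rightarrow> ('l + 'l) mpoly" where
    "S i = (\<Sum>j\<in>UNIV. pconst (2 * gram i j) * pvar (Inl j))" for i
  define G where "G = (\<Sum>i\<in>UNIV. pvar (Inr i) * pdiff (Inl i) F + pconst (-1) * (qdiff i F * S i))"
  have "G = 0"
  proof (rule toda_fun_eq_0)
    fix p
    have "poisson (toda_fun F) (toda_fun toda_poly) p = 2 * toda_fun G p"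
      unfolding poisson_def frechet_derivative_toda_fun toda_deriv_r toda_deriv_s
        pdiff_toda_poly_Inr pdiff_toda_poly_Inl S_def[symmetric] G_def qdiff_def toda_fun_sum sum_distrib_left
      by (intro sum.cong refl) (simp add: toda_fun_add toda_fun_mult algebra_simps)
    moreover have "poisson (toda_fun F) (toda_fun toda_poly) p = 0"
      using assms unfolding integral_of_motion_def toda_hamiltonian_eq by blast
    ultimately show "toda_fun G p = 0" by simp
  qed
  then have "toda_subst G = 0" by (simp add: toda_subst_def)
  moreover have "toda_subst G = - tder (toda_subst F)"
  proof -
    have v: "toda_subst (pvar (Inl j)) = pvar (Inl j)"
      "toda_subst (pvar (Inr j)) = - (pconst (gram j j) * pvar (Inr j))" for j
      by (simp_all add: toda_subst_def gram_def pconst_uminus)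
    have h: "toda_subst (f + g) = toda_subst f + toda_subst g"
      "toda_subst (f * g) = toda_subst f * toda_subst g" "toda_subst (pconst c) = pconst c"
      "toda_subst (sum k A) = (\<Sum>x\<in>A. toda_subst (k x))" for f g c and k :: "'l \<Rightarrow> _" and A
      by (simp_all add: toda_subst_def psubst_simps)
    have "toda_subst G = (\<Sum>i\<in>UNIV. - (pconst (gram i i) * pvar (Inr i) * pdiff (Inl i) (toda_subst F))
        - (\<Sum>j\<in>UNIV. pconst (2 * gram i j) * pvar (Inl j) * qdiff i (toda_subst F)))"
      unfolding G_def S_def h v toda_subst_pdiff toda_subst_qdiff
      by (intro sum.cong refl) (simp add: pconst_uminus sum_distrib_left sum_negf mult_ac)
    then show ?thesis by (simp add: tder_def sum_subtractf sum_negf)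
  qed
  ultimately show ?thesis by simp
qed

lemma act_emb_lam: "act w (emb_lam f) = emb_lam (weyl_act al w f)"
  by (simp add: weyl_act_q_def emb_lam_def weyl_act_def psubst_psubst)

lemma act_emb_lam_invariant: "weyl_invariant \<Phi> al f \<Longrightarrow> act (s i) (emb_lam f) = emb_lam f"
proof -
  assume f: "weyl_invariant \<Phi> al f"
  have "s i \<circ> id \<in> weyl_group \<Phi>"
    by (intro weyl_group.intros simple_root)
  then have "weyl_act al (s i) f = f" using f by (simp add: weyl_invariant_def)
  then show ?thesis by (simp add: act_emb_lam)
qed

lemma qdiff_emb_lam: "qdiff i (emb_lam f) = 0"
  by (induction f rule: mpoly_induct) (simp_all add: emb_lam_def psubst_simps qdiff_add qdiff_mult)

end

context ordered_root_base
begin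

theorem psi_integral_of_motion:
  fixes u :: "'l \<Rightarrow> 'l mpoly" and F :: "'l \<Rightarrow> ('l + 'l) mpoly"
  assumes inv: "\<And>k. weyl_invariant \<Phi> al (u k)"
    and ham: "toda_fun (F k0) = toda_hamiltonian al"
    and int: "\<And>k. integral_of_motion (toda_hamiltonian al) (toda_fun (F k))"
    and F0: "\<And>k. psubst (case_sum pvar (\<lambda>_. 0)) (F k) = u k"
  shows "\<psi> (toda_subst (F k)) = emb_lam (u k)"
proof -
  \<comment> \<open>The invariance of the quadratic form is obtained from this: at q = 0 the
    Hamiltonian restricts to \<open>quad\<close>, which is thus one of the invariants u_k.\<close>
  have "F k0 = toda_poly" using ham by (intro toda_fun_eq) (simp add: toda_hamiltonian_eq)
  then have "u k0 = psubst (case_sum pvar (\<lambda>_. 0)) toda_poly" using F0[of k0] by simp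
  then have "emb_lam (u k0) = quad"
    by (simp add: toda_poly_def quad_def emb_lam_def psubst_simps)
  then have quad: "act (s i) quad = quad" for i using act_emb_lam_invariant[OF inv[of k0], of i] by simp
  define f where "f = psi_inv \<Phi> al (emb_lam (u k))"
  have pf: "\<psi> f = emb_lam (u k)" by (simp add: f_def)
  have "tder f = 0" unfolding f_def
    by (rule tder_psi_inv[OF quad act_emb_lam_invariant[OF inv] qdiff_emb_lam])
  moreover have "tder (toda_subst (F k)) = 0" by (rule integral_of_motion_tder[OF int])
  ultimately have 1: "tder (toda_subst (F k) - f) = 0" by (simp add: tder_diff)
  have "psubst (case_sum pvar (\<lambda>_. 0)) f = psubst (case_sum pvar (\<lambda>_. 0)) (emb_lam (u k))"
    using ev0_psi[of f] pf by simp
  also have "\<dots> = u k" by (simp add: emb_lam_def psubst_psubst)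
  also have "\<dots> = psubst (case_sum pvar (\<lambda>_. 0)) (toda_subst (F k))"
  proof -
    have "psubst (case_sum pvar (\<lambda>_. 0)) (toda_subst (F k)) = psubst (case_sum pvar (\<lambda>_. 0)) (F k)"
      unfolding toda_subst_def psubst_psubst
      by (rule arg_cong[where f = "\<lambda>\<sigma>. psubst \<sigma> (F k)"])
         (auto simp: fun_eq_iff psubst_simps split: sum.split)
    then show ?thesis using F0 by simp
  qed
  finally have 2: "psubst (case_sum pvar (\<lambda>_. 0)) (toda_subst (F k) - f) = 0"
    by (simp add: psubst_diff)
  have "toda_subst (F k) - f = 0" by (rule tder_unique[OF 1 2])
  then show ?thesis using pf by simp
qed

end

section \<open>Algebras of cosets\<close>

lemma mpoly_ring_simps [simp]:
  "carrier mpoly_ring = (UNIV :: 'v mpoly set)" "f \<oplus>\<^bsub>mpoly_ring\<^esub> g = f + g"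
  "f \<otimes>\<^bsub>mpoly_ring\<^esub> g = f * g" "\<zero>\<^bsub>mpoly_ring\<^esub> = (0 :: 'v mpoly)" "\<one>\<^bsub>mpoly_ring\<^esub> = (1 :: 'v mpoly)"
  for f g :: "'v mpoly"
  by (simp_all add: ring_of_type_algebra_def)

lemma cring_mpoly: "cring (mpoly_ring :: 'v mpoly ring)"
  by (rule cring_from_type_algebra)

lemma ring_mpoly: "ring (mpoly_ring :: 'v mpoly ring)"
  by (rule ring_from_type_algebra)

text \<open>An ideal with an explicit finite family of generators, so that \<psi> can be applied to
  a combination term by term.\<close>

definition lin_span :: "('k::finite \<Rightarrow> 'v mpoly) \<Rightarrow> 'v mpoly set" where
  "lin_span g = range (\<lambda>a. \<Sum>k\<in>UNIV. a k * g k)"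

lemma lin_spanI: "x = (\<Sum>k\<in>UNIV. a k * g k) \<Longrightarrow> x \<in> lin_span g"
  by (simp add: lin_span_def)

lemma lin_spanE:
  assumes "x \<in> lin_span g"
  obtains a where "x = (\<Sum>k\<in>UNIV. a k * g k)"
  using assms by (auto simp: lin_span_def)

lemma lin_span_0: "0 \<in> lin_span g"
  by (rule lin_spanI[of _ "\<lambda>_. 0"]) simp

lemma lin_span_add:
  assumes "x \<in> lin_span g" "y \<in> lin_span g"
  shows "x + y \<in> lin_span g"
proof -
  obtain a b where "x = (\<Sum>k\<in>UNIV. a k * g k)" "y = (\<Sum>k\<in>UNIV. b k * g k)"
    using assms by (elim lin_spanE)
  then show ?thesis
    by (intro lin_spanI[of _ "\<lambda>k. a k + b k"]) (simp add: distrib_right sum.distrib)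
qed

lemma lin_span_mult:
  assumes "x \<in> lin_span g"
  shows "c * x \<in> lin_span g"
proof -
  obtain a where "x = (\<Sum>k\<in>UNIV. a k * g k)" using assms by (elim lin_spanE)
  then show ?thesis
    by (intro lin_spanI[of _ "\<lambda>k. c * a k"]) (simp add: sum_distrib_left mult.assoc)
qed

lemma lin_span_generator: "g k \<in> lin_span g"
proof (rule lin_spanI)
  have "(\<Sum>j\<in>UNIV. (if j = k then 1 else 0) * g j) = (\<Sum>j\<in>UNIV. if j = k then g j else 0)"
    by (intro sum.cong) auto
  then show "g k = (\<Sum>j\<in>UNIV. (if j = k then 1 else 0) * g j)" by simp
qed

lemma genideal_mpoly:
  fixes g :: "'k::finite \<Rightarrow> 'v mpoly"
  shows "Idl\<^bsub>mpoly_ring\<^esub> (range g) = lin_span g"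
proof
  interpret ring "mpoly_ring :: 'v mpoly ring" by (rule ring_mpoly)
  have inv: "inv\<^bsub>add_monoid mpoly_ring\<^esub> x = - x" for x :: "'v mpoly"
    using minus_equality[of "- x" x] by (simp add: a_inv_def)
  have "ideal (lin_span g) mpoly_ring"
  proof (rule idealI)
    show "subgroup (lin_span g) (add_monoid mpoly_ring)"
    proof (rule subgroup.intro)
      fix x assume "x \<in> lin_span g"
      then show "inv\<^bsub>add_monoid mpoly_ring\<^esub> x \<in> lin_span g"
        unfolding inv using lin_span_mult[of x g "-1"] by simp
    qed (auto simp: lin_span_0 lin_span_add)
  next
    fix a x assume "a \<in> lin_span g"
    then show "x \<otimes>\<^bsub>mpoly_ring\<^esub> a \<in> lin_span g" "a \<otimes>\<^bsub>mpoly_ring\<^esub> x \<in> lin_span g"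
      using lin_span_mult[of a g x] by (simp_all add: mult.commute)
  qed (rule ring_mpoly)
  moreover have "range g \<subseteq> lin_span g" using lin_span_generator by blast
  ultimately show "Idl\<^bsub>mpoly_ring\<^esub> (range g) \<subseteq> lin_span g" by (rule genideal_minimal)
  interpret I: ideal "Idl\<^bsub>mpoly_ring\<^esub> (range g)" mpoly_ring by (rule genideal_ideal) simp
  show "lin_span g \<subseteq> Idl\<^bsub>mpoly_ring\<^esub> (range g)"
  proof
    fix x assume "x \<in> lin_span g"
    then obtain a where x: "x = (\<Sum>k\<in>UNIV. a k * g k)" by (elim lin_spanE)
    have gk: "g k \<in> Idl\<^bsub>mpoly_ring\<^esub> (range g)" for k using genideal_self[of "range g"] by auto
    have "(\<Sum>k\<in>A. a k * g k) \<in> Idl\<^bsub>mpoly_ring\<^esub> (range g)" for A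
    proof (induction A rule: infinite_finite_induct)
      case (insert k A)
      then show ?case using I.a_closed I.I_l_closed[OF gk, of "a k"] by simp
    qed (use I.zero_closed in simp_all)
    then show "x \<in> Idl\<^bsub>mpoly_ring\<^esub> (range g)" using x by simp
  qed
qed

lemma emb_q_add: "emb_q (f + g) = emb_q f + emb_q g"
  by (simp add: emb_q_def psubst_simps)

lemma emb_q_mult: "emb_q (f * g) = emb_q f * emb_q g"
  by (simp add: emb_q_def psubst_simps)

lemma emb_q_1: "emb_q 1 = 1"
  by (simp add: emb_q_def)

lemma emb_q_pconst: "emb_q (pconst c) = pconst c"
  by (simp add: emb_q_def)

abbreviation (input) coset :: "'v mpoly set \<Rightarrow> 'v mpoly \<Rightarrow> 'v mpoly set" where
  "coset I f \<equiv> I +>\<^bsub>mpoly_ring\<^esub> f"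

lemma mem_coset: "g \<in> coset I f \<longleftrightarrow> g - f \<in> I"
proof
  assume "g - f \<in> I"
  then show "g \<in> coset I f" by (auto simp: a_r_coset_def' intro!: bexI[of _ "g - f"])
qed (auto simp: a_r_coset_def')

text \<open>Common form of the two algebras to be compared; they differ only in the ideal and in the
  product on representatives.\<close>

definition coset_algebra :: "('l + 'l) mpoly set \<Rightarrow> (('l + 'l) mpoly \<Rightarrow> ('l + 'l) mpoly \<Rightarrow> ('l + 'l) mpoly)
    \<Rightarrow> ('l mpoly, ('l + 'l) mpoly set) module" where
  "coset_algebra I \<mu> =
     \<lparr>carrier = a_rcosets\<^bsub>mpoly_ring\<^esub> I,
      mult = (\<lambda>A B. \<Union>f\<in>A. \<Union>g\<in>B. coset I (\<mu> f g)),
      one = coset I 1, zero = I, add = set_add mpoly_ring, smult = coset_smult I\<rparr>"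

lemma star_algebra_eq:
  "star_algebra \<Phi> al = coset_algebra (coinv_ideal_q \<Phi> al) (\<lambda>f g. psi \<Phi> al (psi_inv \<Phi> al f * psi_inv \<Phi> al g))"
  by (simp add: star_algebra_def coset_algebra_def star_def[abs_def])

lemma quotient_algebra_eq: "quotient_algebra I = coset_algebra I (*)"
  by (simp add: quotient_algebra_def coset_algebra_def ring.defs module.defs FactRing_def rcoset_mult_def[abs_def])

text \<open>I is an ideal for the product \<mu>, which may differ from the product of polynomials;
  the latter enters only through scalars from R[q].\<close>

locale mult_ideal =
  fixes I :: "('l + 'l) mpoly set" and \<mu> :: "('l + 'l) mpoly \<Rightarrow> ('l + 'l) mpoly \<Rightarrow> ('l + 'l) mpoly"
  assumes zero: "0 \<in> I" and add: "f \<in> I \<Longrightarrow> g \<in> I \<Longrightarrow> f + g \<in> I"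
    and smult: "f \<in> I \<Longrightarrow> emb_q p * f \<in> I" and mult: "f \<in> I \<Longrightarrow> \<mu> f g \<in> I"
    and mu_add: "\<mu> (f + f') g = \<mu> f g + \<mu> f' g" and mu_commute: "\<mu> f g = \<mu> g f"
    and mu_assoc: "\<mu> (\<mu> f g) h = \<mu> f (\<mu> g h)" and mu_one: "\<mu> 1 f = f"
    and mu_smult: "\<mu> (emb_q p * f) g = emb_q p * \<mu> f g"
begin

lemma uminus: "f \<in> I \<Longrightarrow> - f \<in> I"
  using smult[of f "pconst (-1)"] unfolding emb_q_pconst by (simp add: pconst_uminus)

lemma diff: "f \<in> I \<Longrightarrow> g \<in> I \<Longrightarrow> f - g \<in> I"
  using add[of f "- g"] uminus by simp

lemma coset_eq: "coset I f = coset I g \<longleftrightarrow> f - g \<in> I"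
proof
  assume "coset I f = coset I g"
  moreover have "f \<in> coset I f" using zero by (simp add: mem_coset)
  ultimately show "f - g \<in> I" by (simp add: mem_coset)
next
  assume fg: "f - g \<in> I"
  show "coset I f = coset I g"
  proof (rule Set.set_eqI)
    fix h
    have "h - g = (h - f) + (f - g)" "h - f = (h - g) - (f - g)" by simp_all
    then show "h \<in> coset I f \<longleftrightarrow> h \<in> coset I g" unfolding mem_coset using add diff fg by metis
  qed
qed

lemma self_mem: "f \<in> coset I f"
  using zero by (simp add: mem_coset)

lemma carrier_eq: "carrier (coset_algebra I \<mu>) = range (coset I)"
  by (auto simp: coset_algebra_def A_RCOSETS_def')

lemma mu_diff: "\<mu> f g - \<mu> f' g = \<mu> (f - f') g"
  using mu_add[of "f - f'" f' g] by simp

lemma mu_cong: "f - f' \<in> I \<Longrightarrow> g - g' \<in> I \<Longrightarrow> \<mu> f g - \<mu> f' g' \<in> I"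
proof -
  assume f: "f - f' \<in> I" and g: "g - g' \<in> I"
  have "\<mu> f g - \<mu> f' g = \<mu> (f - f') g" "\<mu> f' g - \<mu> f' g' = \<mu> (g - g') f'"
    using mu_diff[of f g f'] mu_diff[of g f' g'] by (simp_all only: mu_commute[of f'])
  then have "(\<mu> f g - \<mu> f' g) + (\<mu> f' g - \<mu> f' g') \<in> I" using f g mult add by simp
  then show ?thesis by simp
qed

lemma coset_mult: "coset I f \<otimes>\<^bsub>coset_algebra I \<mu>\<^esub> coset I g = coset I (\<mu> f g)"
proof -
  have "coset I (\<mu> f' g') = coset I (\<mu> f g)" if "f' \<in> coset I f" "g' \<in> coset I g" for f' g'
    using that mu_cong by (simp add: mem_coset coset_eq)
  then have "(\<Union>f'\<in>coset I f. \<Union>g'\<in>coset I g. coset I (\<mu> f' g')) = coset I (\<mu> f g)"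
    using self_mem[of f] self_mem[of g] by blast
  then show ?thesis by (simp add: coset_algebra_def)
qed

lemma coset_add: "coset I f \<oplus>\<^bsub>coset_algebra I \<mu>\<^esub> coset I g = coset I (f + g)"
proof (rule Set.set_eqI)
  fix h
  have "h \<in> coset I (f + g) \<longleftrightarrow> (\<exists>a\<in>coset I f. \<exists>b\<in>coset I g. h = a + b)"
  proof
    assume "h \<in> coset I (f + g)"
    then have "h - g \<in> coset I f" by (simp add: mem_coset algebra_simps)
    then show "\<exists>a\<in>coset I f. \<exists>b\<in>coset I g. h = a + b"
      using self_mem[of g] by (intro bexI[of _ "h - g"] bexI[of _ g]) auto
  next
    assume "\<exists>a\<in>coset I f. \<exists>b\<in>coset I g. h = a + b"
    then obtain a b where ab: "a - f \<in> I" "b - g \<in> I" "h = a + b" by (auto simp: mem_coset)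
    have "h - (f + g) = (a - f) + (b - g)" using ab by simp
    then show "h \<in> coset I (f + g)" unfolding mem_coset using add ab by metis
  qed
  then show "h \<in> coset I f \<oplus>\<^bsub>coset_algebra I \<mu>\<^esub> coset I g \<longleftrightarrow> h \<in> coset I (f + g)"
    by (auto simp: coset_algebra_def set_add_def')
qed

lemma coset_smult_eq: "p \<odot>\<^bsub>coset_algebra I \<mu>\<^esub> coset I f = coset I (emb_q p * f)"
proof -
  have "coset I (emb_q p * f') = coset I (emb_q p * f)" if "f' \<in> coset I f" for f'
    using that smult[of "f' - f" p] by (simp add: mem_coset coset_eq right_diff_distrib)
  then have "(\<Union>f'\<in>coset I f. coset I (emb_q p * f')) = coset I (emb_q p * f)"
    using self_mem[of f] by blast
  then show ?thesis by (simp add: coset_algebra_def coset_smult_def)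
qed

lemma coset_one: "\<one>\<^bsub>coset_algebra I \<mu>\<^esub> = coset I 1"
  by (simp add: coset_algebra_def)

lemma coset_zero: "\<zero>\<^bsub>coset_algebra I \<mu>\<^esub> = coset I 0"
  by (auto simp: coset_algebra_def mem_coset)

lemmas coset_simps = carrier_eq coset_mult coset_add coset_smult_eq coset_one coset_zero

lemma algebra_coset_algebra: "algebra mpoly_ring (coset_algebra I \<mu>)"
proof (rule algebraI)
  show "cring (coset_algebra I \<mu>)"
  proof (rule cringI)
    show "abelian_group (coset_algebra I \<mu>)"
    proof (rule abelian_groupI)
      fix x assume "x \<in> carrier (coset_algebra I \<mu>)"
      then obtain f where "x = coset I f" by (auto simp: coset_simps)
      then have "coset I (- f) \<oplus>\<^bsub>coset_algebra I \<mu>\<^esub> x = \<zero>\<^bsub>coset_algebra I \<mu>\<^esub>"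
        by (simp add: coset_simps)
      then show "\<exists>y\<in>carrier (coset_algebra I \<mu>). y \<oplus>\<^bsub>coset_algebra I \<mu>\<^esub> x = \<zero>\<^bsub>coset_algebra I \<mu>\<^esub>"
        by (auto simp: coset_simps)
    qed (auto simp: coset_simps add_ac)
    show "comm_monoid (coset_algebra I \<mu>)"
    proof (rule comm_monoidI)
      show "x \<otimes>\<^bsub>coset_algebra I \<mu>\<^esub> y = y \<otimes>\<^bsub>coset_algebra I \<mu>\<^esub> x"
        if "x \<in> carrier (coset_algebra I \<mu>)" "y \<in> carrier (coset_algebra I \<mu>)" for x y
      proof -
        from that obtain f g where "x = coset I f" "y = coset I g" by (auto simp: carrier_eq)
        then show ?thesis using mu_commute[of f g] by (simp add: coset_mult)
      qed
    qed (auto simp: coset_simps mu_assoc mu_one)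
  qed (auto simp: coset_simps mu_add)
qed (auto simp: coset_simps cring_mpoly mu_smult emb_q_add emb_q_mult emb_q_1 distrib_left distrib_right
    mult.assoc)

end

lemma coset_algebra_iso:
  assumes I: "mult_ideal I \<mu>" and J: "mult_ideal J \<nu>"
    and \<phi>: "bij \<phi>" "\<phi> ` I = J" "\<And>f g. \<phi> (f + g) = \<phi> f + \<phi> g" "\<And>f g. \<phi> (\<mu> f g) = \<nu> (\<phi> f) (\<phi> g)"
      "\<phi> 1 = 1" "\<And>p f. \<phi> (emb_q p * f) = emb_q p * \<phi> f"
  shows "\<And>f. \<phi> ` coset I f = coset J (\<phi> f)"
    and "algebra_iso mpoly_ring (coset_algebra I \<mu>) (coset_algebra J \<nu>) (image \<phi>)"
proof -
  interpret I: mult_ideal I \<mu> by fact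
  interpret J: mult_ideal J \<nu> by fact
  have diff: "\<phi> (f - g) = \<phi> f - \<phi> g" for f g using \<phi>(3)[of "f - g" g] by simp
  have inj: "inj \<phi>" and surj: "surj \<phi>" using \<phi>(1) by (auto simp: bij_def)
  have mem: "\<phi> f \<in> J \<longleftrightarrow> f \<in> I" for f using \<phi>(2) inj by (auto simp: inj_def)
  show c: "\<phi> ` coset I f = coset J (\<phi> f)" for f
  proof (rule Set.set_eqI)
    fix h
    obtain g where g: "h = \<phi> g" using surj by (auto simp: surj_def)
    have "h \<in> \<phi> ` coset I f \<longleftrightarrow> g \<in> coset I f" using inj by (auto simp: g inj_def)
    also have "\<dots> \<longleftrightarrow> h \<in> coset J (\<phi> f)" by (simp add: mem_coset g mem flip: diff)
    finally show "h \<in> \<phi> ` coset I f \<longleftrightarrow> h \<in> coset J (\<phi> f)" .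
  qed
  have "image \<phi> \<in> ring_iso (coset_algebra I \<mu>) (coset_algebra J \<nu>)"
  proof (rule ring_iso_memI)
    show "bij_betw (image \<phi>) (carrier (coset_algebra I \<mu>)) (carrier (coset_algebra J \<nu>))"
    proof (rule bij_betw_imageI)
      show "inj_on (image \<phi>) (carrier (coset_algebra I \<mu>))" using inj by (simp add: inj_on_image inj_image_eq_iff inj_on_def)
      have "image \<phi> ` range (coset I) = coset J ` range \<phi>" by (simp add: image_image c)
      then show "image \<phi> ` carrier (coset_algebra I \<mu>) = carrier (coset_algebra J \<nu>)"
        by (simp add: I.carrier_eq J.carrier_eq surj)
    qed
  next
    fix x y assume "x \<in> carrier (coset_algebra I \<mu>)" "y \<in> carrier (coset_algebra I \<mu>)"
    then obtain f g where "x = coset I f" "y = coset I g" by (auto simp: I.carrier_eq)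
    then show "\<phi> ` (x \<otimes>\<^bsub>coset_algebra I \<mu>\<^esub> y) = \<phi> ` x \<otimes>\<^bsub>coset_algebra J \<nu>\<^esub> \<phi> ` y"
      "\<phi> ` (x \<oplus>\<^bsub>coset_algebra I \<mu>\<^esub> y) = \<phi> ` x \<oplus>\<^bsub>coset_algebra J \<nu>\<^esub> \<phi> ` y"
      by (simp_all only: I.coset_simps J.coset_simps c \<phi>(3-6))
  next
    fix x assume "x \<in> carrier (coset_algebra I \<mu>)"
    then show "\<phi> ` x \<in> carrier (coset_algebra J \<nu>)" by (auto simp: I.carrier_eq J.carrier_eq c)
  qed (simp only: I.coset_one J.coset_one c \<phi>(5))
  moreover have "\<phi> ` (p \<odot>\<^bsub>coset_algebra I \<mu>\<^esub> x) = p \<odot>\<^bsub>coset_algebra J \<nu>\<^esub> \<phi> ` x"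
    if "x \<in> carrier (coset_algebra I \<mu>)" for p x
  proof -
    from that obtain f where "x = coset I f" by (auto simp: I.carrier_eq)
    then show ?thesis by (simp only: I.coset_simps J.coset_simps c \<phi>(6))
  qed
  ultimately show "algebra_iso mpoly_ring (coset_algebra I \<mu>) (coset_algebra J \<nu>) (image \<phi>)"
    unfolding algebra_iso_def
    using I.algebra_coset_algebra J.algebra_coset_algebra by blast
qed

section \<open>The isomorphism\<close>

lemma emb_lam_mult: "emb_lam (f * g) = emb_lam f * emb_lam g"
  by (simp add: emb_lam_def psubst_simps)

text \<open>I_W \<otimes> R[q] is the ideal of R[\<lambda>, q] generated by the u_k. The point is
  that sums of pure tensors absorb any polynomial factor: \<lambda>_j goes into the left factor,
  which lies in an ideal, and q_j into the right one.\<close>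

lemma coinv_ideal_q_eq:
  fixes u :: "'l::finite \<Rightarrow> 'l mpoly"
  assumes "Idl\<^bsub>mpoly_ring\<^esub> (range u) = coinv_ideal \<Phi> al"
  shows "coinv_ideal_q \<Phi> al = lin_span (\<lambda>k. emb_lam (u k))"
proof
  let ?I = "coinv_ideal_q \<Phi> al" and ?S = "lin_span (\<lambda>k. emb_lam (u k)) :: ('l + 'l) mpoly set"
  have ci: "coinv_ideal \<Phi> al = lin_span u"
    using assms genideal_mpoly[of u] by simp
  have gen: "emb_lam f * emb_q g \<in> ?S" if "f \<in> coinv_ideal \<Phi> al" for f g
  proof -
    from that obtain a where "f = (\<Sum>k\<in>UNIV. a k * u k)" unfolding ci by (elim lin_spanE)
    then show ?thesis
      by (intro lin_spanI[of _ "\<lambda>k. emb_lam (a k) * emb_q g"])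
         (simp add: emb_lam_def psubst_simps sum_distrib_right sum_distrib_left mult_ac)
  qed
  show "?I \<subseteq> ?S"
  proof
    fix x assume "x \<in> ?I"
    then obtain n f g where x: "x = (\<Sum>k<n. emb_lam (f k) * emb_q (g k))"
      and f: "\<forall>k<n::nat. f k \<in> coinv_ideal \<Phi> al" unfolding coinv_ideal_q_def by blast
    have "(\<Sum>k<m. emb_lam (f k) * emb_q (g k)) \<in> ?S" if "m \<le> n" for m
      using that
    proof (induction m)
      case (Suc m)
      then show ?case using f gen by (simp add: lin_span_add)
    qed (simp add: lin_span_0)
    then show "x \<in> ?S" using x by simp
  qed
  have I_0: "0 \<in> ?I" unfolding coinv_ideal_q_def
    by (intro CollectI exI[of _ "0::nat"]) auto
  have I_gen: "x + emb_lam f * emb_q g \<in> ?I" if "x \<in> ?I" "f \<in> coinv_ideal \<Phi> al" for x f g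
  proof -
    from that obtain n F G where x: "x = (\<Sum>k<n. emb_lam (F k) * emb_q (G k))"
      and F: "\<forall>k<n::nat. F k \<in> coinv_ideal \<Phi> al" unfolding coinv_ideal_q_def by blast
    have "x + emb_lam f * emb_q g = (\<Sum>k<Suc n. emb_lam ((F(n := f)) k) * emb_q ((G(n := g)) k))"
      by (simp add: x)
    moreover have "\<forall>k<Suc n. (F(n := f)) k \<in> coinv_ideal \<Phi> al" using F that by auto
    ultimately show ?thesis unfolding coinv_ideal_q_def by blast
  qed
  have ci_mult: "a * f \<in> coinv_ideal \<Phi> al" if "f \<in> coinv_ideal \<Phi> al" for a f
    using that unfolding ci by (rule lin_span_mult)
  \<comment> \<open>The summand x makes the sum case of the induction work: the pieces of b are
    added one after the other to an element already in the set.\<close>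
  have I_mult: "x + b * (emb_lam f * emb_q g) \<in> ?I" if "x \<in> ?I" "f \<in> coinv_ideal \<Phi> al" for x b f g
    using that
  proof (induction b arbitrary: x f g rule: mpoly_induct)
    case (const c)
    have "pconst c * (emb_lam f * emb_q g) = emb_lam (pconst c * f) * emb_q g"
      by (simp add: emb_lam_mult mult.assoc) (simp add: emb_lam_def)
    then show ?case using I_gen const ci_mult by simp
  next
    case (add b b')
    then show ?case by (simp add: distrib_right flip: add.assoc)
  next
    case (var v b)
    show ?case
    proof (cases v)
      case (Inl j)
      have "pvar v * b * (emb_lam f * emb_q g) = b * (emb_lam (pvar j * f) * emb_q g)"
        by (simp add: Inl emb_lam_mult) (simp add: emb_lam_def mult_ac)
      then show ?thesis using var ci_mult by simp
    next
      case (Inr j)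
      have "pvar v * b * (emb_lam f * emb_q g) = b * (emb_lam f * emb_q (pvar j * g))"
        by (simp add: Inr emb_q_mult) (simp add: emb_q_def mult_ac)
      then show ?thesis using var by simp
    qed
  qed
  have uk: "u k \<in> coinv_ideal \<Phi> al" for k
    unfolding ci by (rule lin_span_generator)
  show "?S \<subseteq> ?I"
  proof
    fix x assume "x \<in> ?S"
    then obtain b where x: "x = (\<Sum>k\<in>UNIV. b k * emb_lam (u k))" by (elim lin_spanE)
    have "(\<Sum>k\<in>A. b k * emb_lam (u k)) \<in> ?I" for A
    proof (induction A rule: infinite_finite_induct)
      case (insert k A)
      then show ?case using I_mult[OF insert.IH uk, of "b k" k 1] by (simp add: emb_q_1 add.commute)
    qed (simp_all add: I_0)
    then show "x \<in> ?I" using x by simp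
  qed
qed

theorem theorem1p6:
  fixes \<Phi> :: "'a::euclidean_space set"
    and al :: "'l::{finite,linorder} \<Rightarrow> 'a"
    and u :: "'l \<Rightarrow> 'l mpoly"
    and F :: "'l \<Rightarrow> ('l + 'l) mpoly"
  assumes "irreducible_root_system \<Phi>"
    and "simple_roots \<Phi> al"
    and "\<And>k. weyl_invariant \<Phi> al (u k)"
    and "\<And>k. \<exists>d. homogeneous d (u k)"
    and "alg_independent u"
    and "Idl\<^bsub>mpoly_ring\<^esub> (range u) = coinv_ideal \<Phi> al"
    and "toda_fun (F (Min UNIV)) = toda_hamiltonian al"
    and "\<And>k. integral_of_motion (toda_hamiltonian al) (toda_fun (F k))"
    and "independent_functions (\<lambda>k. toda_fun (F k))"
    and "\<And>k. psubst (case_sum pvar (\<lambda>_. 0)) (F k) = u k"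
  shows "\<exists>h. (\<forall>f. h (coinv_ideal_q \<Phi> al +>\<^bsub>mpoly_ring\<^esub> f)
                   = toda_ideal al F +>\<^bsub>mpoly_ring\<^esub> psi_inv \<Phi> al f) \<and>
             algebra_iso mpoly_ring (star_algebra \<Phi> al) (quotient_algebra (toda_ideal al F)) h"
proof -
  interpret ordered_root_base \<Phi> al
    using assms(1,2) by unfold_locales (auto simp: irreducible_root_system_def)
  let ?I = "coinv_ideal_q \<Phi> al" and ?J = "toda_ideal al F"
  let ?\<mu> = "\<lambda>f g. \<psi> (psi_inv \<Phi> al f * psi_inv \<Phi> al g)"
  have J: "?J = lin_span (\<lambda>k. toda_subst (F k))"
    unfolding toda_ideal_def toda_subst_def[symmetric] by (rule genideal_mpoly)
  have I: "?I = lin_span (\<lambda>k. emb_lam (u k))"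
    by (rule coinv_ideal_q_eq[OF assms(6)])
  \<comment> \<open>Through \<psi>, the k-th generator acts as multiplication by the invariant u_k,
    so the ideals correspond generator by generator, with coefficients transformed by
    \<psi>.\<close>
  have core: "\<psi> (toda_subst (F k) * a) = emb_lam (u k) * \<psi> a" for k a
    by (rule psi_invariant[OF act_emb_lam_invariant[OF assms(3)]
          psi_integral_of_motion[of u F, OF assms(3,7,8,10)]])
  have psi_gen: "\<psi> (\<Sum>k\<in>UNIV. a k * toda_subst (F k)) = (\<Sum>k\<in>UNIV. \<psi> (a k) * emb_lam (u k))" for a
  proof -
    have "\<psi> (a k * toda_subst (F k)) = \<psi> (a k) * emb_lam (u k)" for k
      using core[of k "a k"] by (simp only: mult.commute)
    then show ?thesis by (simp only: psi_sum)
  qed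
  have JI: "\<psi> f \<in> ?I" if "f \<in> ?J" for f
  proof -
    from that obtain a where "f = (\<Sum>k\<in>UNIV. a k * toda_subst (F k))" unfolding J by (elim lin_spanE)
    then show ?thesis unfolding I by (intro lin_spanI[of _ "\<lambda>k. \<psi> (a k)"]) (simp add: psi_gen)
  qed
  have IJ: "psi_inv \<Phi> al f \<in> ?J" if "f \<in> ?I" for f
  proof -
    from that obtain b where "f = (\<Sum>k\<in>UNIV. b k * emb_lam (u k))" unfolding I by (elim lin_spanE)
    then have "\<psi> (\<Sum>k\<in>UNIV. psi_inv \<Phi> al (b k) * toda_subst (F k)) = f" by (simp add: psi_gen)
    then have "psi_inv \<Phi> al f = (\<Sum>k\<in>UNIV. psi_inv \<Phi> al (b k) * toda_subst (F k))"
      by (rule inv_f_eq[OF psi_inj])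
    then show ?thesis unfolding J by (rule lin_spanI)
  qed
  have inv_add: "psi_inv \<Phi> al (f + g) = psi_inv \<Phi> al f + psi_inv \<Phi> al g" for f g
    by (rule inv_f_eq[OF psi_inj]) (simp add: psi_add)
  have inv_smult: "psi_inv \<Phi> al (emb_q p * f) = emb_q p * psi_inv \<Phi> al f" for p f
    by (rule inv_f_eq[OF psi_inj]) (simp add: psi_emb_q_mult)
  have inv_one: "psi_inv \<Phi> al 1 = 1" by (rule inv_f_eq[OF psi_inj]) simp
  have J_add: "f + g \<in> ?J" if "f \<in> ?J" "g \<in> ?J" for f g
    using that unfolding J by (rule lin_span_add)
  have J_mult: "c * f \<in> ?J" if "f \<in> ?J" for c f
    using that unfolding J by (rule lin_span_mult)
  have J_zero: "0 \<in> ?J" unfolding J by (rule lin_span_0)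
  have mJ: "mult_ideal ?J (*)"
  proof
    show "f * g \<in> ?J" if "f \<in> ?J" for f g using J_mult[OF that, of g] by (simp add: mult.commute)
    show "f * g = g * f" for f g :: "('l + 'l) mpoly" by (rule mult.commute)
  qed (simp_all add: J_zero J_add J_mult distrib_right mult.assoc)
  \<comment> \<open>Each closure property is transported from the ideal on the other side, where
    \<mu> becomes the ordinary product.\<close>
  have mI: "mult_ideal ?I ?\<mu>"
  proof
    show "0 \<in> ?I" using JI[OF J_zero] by simp
    show "f + g \<in> ?I" if "f \<in> ?I" "g \<in> ?I" for f g
      using JI[OF J_add[OF IJ[OF that(1)] IJ[OF that(2)]]] by (simp add: psi_add)
    show "emb_q p * f \<in> ?I" if "f \<in> ?I" for f p
      using JI[OF J_mult[OF IJ[OF that], of "emb_q p"]] by (simp add: psi_emb_q_mult)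
    show "?\<mu> f g \<in> ?I" if "f \<in> ?I" for f g
      using JI[OF J_mult[OF IJ[OF that], of "psi_inv \<Phi> al g"]] by (simp add: mult.commute)
    show "?\<mu> (emb_q p * f) g = emb_q p * ?\<mu> f g" for p f g
      by (simp add: inv_smult mult.assoc psi_emb_q_mult)
    show "?\<mu> f g = ?\<mu> g f" for f g by (simp only: mult.commute)
  qed (simp_all add: inv_add inv_one distrib_right psi_add mult.assoc)
  have bij: "bij (psi_inv \<Phi> al)" using psi_bij by (rule bij_imp_bij_inv)
  have im: "psi_inv \<Phi> al ` ?I = ?J"
  proof
    show "?J \<subseteq> psi_inv \<Phi> al ` ?I"
    proof
      fix f assume "f \<in> ?J"
      then show "f \<in> psi_inv \<Phi> al ` ?I" using JI[of f] by (intro image_eqI[of _ _ "\<psi> f"]) simp_all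
    qed
  qed (use IJ in blast)
  note iso = coset_algebra_iso[OF mI mJ bij im inv_add psi_inv_psi inv_one inv_smult]
  show ?thesis
    unfolding star_algebra_eq quotient_algebra_eq
    using iso by (intro exI[of _ "image (psi_inv \<Phi> al)"] conjI allI)
qed

end
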